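(* Let $\Re(\gamma)>-1$, $\Re(\mu)>0$, $\Re(\beta)>0$, $w\in\mathbb{C}\setminus\{0\}$, $1\le m\le q$, $0\le n\le p$ and $\Re(\beta)+\min_{1\le j\le m}\Re\left(\frac{\alpha b_j}{\beta_j}\right)>0$. Let $x>a$, with $\left|\frac{x-u}{x}\right|<1$ for the integration variable $u$. Then $$\left(I^{\gamma,\mu}_{a+}\,\mathcal{H}^{w;m,n;\alpha}_{a+;p,q;\beta}\phi\right)(x)=\frac{x^{\gamma}(x-a)^{-\mu-\gamma}}{\Gamma(\mu)\Gamma(-\gamma)}\int_a^x (x-u)^{\mu+\beta-1}\;H^{0,0:m,n+1;1,2}_{0,1:p+1,q;2,1}\left[\begin{array}{c} w(x-u)^{\alpha}\\ -\frac{x-u}{x}\end{array}\left|\begin{array}{l}-:(1-\beta,\alpha),(a_j,\alpha_j)_{1,p};(1+\gamma,1),(1-\mu,1)\\ (1-\mu-\beta;\alpha,1):(b_j,\beta_j)_{1,q};(0,1)\end{array}\right.\right]\phi(u)\,du .$$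
   Context: Throughout, $a\in\mathbb{R}$, $x>a$, $\alpha>0$, $\mu,\gamma,\beta\in\mathbb{C}$; powers are principal values; $(a_j,\alpha_j)_{1,p}$ stands for the list $(a_1,\alpha_1),\dots,(a_p,\alpha_p)$, with $a_j,b_j\in\mathbb{C}$ and $\alpha_j,\beta_j>0$; a dash denotes an empty parameter list. Fox $H$-function: for $z\neq0$, $$H^{m,n}_{p,q}[z]=H^{m,n}_{p,q}\left[z\left|\begin{array}{c}(a_j,\alpha_j)_{1,p}\\(b_j,\beta_j)_{1,q}\end{array}\right.\right]=\frac1{2\pi i}\int_L\varphi(\xi)z^{\xi}\,d\xi,\qquad \varphi(\xi)=\frac{\prod_{j=1}^m\Gamma(b_j-\beta_j\xi)\prod_{j=1}^n\Gamma(1-a_j+\alpha_j\xi)}{\prod_{j=m+1}^q\Gamma(1-b_j+\beta_j\xi)\prod_{j=n+1}^p\Gamma(a_j-\alpha_j\xi)},$$ where $L$ is a suitable contour (running from $-i\infty$ to $+i\infty$, or a loop) separating the poles of $\Gamma(b_j-\beta_j\xi)$, $j\le m$ (to its right), from those of $\Gamma(1-a_j+\alpha_j\xi)$, $j\le n$ (to its left); as usual these two sets of poles are assumed disjoint and the integral is assumed to converge absolutely. $H$-function of two variables: $$H^{0,n_1:m_2,n_2;m_3,n_3}_{p_1,q_1:p_2,q_2;p_3,q_3}\left[\begin{array}{c}X\\ Y\end{array}\left|\begin{array}{l}(a'_j;\alpha'_j,A_j)_{1,p_1}:(c_j,\gamma_j)_{1,p_2};(e_j,E_j)_{1,p_3}\\(b'_j;\beta'_j,B_j)_{1,q_1}:(d_j,\delta_j)_{1,q_2};(f_j,F_j)_{1,q_3}\end{array}\right.\right]=\frac{1}{(2\pi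 i)^2}\int_{L_1}\int_{L_2}\Phi(\xi,\eta)\,\theta_1(\xi)\,\theta_2(\eta)\,X^{\xi}Y^{\eta}\,d\eta\,d\xi,$$ $$\Phi(\xi,\eta)=\frac{\prod_{j=1}^{n_1}\Gamma(1-a'_j+\alpha'_j\xi+A_j\eta)}{\prod_{j=n_1+1}^{p_1}\Gamma(a'_j-\alpha'_j\xi-A_j\eta)\prod_{j=1}^{q_1}\Gamma(1-b'_j+\beta'_j\xi+B_j\eta)},$$ where $\theta_1$ is the function $\varphi$ above formed with indices $m_2,n_2,p_2,q_2$ and parameters $(c_j,\gamma_j),(d_j,\delta_j)$, and $\theta_2$ is the one formed with $m_3,n_3,p_3,q_3$ and $(e_j,E_j),(f_j,F_j)$. The contours $L_1,L_2$ separate the poles of the Gamma functions whose arguments decrease in the variable from the poles of those whose arguments increase (these sets of poles being disjoint); when $|Y|<1$, $L_2$ may be taken as a loop starting and ending at $+\infty$ (from below to above the real axis) and enclosing exactly the poles of the factors $\Gamma(f_j-F_j\eta)$, $j\le m_3$. Operators: $$(I^{\gamma,\mu}_{a+}f)(x)=\frac{(x-a)^{-\mu-\gamma}}{\Gamma(\mu)}\int_a^x\frac{t^{\gamma}f(t)}{(x-t)^{1-\mu}}\,dt\qquad(\Re(\gamma)>-1,\ \Re(\mu)>0),$$ $$\left(\mathcal{H}^{w;m,n;\alpha}_{a+;p,q;\beta}\varphi\right)(x)=\int_a^x(x-t)^{\beta-1}H^{m,n}_{p,q}[w(x-t)^{\alpha}]\varphi(t)\,dt,$$ where the $H$-function has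 parameters $(a_j,\alpha_j)_{1,p}$, $(b_j,\beta_j)_{1,q}$. The function $\phi$ is any complex-valued integrable function for which the integrals occurring on both sides, including the iterated ones, exist and converge absolutely. *)

theory Defs
  imports "HOL-Complex_Analysis.Complex_Analysis"
begin

section \<open>Infinite contours\<close>

text \<open>
  A contour is a continuous, piecewise continuously differentiable map from the whole real line
  to the complex plane.  It runs from \<open>-\<i>\<infinity>\<close> to \<open>+\<i>\<infinity>\<close> inside a vertical strip, or it is a loop
  inside a horizontal strip that starts and ends at \<open>+\<infinity>\<close>, respectively at \<open>-\<infinity>\<close>.
\<close>

datatype contour_kind = Vertical | Right_Loop | Left_Loop

primrec contour_ends :: "contour_kind \<Rightarrow> (real \<Rightarrow> complex) \<Rightarrow> bool" where
  "contour_ends Vertical L \<longleftrightarrow>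
     bounded (range (Re \<circ> L)) \<and>
     filterlim (Im \<circ> L) at_bot at_bot \<and> filterlim (Im \<circ> L) at_top at_top"
| "contour_ends Right_Loop L \<longleftrightarrow>
     bounded (range (Im \<circ> L)) \<and>
     filterlim (Re \<circ> L) at_top at_bot \<and> filterlim (Re \<circ> L) at_top at_top \<and>
     (\<exists>R. antimono_on {..-R} (Re \<circ> L) \<and> mono_on {R..} (Re \<circ> L))"
| "contour_ends Left_Loop L \<longleftrightarrow>
     bounded (range (Im \<circ> L)) \<and>
     filterlim (Re \<circ> L) at_bot at_bot \<and> filterlim (Re \<circ> L) at_bot at_top \<and>
     (\<exists>R. mono_on {..-R} (Re \<circ> L) \<and> antimono_on {R..} (Re \<circ> L))"

text \<open>
  The side of \<open>L\<close> on which a point \<open>p\<close> lies is read off from the total variation of the argument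
  of \<open>L t - p\<close>, divided by \<open>2\<pi>\<close>.  (\<^const>\<open>winding_number\<close> is also meaningful for open paths, and
  its real part is then this variation along the path.)

  For a vertical contour it is \<open>1/2\<close> when \<open>p\<close> is on the left and \<open>-1/2\<close> when \<open>p\<close> is on the right.
  For a loop at \<open>+\<infinity>\<close> traversed from below to above it is \<open>-1\<close> when \<open>p\<close> is enclosed (right side)
  and \<open>0\<close> otherwise.  For a loop at \<open>-\<infinity>\<close> traversed from below to above it is \<open>1\<close> when \<open>p\<close> is
  enclosed (left side) and \<open>0\<close> otherwise.  In particular the direction in which a loop is
  traversed is fixed by these values.
\<close>

definition has_arg_variation :: "(real \<Rightarrow> complex) \<Rightarrow> complex \<Rightarrow> real \<Rightarrow> bool" where
  "has_arg_variation L p v \<longleftrightarrow>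
     p \<notin> range L \<and>
     ((\<lambda>T. Re (winding_number (L \<circ> linepath (- T) T) p)) \<longlongrightarrow> v) at_top"

primrec left_variation :: "contour_kind \<Rightarrow> real" where
  "left_variation Vertical = 1 / 2"
| "left_variation Right_Loop = 0"
| "left_variation Left_Loop = 1"

definition left_of :: "contour_kind \<Rightarrow> (real \<Rightarrow> complex) \<Rightarrow> complex \<Rightarrow> bool" where
  "left_of k L p \<longleftrightarrow> has_arg_variation L p (left_variation k)"

definition right_of :: "contour_kind \<Rightarrow> (real \<Rightarrow> complex) \<Rightarrow> complex \<Rightarrow> bool" where
  "right_of k L p \<longleftrightarrow> has_arg_variation L p (left_variation k - 1)"


section \<open>The H-function\<close>

text \<open>
  A parameter list \<open>(a\<^sub>1, \<alpha>\<^sub>1), \<dots>, (a\<^sub>p, \<alpha>\<^sub>p)\<close> is a list of pairs; \<open>p\<close> and \<open>q\<close> are the lengths of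
  the lists.  \<^const>\<open>rGamma\<close> is the entire function \<open>1/\<Gamma>\<close>.
\<close>

type_synonym fox_params = "(complex \<times> real) list"

definition fox_kernel :: "nat \<Rightarrow> nat \<Rightarrow> fox_params \<Rightarrow> fox_params \<Rightarrow> complex \<Rightarrow> complex" where
  "fox_kernel m n ap bq \<xi> =
     (\<Prod>(b, B)\<leftarrow>take m bq. Gamma (b - of_real B * \<xi>)) *
     (\<Prod>(a, A)\<leftarrow>take n ap. Gamma (1 - a + of_real A * \<xi>)) *
     (\<Prod>(b, B)\<leftarrow>drop m bq. rGamma (1 - b + of_real B * \<xi>)) *
     (\<Prod>(a, A)\<leftarrow>drop n ap. rGamma (a - of_real A * \<xi>))"

definition fox_right_poles :: "nat \<Rightarrow> fox_params \<Rightarrow> complex set" where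
  "fox_right_poles m bq = {\<xi>. \<exists>(b, B)\<in>set (take m bq). b - of_real B * \<xi> \<in> \<int>\<^sub>\<le>\<^sub>0}"

definition fox_left_poles :: "nat \<Rightarrow> fox_params \<Rightarrow> complex set" where
  "fox_left_poles n ap = {\<xi>. \<exists>(a, A)\<in>set (take n ap). 1 - a + of_real A * \<xi> \<in> \<int>\<^sub>\<le>\<^sub>0}"

text \<open>
  The existence of a contour in the following sense forces the two sets of poles to be disjoint.
\<close>

definition fox_contour ::
    "contour_kind \<Rightarrow> nat \<Rightarrow> nat \<Rightarrow> fox_params \<Rightarrow> fox_params \<Rightarrow> (real \<Rightarrow> complex) \<Rightarrow> bool" where
  "fox_contour k m n ap bq L \<longleftrightarrow>
     L piecewise_C1_differentiable_on UNIV \<and> contour_ends k L \<and>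
     (\<forall>\<xi>\<in>fox_right_poles m bq. right_of k L \<xi>) \<and>
     (\<forall>\<xi>\<in>fox_left_poles n ap. left_of k L \<xi>)"

definition fox_H_integrand ::
    "nat \<Rightarrow> nat \<Rightarrow> fox_params \<Rightarrow> fox_params \<Rightarrow> (real \<Rightarrow> complex) \<Rightarrow> complex \<Rightarrow> real \<Rightarrow> complex" where
  "fox_H_integrand m n ap bq L z s =
     fox_kernel m n ap bq (L s) * z powr L s * vector_derivative L (at s)"

definition fox_H ::
    "nat \<Rightarrow> nat \<Rightarrow> fox_params \<Rightarrow> fox_params \<Rightarrow> (real \<Rightarrow> complex) \<Rightarrow> complex \<Rightarrow> complex" where
  "fox_H m n ap bq L z =
     1 / (2 * of_real pi * \<i>) * (LINT s|lborel. fox_H_integrand m n ap bq L z s)"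


section \<open>The H-function of two variables\<close>

type_synonym fox2_params = "(complex \<times> real \<times> real) list"

definition fox2_Phi ::
    "nat \<Rightarrow> fox2_params \<Rightarrow> fox2_params \<Rightarrow> complex \<Rightarrow> complex \<Rightarrow> complex" where
  "fox2_Phi n1 ap1 bq1 \<xi> \<eta> =
     (\<Prod>(a, \<alpha>, A)\<leftarrow>take n1 ap1. Gamma (1 - a + of_real \<alpha> * \<xi> + of_real A * \<eta>)) *
     (\<Prod>(a, \<alpha>, A)\<leftarrow>drop n1 ap1. rGamma (a - of_real \<alpha> * \<xi> - of_real A * \<eta>)) *
     (\<Prod>(b, \<beta>, B)\<leftarrow>bq1. rGamma (1 - b + of_real \<beta> * \<xi> + of_real B * \<eta>))"

text \<open>
  The poles of the first \<open>n\<^sub>1\<close> factors of \<^const>\<open>fox2_Phi\<close>, whose arguments increase in both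
  variables, have to lie to the left of the contour in either variable.
\<close>

definition fox2_contours ::
    "contour_kind \<Rightarrow> contour_kind \<Rightarrow> nat \<Rightarrow> fox2_params \<Rightarrow>
     nat \<Rightarrow> nat \<Rightarrow> fox_params \<Rightarrow> fox_params \<Rightarrow> nat \<Rightarrow> nat \<Rightarrow> fox_params \<Rightarrow> fox_params \<Rightarrow>
     (real \<Rightarrow> complex) \<Rightarrow> (real \<Rightarrow> complex) \<Rightarrow> bool" where
  "fox2_contours k1 k2 n1 ap1 m2 n2 cs ds m3 n3 es fs L1 L2 \<longleftrightarrow>
     fox_contour k1 m2 n2 cs ds L1 \<and> fox_contour k2 m3 n3 es fs L2 \<and>
     (\<forall>(a, \<alpha>, A)\<in>set (take n1 ap1).
        (\<forall>\<eta>\<in>range L2. \<forall>\<xi>. 1 - a + of_real \<alpha> * \<xi> + of_real A * \<eta> \<in> \<int>\<^sub>\<le>\<^sub>0 \<longrightarrow> left_of k1 L1 \<xi>) \<and>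
        (\<forall>\<xi>\<in>range L1. \<forall>\<eta>. 1 - a + of_real \<alpha> * \<xi> + of_real A * \<eta> \<in> \<int>\<^sub>\<le>\<^sub>0 \<longrightarrow> left_of k2 L2 \<eta>))"

definition fox_H2_integrand ::
    "nat \<Rightarrow> fox2_params \<Rightarrow> fox2_params \<Rightarrow>
     nat \<Rightarrow> nat \<Rightarrow> fox_params \<Rightarrow> fox_params \<Rightarrow> nat \<Rightarrow> nat \<Rightarrow> fox_params \<Rightarrow> fox_params \<Rightarrow>
     (real \<Rightarrow> complex) \<Rightarrow> (real \<Rightarrow> complex) \<Rightarrow> complex \<Rightarrow> complex \<Rightarrow> real \<Rightarrow> real \<Rightarrow> complex" where
  "fox_H2_integrand n1 ap1 bq1 m2 n2 cs ds m3 n3 es fs L1 L2 X Y s r =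
     fox2_Phi n1 ap1 bq1 (L1 s) (L2 r) *
     fox_kernel m2 n2 cs ds (L1 s) * fox_kernel m3 n3 es fs (L2 r) *
     X powr L1 s * Y powr L2 r *
     vector_derivative L1 (at s) * vector_derivative L2 (at r)"

definition fox_H2 ::
    "nat \<Rightarrow> fox2_params \<Rightarrow> fox2_params \<Rightarrow>
     nat \<Rightarrow> nat \<Rightarrow> fox_params \<Rightarrow> fox_params \<Rightarrow> nat \<Rightarrow> nat \<Rightarrow> fox_params \<Rightarrow> fox_params \<Rightarrow>
     (real \<Rightarrow> complex) \<Rightarrow> (real \<Rightarrow> complex) \<Rightarrow> complex \<Rightarrow> complex \<Rightarrow> complex" where
  "fox_H2 n1 ap1 bq1 m2 n2 cs ds m3 n3 es fs L1 L2 X Y =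
     1 / (2 * of_real pi * \<i>)\<^sup>2 *
     (LINT s|lborel. LINT r|lborel.
        fox_H2_integrand n1 ap1 bq1 m2 n2 cs ds m3 n3 es fs L1 L2 X Y s r)"


section \<open>The operators\<close>

definition EK_integral ::
    "real \<Rightarrow> complex \<Rightarrow> complex \<Rightarrow> (real \<Rightarrow> complex) \<Rightarrow> real \<Rightarrow> complex" where
  "EK_integral a \<gamma> \<mu> f x =
     of_real (x - a) powr (- \<mu> - \<gamma>) / Gamma \<mu> *
     (LINT t:{a<..<x}|lebesgue. of_real t powr \<gamma> * f t / of_real (x - t) powr (1 - \<mu>))"

definition fox_H_operator ::
    "real \<Rightarrow> complex \<Rightarrow> nat \<Rightarrow> nat \<Rightarrow> real \<Rightarrow> fox_params \<Rightarrow> fox_params \<Rightarrow> complex \<Rightarrow>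
     (real \<Rightarrow> complex) \<Rightarrow> (real \<Rightarrow> complex) \<Rightarrow> real \<Rightarrow> complex" where
  "fox_H_operator a w m n \<alpha> ap bq \<beta> L \<phi> x =
     (LINT t:{a<..<x}|lebesgue.
        of_real (x - t) powr (\<beta> - 1) *
        fox_H m n ap bq L (w * of_real ((x - t) powr \<alpha>)) * \<phi> t)"

end

theory Submission
  imports Defs
begin

text \<open>
  Inserting the Mellin-Barnes integral of the \<open>H\<close>-function on the left and integrating over \<open>t\<close>
  first leaves, for fixed \<open>u\<close> and \<open>\<xi>\<close>, Euler's integral of
  \<open>t\<^sup>\<gamma> (x - t)\<^sup>\<mu>\<^sup>-\<^sup>1 (t - u)\<^sup>b\<^sup>-\<^sup>1\<close> with \<open>b = \<beta> + \<alpha> \<xi>\<close>.  It equals \<open>\<Gamma>(b)\<close> times powers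
  of \<open>x\<close> and \<open>x - u\<close> times \<open>F(\<mu> + b)\<close>, where the hypergeometric series \<open>F\<close> in \<open>v = (x - u)/x\<close>,
  normalised by the reciprocal Gamma function, is entire in its parameter.  On the right, the
  residues of the \<open>\<eta>\<close>-integrand at \<open>0, 1, 2, \<dots>\<close> sum up to \<open>2\<pi>\<i> \<Gamma>(-\<gamma>) F(\<mu> + b)\<close>.  Both sides
  thus are integrals over \<open>u\<close> of the same function of \<open>\<xi>\<close>, integrated along \<open>L\<close> and along \<open>L\<^sub>1\<close>.

  It remains to replace \<open>L\<close> by \<open>L\<^sub>1\<close>, which in addition has to separate the poles of \<open>\<Gamma>(\<beta> + \<alpha> \<xi>)\<close>.
  Absolute convergence of the left-hand side forces \<open>Re (\<beta> + \<alpha> \<xi>) \<ge> 0\<close> on all of \<open>L\<close>, with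
  equality at the pole \<open>-\<beta>/\<alpha>\<close> only if that singularity is removable, so \<open>L\<close> has these poles on the
  correct side as well.  The two contours are then joined far out by segments.  On small cells away
  from poles and zeros the integrand varies by a bounded factor only, and absolute integrability
  makes it small at some point of each contour in such a cell, hence on the joining segment.
\<close>

section \<open>Arguments along contours\<close>

text \<open>No growth or decay of the integrand is at hand, only absolute convergence along contours
  of arbitrary shape, so the joining segments are controlled through ratios of values at nearby
  points. For a Fox kernel such a ratio is bounded only up to a power
  \<open>r powr (d * Re (z - w))\<close> of the distance \<open>r\<close>; the sign of the exponent
  at the two ends of a segment disposes of it. For vertical contours every far cell will do. For
  right loops the cells have to dodge infinitely many poles and zeros, which leaves cells of a fixed
  size at arbitrarily large abscissae.

  How \<open>L\<close> lies relative to the poles of \<Gamma>(\<beta> + \<alpha> \<xi>) can be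
  learned only from values \<open>u\<close> at which \<phi> does not vanish: for \<phi> = 0 the
  convergence of the left-hand side says nothing about \<open>L\<close>. Hence the contour is
  changed separately for almost every \<open>u\<close>, inside the
  \<open>u\<close>-integral.\<close>

lemma piecewise_C1_UNIV_E:
  fixes L :: "real \<Rightarrow> complex"
  assumes "L piecewise_C1_differentiable_on UNIV"
  obtains S where "finite S" "continuous_on UNIV L"
    "\<And>s. s \<notin> S \<Longrightarrow> (L has_vector_derivative vector_derivative L (at s)) (at s)"
    "continuous_on (- S) (\<lambda>s. vector_derivative L (at s))"
proof -
  obtain S where S: "finite S" "L C1_differentiable_on (UNIV - S)" "continuous_on UNIV L"
    using assms unfolding piecewise_C1_differentiable_on_def by blast
  show thesis
    by (rule that[of S]) (use S in \<open>auto simp: C1_differentiable_on_eq vector_derivative_works Compl_eq_Diff_UNIV\<close>)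
qed

lemma valid_path_arc:
  fixes L :: "real \<Rightarrow> complex"
  assumes L: "L piecewise_C1_differentiable_on UNIV" and ab: "a < b"
  shows "valid_path (L \<circ> linepath a b)"
  unfolding valid_path_def
proof (rule piecewise_C1_differentiable_compose)
  show "linepath a b piecewise_C1_differentiable_on {0..1}"
    using valid_path_linepath valid_path_def by blast
  show "L piecewise_C1_differentiable_on linepath a b ` {0..1}"
    using L piecewise_C1_differentiable_on_subset by blast
  show "finite ({0..1} \<inter> linepath a b -` {x})" for x
    by (rule finite_subset[of _ "{(x - a) / (b - a)}"])
       (use ab in \<open>auto simp: linepath_def field_simps\<close>)
qed

lemma path_image_arc:
  "a \<le> b \<Longrightarrow> path_image (L \<circ> linepath a b) = L ` {a..b::real}"
  by (simp add: path_image_compose closed_segment_eq_real_ivl)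

lemma pathstart_arc [simp]: "pathstart (L \<circ> linepath a b) = L a"
  and pathfinish_arc [simp]: "pathfinish (L \<circ> linepath a b) = L b"
  by (simp_all add: pathstart_compose pathfinish_compose)

lemma has_contour_integral_arc:
  fixes L :: "real \<Rightarrow> complex"
  assumes L: "L piecewise_C1_differentiable_on UNIV" and ab: "a < b"
    and int: "((\<lambda>s. f (L s) * vector_derivative L (at s)) has_integral I) {a..b}"
  shows "(f has_contour_integral I) (L \<circ> linepath a b)"
proof -
  obtain S where S: "finite S" "continuous_on UNIV L"
    "\<And>s. s \<notin> S \<Longrightarrow> (L has_vector_derivative vector_derivative L (at s)) (at s)"
    using L by (rule piecewise_C1_UNIV_E) blast
  have img: "(\<lambda>x. (x - a) / (b - a)) ` {a..b} = {0..1}"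
    using image_affinity_atLeastAtMost_div_diff[of "b - a" "a / (b - a)" a b] ab
    by (simp add: diff_divide_distrib) (simp flip: diff_divide_distrib)
  have *: "((\<lambda>x. f (L ((b - a) * x + a)) * vector_derivative L (at ((b - a) * x + a)))
            has_integral (1 / (b - a)) * I) {0..1}"
    using has_integral_affinity [OF int[unfolded cbox_interval[symmetric]], where m="b-a" and c=a, simplified] ab
    by (simp add: img scaleR_conv_of_real flip: diff_divide_distrib)
  define T where "T = (\<lambda>t. (b - a) * t + a) -` S"
  have fin: "finite T"
    unfolding T_def by (rule finite_vimageI) (use ab S in \<open>auto simp: inj_on_def\<close>)
  have lin: "L \<circ> linepath a b = (\<lambda>x. L ((b - a) * x + a))"
    by (auto simp: linepath_def fun_eq_iff algebra_simps)
  have vd: "vector_derivative (L \<circ> linepath a b) (at x) = (b-a) *\<^sub>R vector_derivative L (at ((b-a) * x + a))"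
    if "x \<notin> T" for x
    unfolding lin
  proof (rule vector_derivative_at [OF vector_diff_chain_at [simplified o_def]])
    show "((\<lambda>x. (b - a) * x + a) has_vector_derivative b - a) (at x)"
      by (intro derivative_eq_intros | simp)+
    show "(L has_vector_derivative vector_derivative L (at ((b - a) * x + a))) (at ((b - a) * x + a))"
      using S(3) that unfolding T_def by simp
  qed
  show ?thesis
    unfolding has_contour_integral
  proof (rule has_integral_spike_finite [OF fin])
    show "((\<lambda>x. (b - a) *\<^sub>R (f (L ((b - a) * x + a)) * vector_derivative L (at ((b - a) * x + a))))
        has_integral I) {0..1}"
      using has_integral_cmul [OF *, where c = "b-a"] ab by (simp add: scaleR_conv_of_real)
  next
    fix x assume "x \<in> {0..1} - T"
    then show "f ((L \<circ> linepath a b) x) * vector_derivative (L \<circ> linepath a b) (at x) =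
        (b - a) *\<^sub>R (f (L ((b - a) * x + a)) * vector_derivative L (at ((b - a) * x + a)))"
      using vd[of x] fun_cong[OF lin, of x] by (simp add: scaleR_conv_of_real)
  qed
qed

text \<open>Dividing by \<open>e\<close> turns the cut of the logarithm away from the path, so
  \<open>Ln ((z - p) / e)\<close> is a primitive of \<open>1 / (z - p)\<close> along it.\<close>

lemma winding_number_Arg:
  assumes g: "valid_path g" and slit: "\<And>z. z \<in> path_image g \<Longrightarrow> (z - p) / e \<notin> \<real>\<^sub>\<le>\<^sub>0"
    and e: "e \<noteq> 0"
  shows "Re (winding_number g p) =
    (Arg ((pathfinish g - p) / e) - Arg ((pathstart g - p) / e)) / (2 * pi)"
proof -
  have p: "p \<notin> path_image g" using slit[of p] by auto
  have "((\<lambda>z. 1 / (z - p)) has_contour_integral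
     (Ln ((pathfinish g - p) / e) - Ln ((pathstart g - p) / e))) g"
  proof (rule contour_integral_primitive[OF _ g subset_refl])
    fix z assume z: "z \<in> path_image g"
    with p have "z \<noteq> p" by auto
    then show "((\<lambda>z. Ln ((z - p) / e)) has_field_derivative 1 / (z - p)) (at z within path_image g)"
      using slit[OF z] e by (auto intro!: derivative_eq_intros)
  qed
  moreover have "(pathfinish g - p) / e \<noteq> 0" "(pathstart g - p) / e \<noteq> 0"
    using slit[of "pathfinish g"] slit[of "pathstart g"] by (metis pathfinish_in_path_image pathstart_in_path_image nonpos_Reals_zero_I)+
  ultimately show ?thesis
    using Re_winding_number[OF g p] by (simp add: contour_integral_unique Arg_eq_Im_Ln)
qed

lemma winding_number_arc_split:
  fixes L :: "real \<Rightarrow> complex"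
  assumes L: "L piecewise_C1_differentiable_on UNIV" and ab: "a < b" "b < c" and p: "p \<notin> L ` {a..c}"
  shows "winding_number (L \<circ> linepath a c) p =
    winding_number (L \<circ> linepath a b) p + winding_number (L \<circ> linepath b c) p"
proof -
  have wn: "winding_number (L \<circ> linepath x y) p = 1 / (2 * pi * \<i>) * integral {x..y} (\<lambda>s. vector_derivative L (at s) / (L s - p))"
    and i: "(\<lambda>s. vector_derivative L (at s) / (L s - p)) integrable_on {x..y}"
    if xy: "x < y" "{x..y} \<subseteq> {a..c}" for x y
  proof -
    have px: "p \<notin> L ` {x..y}" using xy p by blast
    show i: "(\<lambda>s. vector_derivative L (at s) / (L s - p)) integrable_on {x..y}"
      by (rule winding_number_exp_integral(1))
        (use piecewise_C1_differentiable_on_subset[OF L] xy px in auto)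
    have "((\<lambda>w. 1 / (w - p)) has_contour_integral integral {x..y} (\<lambda>s. vector_derivative L (at s) / (L s - p))) (L \<circ> linepath x y)"
      by (rule has_contour_integral_arc[OF L xy(1)]) (use i in \<open>simp add: has_integral_integral\<close>)
    then show "winding_number (L \<circ> linepath x y) p = 1 / (2 * pi * \<i>) * integral {x..y} (\<lambda>s. vector_derivative L (at s) / (L s - p))"
      using winding_number_valid_path[OF valid_path_arc[OF L xy(1)]] px xy
      by (simp add: path_image_arc contour_integral_unique)
  qed
  have "integral {a..b} (\<lambda>s. vector_derivative L (at s) / (L s - p)) +
      integral {b..c} (\<lambda>s. vector_derivative L (at s) / (L s - p)) =
      integral {a..c} (\<lambda>s. vector_derivative L (at s) / (L s - p))"
    by (rule Henstock_Kurzweil_Integration.integral_combine) (use i[of a c] ab in auto)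
  then show ?thesis using wn[of a b] wn[of b c] wn[of a c] ab by (simp flip: add_divide_distrib)
qed

text \<open>The arc carries the total variation \<open>v\<close> less that of the two infinite
  tails. Relative to the directions \<open>e1\<close> and \<open>e2\<close> of escape the arguments
  tend to 0, so each tail is measured by the argument at its finite end alone.\<close>

lemma winding_number_arc_tails:
  fixes L :: "real \<Rightarrow> complex"
  assumes L: "L piecewise_C1_differentiable_on UNIV" and v: "has_arg_variation L p v" and ab: "a < b"
    and e: "e1 \<noteq> 0" "e2 \<noteq> 0"
    and up: "\<And>s. s \<ge> b \<Longrightarrow> (L s - p) / e1 \<notin> \<real>\<^sub>\<le>\<^sub>0" "((\<lambda>s. Arg ((L s - p) / e1)) \<longlongrightarrow> 0) at_top"
    and lo: "\<And>s. s \<le> a \<Longrightarrow> (L s - p) / e2 \<notin> \<real>\<^sub>\<le>\<^sub>0" "((\<lambda>s. Arg ((L s - p) / e2)) \<longlongrightarrow> 0) at_bot"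
  shows "Re (winding_number (L \<circ> linepath a b) p) =
     v + (Arg ((L b - p) / e1) - Arg ((L a - p) / e2)) / (2 * pi)"
proof -
  have p: "p \<notin> range L" and lim: "((\<lambda>T. Re (winding_number (L \<circ> linepath (- T) T) p)) \<longlongrightarrow> v) at_top"
    using v by (auto simp: has_arg_variation_def)
  have eq: "Re (winding_number (L \<circ> linepath a b) p) = Re (winding_number (L \<circ> linepath (-T) T) p)
     - (Arg ((L T - p) / e1) - Arg ((L b - p) / e1)) / (2 * pi)
     - (Arg ((L a - p) / e2) - Arg ((L (-T) - p) / e2)) / (2 * pi)" if T: "T > \<bar>a\<bar>" "T > \<bar>b\<bar>" for T
  proof -
    have 1: "winding_number (L \<circ> linepath (-T) T) p = winding_number (L \<circ> linepath (-T) a) p + winding_number (L \<circ> linepath a T) p"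
      by (rule winding_number_arc_split[OF L]) (use T p in auto)
    have 2: "winding_number (L \<circ> linepath a T) p = winding_number (L \<circ> linepath a b) p + winding_number (L \<circ> linepath b T) p"
      by (rule winding_number_arc_split[OF L]) (use T p ab in auto)
    have 3: "Re (winding_number (L \<circ> linepath b T) p) = (Arg ((L T - p) / e1) - Arg ((L b - p) / e1)) / (2 * pi)"
      using winding_number_Arg[OF valid_path_arc[OF L], of b T p e1] up(1) T e by (fastforce simp: path_image_arc)
    have 4: "Re (winding_number (L \<circ> linepath (-T) a) p) = (Arg ((L a - p) / e2) - Arg ((L (-T) - p) / e2)) / (2 * pi)"
      using winding_number_Arg[OF valid_path_arc[OF L], of "-T" a p e2] lo(1) T e by (fastforce simp: path_image_arc)
    show ?thesis using 1 2 3 4 by simp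
  qed
  have lo': "((\<lambda>T. Arg ((L (-T) - p) / e2)) \<longlongrightarrow> 0) at_top"
    using lo(2) by (simp add: filterlim_at_bot_mirror)
  have "((\<lambda>T. Re (winding_number (L \<circ> linepath (-T) T) p)
     - (Arg ((L T - p) / e1) - Arg ((L b - p) / e1)) / (2 * pi)
     - (Arg ((L a - p) / e2) - Arg ((L (-T) - p) / e2)) / (2 * pi)) \<longlongrightarrow>
     v - (0 - Arg ((L b - p) / e1)) / (2*pi) - (Arg ((L a - p) / e2) - 0) / (2*pi)) at_top"
    by (intro tendsto_intros lim up(2) lo') auto
  moreover have "eventually (\<lambda>T. Re (winding_number (L \<circ> linepath a b) p) = Re (winding_number (L \<circ> linepath (-T) T) p)
     - (Arg ((L T - p) / e1) - Arg ((L b - p) / e1)) / (2 * pi)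
     - (Arg ((L a - p) / e2) - Arg ((L (-T) - p) / e2)) / (2 * pi)) at_top"
    using eventually_gt_at_top[of "\<bar>a\<bar>"] eventually_gt_at_top[of "\<bar>b\<bar>"] by eventually_elim (use eq in blast)
  ultimately have "((\<lambda>T::real. Re (winding_number (L \<circ> linepath a b) p)) \<longlongrightarrow>
     v - (0 - Arg ((L b - p) / e1)) / (2*pi) - (Arg ((L a - p) / e2) - 0) / (2*pi)) at_top"
    using tendsto_cong by fastforce
  then show ?thesis
    by (auto simp: tendsto_const_iff diff_divide_distrib)
qed

text \<open>\<open>e1\<close> and \<open>e2\<close> are the asymptotic directions of the two ends:
  \<i> and -\<i> for vertical contours, 1 and 1 for right loops. A half plane is required instead of
  a slit plane because, being convex, it also contains the joining segments.\<close>

definition arg_tails :: "(real \<Rightarrow> complex) \<Rightarrow> complex \<Rightarrow> real \<Rightarrow> real \<Rightarrow> complex \<Rightarrow> complex \<Rightarrow> bool" where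
  "arg_tails L p a b e1 e2 \<longleftrightarrow>
     (\<forall>s\<ge>b. Re ((L s - p) / e1) > 0) \<and> ((\<lambda>s. Arg ((L s - p) / e1)) \<longlongrightarrow> 0) at_top \<and>
     (\<forall>s\<le>a. Re ((L s - p) / e2) > 0) \<and> ((\<lambda>s. Arg ((L s - p) / e2)) \<longlongrightarrow> 0) at_bot"

lemma winding_number_arg_tails:
  assumes "L piecewise_C1_differentiable_on UNIV" "has_arg_variation L p v" "a < b" "e1 \<noteq> 0" "e2 \<noteq> 0"
    and "arg_tails L p a b e1 e2"
  shows "Re (winding_number (L \<circ> linepath a b) p) =
     v + (Arg ((L b - p) / e1) - Arg ((L a - p) / e2)) / (2 * pi)"
  by (rule winding_number_arc_tails) (use assms in \<open>force simp: arg_tails_def complex_nonpos_Reals_iff\<close>)+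

lemma winding_number_linepath_Arg:
  assumes "Re ((x - p) / e) > 0" "Re ((y - p) / e) > 0" and e: "e \<noteq> 0"
  shows "Re (winding_number (linepath x y) p) = (Arg ((y - p) / e) - Arg ((x - p) / e)) / (2 * pi)"
    and "p \<notin> closed_segment x y"
proof -
  have *: "Re ((z - p) / e) > 0" if z: "z \<in> closed_segment x y" for z
  proof -
    obtain u where u: "0 \<le> u" "u \<le> 1" "z = (1 - u) *\<^sub>R x + u *\<^sub>R y"
      using z by (auto simp: in_segment)
    have "(z - p) / e = (1 - u) *\<^sub>R ((x - p) / e) + u *\<^sub>R ((y - p) / e)"
      using e by (simp add: u scaleR_conv_of_real field_simps)
    then have "Re ((z - p) / e) = (1 - u) * Re ((x - p) / e) + u * Re ((y - p) / e)"
      by simp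
    also have "\<dots> > 0"
      using assms(1,2) u by (cases "u = 0") (auto intro!: add_nonneg_pos mult_pos_pos)
    finally show ?thesis .
  qed
  show "p \<notin> closed_segment x y" using *[of p] by auto
  show "Re (winding_number (linepath x y) p) = (Arg ((y - p) / e) - Arg ((x - p) / e)) / (2 * pi)"
    using winding_number_Arg[of "linepath x y" p e] * e
    by (force simp: complex_nonpos_Reals_iff)
qed

text \<open>In the second case only the real part is computed, which suffices because the winding
  number of a closed path is an integer. The variation \<open>v\<close> cancels since
  \<open>M\<close> is traversed backwards, and the remaining arguments cancel against those of the
  two segments.\<close>

lemma winding_number_arcs_closed:
  fixes L M :: "real \<Rightarrow> complex"
  assumes L: "L piecewise_C1_differentiable_on UNIV" and M: "M piecewise_C1_differentiable_on UNIV"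
    and ab: "a < b" "c < d"
    and p: "p \<notin> L ` {a..b}" "p \<notin> M ` {c..d}" "p \<notin> closed_segment (L b) (M d)" "p \<notin> closed_segment (M c) (L a)"
    and *: "(\<exists>K. convex K \<and> p \<notin> K \<and> L ` {a..b} \<subseteq> K \<and> M ` {c..d} \<subseteq> K) \<or>
      (\<exists>v e1 e2. e1 \<noteq> 0 \<and> e2 \<noteq> 0 \<and> has_arg_variation L p v \<and> has_arg_variation M p v \<and>
         arg_tails L p a b e1 e2 \<and> arg_tails M p c d e1 e2)"
  shows "winding_number ((((L \<circ> linepath a b) +++ linepath (L b) (M d)) +++ reversepath (M \<circ> linepath c d)) +++
           linepath (M c) (L a)) p = 0" (is "winding_number ?g p = 0")
proof -
  have paths: "path (L \<circ> linepath a b)" "path (M \<circ> linepath c d)"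
    using valid_path_arc L M ab valid_path_imp_path by blast+
  have img: "path_image (L \<circ> linepath a b) = L ` {a..b}" "path_image (M \<circ> linepath c d) = M ` {c..d}"
    using ab by (simp_all add: path_image_arc)
  have path: "path ?g" and loop: "pathfinish ?g = pathstart ?g"
    using paths by auto
  have pim: "path_image ?g = L ` {a..b} \<union> closed_segment (L b) (M d) \<union> M ` {c..d} \<union> closed_segment (M c) (L a)"
    using paths by (simp add: path_image_join img)
  show ?thesis
    using *
  proof (elim disjE exE conjE)
    fix K assume K: "convex K" "p \<notin> K" "L ` {a..b} \<subseteq> K" "M ` {c..d} \<subseteq> K"
    have "path_image ?g \<subseteq> K"
      unfolding pim using K ab by (intro Un_least closed_segment_subset) (auto simp: image_subset_iff)
    then show ?thesis
      using winding_number_zero_outside[OF path K(1) loop K(2)] by blast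
  next
    fix v e1 e2 assume e: "e1 \<noteq> 0" "e2 \<noteq> 0" and v: "has_arg_variation L p v" "has_arg_variation M p v"
      and t: "arg_tails L p a b e1 e2" "arg_tails M p c d e1 e2"
    have "winding_number ?g p = winding_number (L \<circ> linepath a b) p + winding_number (linepath (L b) (M d)) p
      - winding_number (M \<circ> linepath c d) p + winding_number (linepath (M c) (L a)) p"
      using paths p by (simp add: winding_number_join path_image_join winding_number_reversepath img)
    also have "Re \<dots> = 0"
      using winding_number_arg_tails[OF L v(1) ab(1) e t(1)] winding_number_arg_tails[OF M v(2) ab(2) e t(2)]
        winding_number_linepath_Arg(1)[of "L b" p e1 "M d"] winding_number_linepath_Arg(1)[of "M c" p e2 "L a"] t e
      by (auto simp: arg_tails_def diff_divide_distrib add_divide_distrib)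
    finally have "Re (winding_number ?g p) = 0" .
    moreover have "winding_number ?g p \<in> \<int>"
      by (rule integer_winding_number[OF path loop]) (use p pim in auto)
    ultimately show ?thesis by (auto elim!: Ints_cases)
  qed
qed

text \<open>The closed path has winding number 0 around every point outside \<open>U\<close>, so the
  homology form of Cauchy's theorem leaves only the integrals over the two joining segments.\<close>

lemma arcs_integral_diff_le:
  fixes L M :: "real \<Rightarrow> complex"
  assumes L: "L piecewise_C1_differentiable_on UNIV" and M: "M piecewise_C1_differentiable_on UNIV"
    and ab: "a < b" "c < d" and U: "open U" and g: "g holomorphic_on U"
    and imgs: "L ` {a..b} \<subseteq> U" "M ` {c..d} \<subseteq> U" "closed_segment (L b) (M d) \<subseteq> U" "closed_segment (M c) (L a) \<subseteq> U"
    and I: "((\<lambda>s. g (L s) * vector_derivative L (at s)) has_integral I) {a..b}"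
    and J: "((\<lambda>s. g (M s) * vector_derivative M (at s)) has_integral J) {c..d}"
    and wn: "\<And>p. p \<notin> U \<Longrightarrow> (\<exists>K. convex K \<and> p \<notin> K \<and> L ` {a..b} \<subseteq> K \<and> M ` {c..d} \<subseteq> K) \<or>
      (\<exists>v e1 e2. e1 \<noteq> 0 \<and> e2 \<noteq> 0 \<and> has_arg_variation L p v \<and> has_arg_variation M p v \<and>
         arg_tails L p a b e1 e2 \<and> arg_tails M p c d e1 e2)"
    and B: "\<And>z. z \<in> closed_segment (L b) (M d) \<Longrightarrow> norm (g z) \<le> B" "\<And>z. z \<in> closed_segment (M c) (L a) \<Longrightarrow> norm (g z) \<le> B"
  shows "norm (I - J) \<le> B * (norm (M d - L b) + norm (L a - M c))"
proof -
  let ?g = "(((L \<circ> linepath a b) +++ linepath (L b) (M d)) +++ reversepath (M \<circ> linepath c d)) +++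
           linepath (M c) (L a)"
  have vp: "valid_path (L \<circ> linepath a b)" "valid_path (M \<circ> linepath c d)"
    using valid_path_arc L M ab by blast+
  have img: "path_image (L \<circ> linepath a b) = L ` {a..b}" "path_image (M \<circ> linepath c d) = M ` {c..d}"
    using ab by (simp_all add: path_image_arc)
  have pim: "path_image ?g = L ` {a..b} \<union> closed_segment (L b) (M d) \<union> M ` {c..d} \<union> closed_segment (M c) (L a)"
    using vp by (simp add: path_image_join img valid_path_imp_path)
  have 0: "(g has_contour_integral 0) ?g"
  proof (rule Cauchy_theorem_global[OF U g])
    show "valid_path ?g" using vp by (intro valid_path_join) auto
    show "path_image ?g \<subseteq> U" unfolding pim using imgs by auto
    show "winding_number ?g p = 0" if "p \<notin> U" for p
      by (rule winding_number_arcs_closed[OF L M ab]) (use imgs that wn in \<open>auto simp: image_subset_iff\<close>)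
  qed auto
  have cont: "continuous_on S g" if "S \<subseteq> U" for S
    using g that holomorphic_on_imp_continuous_on holomorphic_on_subset by blast
  have i1: "g contour_integrable_on linepath (L b) (M d)" and i2: "g contour_integrable_on linepath (M c) (L a)"
    by (intro contour_integrable_continuous_linepath cont imgs)+
  have "(g has_contour_integral (((I + contour_integral (linepath (L b) (M d)) g) + (-J)) + contour_integral (linepath (M c) (L a)) g)) ?g"
    using vp i1 i2
    by (intro has_contour_integral_join has_contour_integral_reversepath has_contour_integral_integral
         has_contour_integral_arc L M ab I J valid_path_join) auto
  with 0 have eq: "I - J = - contour_integral (linepath (L b) (M d)) g - contour_integral (linepath (M c) (L a)) g"
    using has_contour_integral_unique by (fastforce simp: algebra_simps)
  have B0: "0 \<le> B" using B(1)[of "L b"] norm_ge_zero order_trans by blast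
  have "norm (contour_integral (linepath (L b) (M d)) g) \<le> B * norm (M d - L b)"
    by (rule contour_integral_bound_linepath[OF i1 B0]) (use B in auto)
  moreover have "norm (contour_integral (linepath (M c) (L a)) g) \<le> B * norm (L a - M c)"
    by (rule contour_integral_bound_linepath[OF i2 B0]) (use B in auto)
  ultimately show ?thesis
    unfolding eq by (metis (no_types, lifting) add_mono distrib_left norm_minus_cancel norm_triangle_le diff_conv_add_uminus)
qed

section \<open>Ends of a contour, and points there at which the integrand is small\<close>

lemma Arg_tendsto_0:
  fixes f :: "'a \<Rightarrow> complex"
  assumes re: "filterlim (\<lambda>x. Re (f x)) at_top F" and im: "\<And>x. \<bar>Im (f x)\<bar> \<le> K"
  shows "((\<lambda>x. Arg (f x)) \<longlongrightarrow> 0) F"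
proof -
  have "((\<lambda>x. Im (f x) * inverse (Re (f x))) \<longlongrightarrow> 0) F"
  proof (rule tendsto_0_le[where K = K])
    show "((\<lambda>x. inverse (Re (f x))) \<longlongrightarrow> 0) F"
      using tendsto_inverse_0_at_top[OF re] .
    show "\<forall>\<^sub>F x in F. norm (Im (f x) * inverse (Re (f x))) \<le> norm (inverse (Re (f x))) * K"
      using mult_right_mono[OF im] by (simp add: abs_mult mult.commute[of _ K])
  qed
  then have "((\<lambda>x. arctan (Im (f x) * inverse (Re (f x)))) \<longlongrightarrow> arctan 0) F"
    by (intro tendsto_intros)
  then have "((\<lambda>x. arctan (Im (f x) / Re (f x))) \<longlongrightarrow> 0) F" by (simp add: divide_inverse)
  moreover have "eventually (\<lambda>x. arctan (Im (f x) / Re (f x)) = Arg (f x)) F"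
    using filterlim_at_top_dense[THEN iffD1, OF re, rule_format, of 0]
    by eventually_elim (auto simp: arg_conv_arctan)
  ultimately show ?thesis by (rule Lim_transform_eventually)
qed

text \<open>Between the first passage \<open>s1\<close> of the level \<open>r + \<delta>\<close> and
  the last passage \<open>s0\<close> of the level \<open>r\<close> before it, the path stays in the
  strip and gains \<delta> in the direction \<open>e\<close>. Hence the minimum of
  \<open>norm g\<close> on this piece, times \<delta>, is at most the integral of
  \<open>norm (g (L s) * D s)\<close>, which the tail bounds by \<eta>.\<close>

lemma path_crossing_point:
  fixes L D :: "real \<Rightarrow> complex"
  assumes cont: "continuous_on UNIV L" and E: "finite E" "\<And>s. s \<notin> E \<Longrightarrow> (L has_vector_derivative D s) (at s)"
    and e: "norm e = 1" and lim: "filterlim (\<lambda>s. Re (L s / e)) at_top at_top"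
    and g: "continuous_on UNIV (\<lambda>s. g (L s))"
    and int: "integrable lborel (\<lambda>s. g (L s) * D s)"
    and small: "(LINT s:{S..}|lborel. norm (g (L s) * D s)) \<le> \<eta>"
    and r: "Re (L S / e) < r" and \<delta>: "\<delta> > 0"
  obtains b where "b > S" "r \<le> Re (L b / e)" "Re (L b / e) \<le> r + \<delta>" "norm (g (L b)) * \<delta> \<le> \<eta>"
proof -
  define h where "h s = Re (L s / e)" for s
  have e0: "e \<noteq> 0" using e by auto
  have h: "continuous_on A h" for A
    unfolding h_def using e0 continuous_on_subset[OF cont] by (auto intro!: continuous_intros)
  obtain t where t: "t \<ge> S" "h t \<ge> r + \<delta>"
    using filterlim_at_top[THEN iffD1, OF lim, rule_format, of "r + \<delta>"] eventually_ge_at_top[of S]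
    by (metis (mono_tags, lifting) eventually_conj eventually_happens' trivial_limit_at_top_linorder h_def)
  define A where "A = {s\<in>{S..t}. h s = r + \<delta>}"
  have "closed A" unfolding A_def by (rule continuous_closed_preimage_constant[OF h]) auto
  then have "compact A" unfolding A_def
    by (metis (no_types, lifting) bounded_closed_interval bounded_subset compact_eq_bounded_closed mem_Collect_eq subsetI)
  moreover have "A \<noteq> {}"
    using IVT'[of h S "r + \<delta>" t] h t r \<delta> by (auto simp: A_def h_def)
  ultimately obtain s1 where s1: "s1 \<in> A" "\<And>s. s \<in> A \<Longrightarrow> s1 \<le> s"
    using compact_attains_inf by metis
  have below: "h s < r + \<delta>" if ss: "S \<le> s" "s < s1" for s
  proof (rule ccontr)
    assume "\<not> h s < r + \<delta>"
    moreover have "h S \<le> r + \<delta>" using r \<delta> by (simp add: h_def)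
    ultimately obtain s' where "S \<le> s'" "s' \<le> s" "h s' = r + \<delta>"
      using IVT'[of h S "r + \<delta>" s] h[of "{S..s}"] ss(1) by auto
    then have "s' \<in> A" using ss s1 by (auto simp: A_def)
    then show False using s1(2)[of s'] \<open>s' \<le> s\<close> ss by auto
  qed
  define B where "B = {s\<in>{S..s1}. h s = r}"
  have "closed B" unfolding B_def by (rule continuous_closed_preimage_constant[OF h]) auto
  then have "compact B" unfolding B_def
    by (metis (no_types, lifting) bounded_closed_interval bounded_subset compact_eq_bounded_closed mem_Collect_eq subsetI)
  moreover have "B \<noteq> {}"
    using IVT'[of h S r s1] h s1 r \<delta> by (auto simp: B_def A_def h_def)
  ultimately obtain s0 where s0: "s0 \<in> B" "\<And>s. s \<in> B \<Longrightarrow> s \<le> s0"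
    using compact_attains_sup by metis
  have above: "h s \<ge> r" if ss: "s0 \<le> s" "s \<le> s1" for s
  proof (rule ccontr)
    assume "\<not> h s \<ge> r"
    moreover have "r \<le> h s1" using s1 \<delta> by (simp add: A_def)
    ultimately obtain s' where "s \<le> s'" "s' \<le> s1" "h s' = r"
      using IVT'[of h s r s1] h[of "{s..s1}"] ss(2) by auto
    then have "s' \<in> B" using ss s0 by (auto simp: B_def)
    then have "s' = s" using s0(2)[of s'] \<open>s \<le> s'\<close> ss by auto
    then show False using \<open>h s' = r\<close> \<open>\<not> h s \<ge> r\<close> by auto
  qed
  have ord: "S \<le> s0" "s0 \<le> s1" "S \<noteq> s0" using s0 r by (auto simp: B_def h_def)
  have "continuous_on {s0..s1} (\<lambda>s. norm (g (L s)))"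
    by (intro continuous_on_norm continuous_on_subset[OF g]) auto
  from continuous_attains_inf[OF compact_Icc _ this] ord
  obtain b where b: "b \<in> {s0..s1}" "\<And>s. s \<in> {s0..s1} \<Longrightarrow> norm (g (L b)) \<le> norm (g (L s))"
    by auto
  define m where "m = norm (g (L b))"
  have D: "(D has_integral L s1 - L s0) {s0..s1}"
    by (rule fundamental_theorem_of_calculus_strong[OF E(1) ord(2)])
      (use E(2) has_vector_derivative_at_within continuous_on_subset[OF cont] in blast)+
  have intn: "integrable lborel (\<lambda>s. norm (g (L s) * D s))" using int by simp
  have si: "set_integrable lborel X (\<lambda>s. norm (g (L s) * D s))" if "X \<in> sets lborel" for X
    using set_integrable_subset[of lborel UNIV "\<lambda>s. norm (g (L s) * D s)" X] intn that by (simp add: set_integrable_def)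
  have "m * \<delta> \<le> m * norm (L s1 - L s0)"
  proof (rule mult_left_mono)
    have "\<delta> = Re ((L s1 - L s0) / e)"
      using s1 s0 by (simp add: A_def B_def h_def diff_divide_distrib)
    also have "\<dots> \<le> norm ((L s1 - L s0) / e)" by (rule complex_Re_le_cmod)
    finally show "\<delta> \<le> norm (L s1 - L s0)" by (simp add: norm_divide e)
  qed (simp add: m_def)
  also have "\<dots> = norm (integral {s0..s1} (\<lambda>s. of_real m * D s))"
    using D by (simp add: integral_unique norm_mult m_def)
  also have "\<dots> \<le> integral {s0..s1} (\<lambda>s. norm (g (L s) * D s))"
  proof (rule integral_norm_bound_integral)
    show "(\<lambda>s. of_real m * D s) integrable_on {s0..s1}"
      using D by (intro integrable_on_mult_right) (auto simp: integrable_on_def)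
    show "(\<lambda>s. norm (g (L s) * D s)) integrable_on {s0..s1}"
      by (rule set_borel_integral_eq_integral(1)[OF si]) simp
    show "norm (of_real m * D s) \<le> norm (g (L s) * D s)" if "s \<in> {s0..s1}" for s
      using b(2)[OF that] by (auto simp: norm_mult m_def intro!: mult_right_mono)
  qed
  also have "\<dots> = (LINT s:{s0..s1}|lborel. norm (g (L s) * D s))"
    by (rule set_borel_integral_eq_integral(2)[OF si, symmetric]) simp
  also have "\<dots> \<le> (LINT s:{S..}|lborel. norm (g (L s) * D s))"
    unfolding set_lebesgue_integral_def
    by (rule integral_mono) (use si[of "{s0..s1}"] si[of "{S..}"] ord in \<open>auto simp: set_integrable_def indicator_def\<close>)
  also have "\<dots> \<le> \<eta>" by (rule small)
  finally have "norm (g (L b)) * \<delta> \<le> \<eta>" by (simp add: m_def)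
  moreover have "b > S" using b(1) ord by auto
  moreover have "r \<le> h b" using above b(1) by auto
  moreover have "h b \<le> r + \<delta>" using below[of b] b(1) s1(1) ord by (cases "b = s1") (auto simp: A_def)
  ultimately show ?thesis using that unfolding h_def by blast
qed

section \<open>Deformation of infinite contours\<close>

text \<open>A rectangle across the half strip of half-width \<open>K\<close> that escapes in the
  direction \<open>e\<close>; its depth is \<delta> and it begins at distance
  \<open>r\<close>.\<close>

definition cell :: "complex \<Rightarrow> real \<Rightarrow> real \<Rightarrow> real \<Rightarrow> complex set" where
  "cell e K r \<delta> = {z. r \<le> Re (z / e) \<and> Re (z / e) \<le> r + \<delta> \<and> \<bar>Im (z / e)\<bar> \<le> K}"

text \<open>
  \<open>P\<close> is the set of singularities of \<open>g\<close>.  The maximum in the bound is what allows a joining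
  segment to be controlled by its two end points, one on each contour.
\<close>

definition good_cell :: "(complex \<Rightarrow> complex) \<Rightarrow> complex set \<Rightarrow> complex \<Rightarrow> real \<Rightarrow> real \<Rightarrow> real \<Rightarrow> real \<Rightarrow> bool" where
  "good_cell g P e K C \<delta> r \<longleftrightarrow> cell e K r \<delta> \<inter> P = {} \<and>
     (\<forall>z0\<in>cell e K r \<delta>. \<forall>z1\<in>cell e K r \<delta>. \<forall>z\<in>closed_segment z0 z1.
        norm (g z) \<le> C * max (norm (g z0)) (norm (g z1)))"

lemma convex_cell: "convex (cell e K r \<delta>)"
proof -
  have "cell e K r \<delta> = (\<lambda>z. z / e) -` ({z. Re z \<ge> r} \<inter> {z. Re z \<le> r + \<delta>} \<inter> ({z. Im z \<ge> -K} \<inter> {z. Im z \<le> K}))"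
    by (auto simp: cell_def)
  moreover have "linear (\<lambda>z. z / e)" by (simp add: linear_iff add_divide_distrib scaleR_conv_of_real)
  ultimately show ?thesis
    by (metis convex_linear_vimage convex_Int convex_halfspace_Re_ge convex_halfspace_Re_le convex_halfspace_Im_ge convex_halfspace_Im_le)
qed

lemma cell_norm_diff:
  assumes "z \<in> cell e K r \<delta>" "w \<in> cell e K r \<delta>" "norm e = 1"
  shows "norm (z - w) \<le> \<delta> + 2 * K"
proof -
  have "norm (z - w) = norm ((z - w) / e)" using assms by (simp add: norm_divide)
  also have "\<dots> \<le> \<bar>Re ((z - w) / e)\<bar> + \<bar>Im ((z - w) / e)\<bar>" by (rule cmod_le)
  also have "\<dots> \<le> \<delta> + 2 * K" using assms(1,2) by (auto simp: cell_def diff_divide_distrib)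
  finally show ?thesis .
qed

lemma tail_integral_small:
  fixes F :: "real \<Rightarrow> real"
  assumes "integrable lborel F" "\<And>s. F s \<ge> 0" "\<eta> > 0"
  shows "eventually (\<lambda>S. (LINT s:{S..}|lborel. F s) \<le> \<eta>) at_top"
proof -
  have "((\<lambda>S. LINT s|lborel. indicator {S..} s *\<^sub>R F s) \<longlongrightarrow> integral\<^sup>L lborel (\<lambda>s::real. 0)) at_top"
  proof (rule integral_dominated_convergence_at_top[where M = lborel and f = "\<lambda>s. 0" and w = F and s = "\<lambda>S s. indicator {S..} s *\<^sub>R F s"])
    show "AE x in lborel. ((\<lambda>S. indicator {S..} x *\<^sub>R F x) \<longlongrightarrow> 0) at_top"
    proof (rule AE_I2)
      fix x :: real
      have "eventually (\<lambda>S. S > x) at_top" by (rule eventually_gt_at_top)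
      then have "eventually (\<lambda>S. indicator {S..} x *\<^sub>R F x = 0) at_top"
        by eventually_elim (auto simp: indicator_def)
      then show "((\<lambda>S. indicator {S..} x *\<^sub>R F x) \<longlongrightarrow> 0) at_top" by (rule tendsto_eventually)
    qed
  qed (use assms in \<open>auto simp: indicator_def\<close>)
  then show ?thesis
    using assms(3) by (auto simp: set_lebesgue_integral_def dest!: order_tendstoD(2)[of _ _ _ \<eta>] elim!: eventually_mono)
qed

lemma set_integral_mirror:
  fixes F :: "real \<Rightarrow> real"
  shows "(LINT s:{S..}|lborel. F (- s)) = (LINT s:{..-S}|lborel. F s)"
  using lborel_integral_real_affine[of "-1" "\<lambda>s. indicator {..-S} s *\<^sub>R F s" 0]
  by (auto simp: set_lebesgue_integral_def indicator_def intro!: Bochner_Integration.integral_cong)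

lemma integral_truncation:
  fixes F :: "real \<Rightarrow> complex"
  assumes F: "integrable lborel F" and ab: "a \<le> S" "S \<le> T" "T \<le> b"
  shows "(F has_integral (LINT s:{a..b}|lborel. F s)) {a..b}"
    and "norm ((LINT s|lborel. F s) - (LINT s:{a..b}|lborel. F s)) \<le>
      (LINT s:{T..}|lborel. norm (F s)) + (LINT s:{..S}|lborel. norm (F s))"
proof -
  have si: "set_integrable lborel X F" "set_integrable lborel X (\<lambda>s. norm (F s))" if "X \<in> sets lborel" for X
    using set_integrable_subset[of lborel UNIV F X] set_integrable_subset[of lborel UNIV "\<lambda>s. norm (F s)" X] F that
    by (simp_all add: set_integrable_def)
  show "(F has_integral (LINT s:{a..b}|lborel. F s)) {a..b}"
    using set_borel_integral_eq_integral[OF si(1), of "{a..b}"] by (simp add: has_integral_integral)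
  have "(LINT s|lborel. F s) - (LINT s:{a..b}|lborel. F s) = (LINT s|lborel. F s - indicator {a..b} s *\<^sub>R F s)"
    using F si(1)[of "{a..b}"] by (simp add: set_lebesgue_integral_def set_integrable_def)
  also have "norm \<dots> \<le> (LINT s|lborel. norm (F s - indicator {a..b} s *\<^sub>R F s))"
    by (rule integral_norm_bound)
  also have "\<dots> \<le> (LINT s|lborel. indicator {T..} s *\<^sub>R norm (F s) + indicator {..S} s *\<^sub>R norm (F s))"
  proof (rule integral_mono)
    show "integrable lborel (\<lambda>s. norm (F s - indicator {a..b} s *\<^sub>R F s))"
      using F si(1)[of "{a..b}"] by (auto simp: set_integrable_def)
    show "integrable lborel (\<lambda>s. indicator {T..} s *\<^sub>R norm (F s) + indicator {..S} s *\<^sub>R norm (F s))"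
      using si(2)[of "{T..}"] si(2)[of "{..S}"] by (auto simp: set_integrable_def)
  qed (use ab in \<open>auto simp: indicator_def\<close>)
  also have "\<dots> = (LINT s:{T..}|lborel. norm (F s)) + (LINT s:{..S}|lborel. norm (F s))"
    using si(2)[of "{T..}"] si(2)[of "{..S}"] by (simp add: set_lebesgue_integral_def set_integrable_def)
  finally show "norm ((LINT s|lborel. F s) - (LINT s:{a..b}|lborel. F s)) \<le>
      (LINT s:{T..}|lborel. norm (F s)) + (LINT s:{..S}|lborel. norm (F s))" .
qed

lemma upper_crossing_point:
  assumes L: "L piecewise_C1_differentiable_on UNIV" and e: "norm e = 1"
    and lim: "filterlim (\<lambda>s. Re (L s / e)) at_top at_top"
    and g: "continuous_on UNIV (\<lambda>s. g (L s))"
    and int: "integrable lborel (\<lambda>s. g (L s) * vector_derivative L (at s))"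
    and small: "(LINT s:{S..}|lborel. norm (g (L s) * vector_derivative L (at s))) \<le> \<eta>"
    and r: "Re (L S / e) < r" and \<delta>: "\<delta> > 0"
  obtains b where "b > S" "r \<le> Re (L b / e)" "Re (L b / e) \<le> r + \<delta>" "norm (g (L b)) * \<delta> \<le> \<eta>"
proof -
  obtain E where "continuous_on UNIV L" "finite E" "\<And>s. s \<notin> E \<Longrightarrow> (L has_vector_derivative vector_derivative L (at s)) (at s)"
    using L by (rule piecewise_C1_UNIV_E) blast
  then show thesis by (rule path_crossing_point[OF _ _ _ e lim g int small r \<delta>]) (use that in blast)+
qed

lemma lower_crossing_point:
  assumes L: "L piecewise_C1_differentiable_on UNIV" and e: "norm e = 1"
    and lim: "filterlim (\<lambda>s. Re (L s / e)) at_top at_bot"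
    and g: "continuous_on UNIV (\<lambda>s. g (L s))"
    and int: "integrable lborel (\<lambda>s. g (L s) * vector_derivative L (at s))"
    and small: "(LINT s:{..-S}|lborel. norm (g (L s) * vector_derivative L (at s))) \<le> \<eta>"
    and r: "Re (L (-S) / e) < r" and \<delta>: "\<delta> > 0"
  obtains a where "a < -S" "r \<le> Re (L a / e)" "Re (L a / e) \<le> r + \<delta>" "norm (g (L a)) * \<delta> \<le> \<eta>"
proof -
  obtain E where E: "continuous_on UNIV L" "finite E" "\<And>s. s \<notin> E \<Longrightarrow> (L has_vector_derivative vector_derivative L (at s)) (at s)"
    using L by (rule piecewise_C1_UNIV_E) blast
  let ?D = "\<lambda>s. - vector_derivative L (at (- s))"
  obtain b where b: "b > S" "r \<le> Re (L (-b) / e)" "Re (L (-b) / e) \<le> r + \<delta>" "norm (g (L (-b))) * \<delta> \<le> \<eta>"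
  proof (rule path_crossing_point[of "\<lambda>s. L (- s)" "uminus ` E" ?D e g S \<eta> r \<delta>])
    show "continuous_on UNIV (\<lambda>s. L (- s))" "continuous_on UNIV (\<lambda>s. g (L (- s)))"
      using continuous_on_compose2[OF E(1), of UNIV uminus] continuous_on_compose2[OF g, of UNIV uminus]
      by (auto simp: continuous_on_minus continuous_on_id)
    show "((\<lambda>s. L (- s)) has_vector_derivative ?D s) (at s)" if "s \<notin> uminus ` E" for s
    proof -
      have "- s \<notin> E" using that by (metis image_eqI minus_minus)
      have "(uminus has_vector_derivative -1) (at s)" by (auto intro!: derivative_eq_intros)
      from vector_diff_chain_at[OF this, of L] E(3)[OF \<open>- s \<notin> E\<close>] show ?thesis by (simp add: o_def)
    qed
    show "filterlim (\<lambda>s. Re (L (- s) / e)) at_top at_top"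
      using lim by (simp add: filterlim_at_bot_mirror)
    show "integrable lborel (\<lambda>s. g (L (- s)) * ?D s)"
      using lborel_integrable_real_affine[OF int, of "-1" 0] by simp
    show "(LINT s:{S..}|lborel. norm (g (L (- s)) * ?D s)) \<le> \<eta>"
      using small set_integral_mirror[of S "\<lambda>s. norm (g (L s) * vector_derivative L (at s))"]
      by (simp add: norm_mult)
  qed (use E e r \<delta> in auto)
  then show thesis using that[of "-b"] by auto
qed

text \<open>
  Either condition makes the winding number around \<open>p\<close> of the closed path along \<open>L\<close>, a segment,
  \<open>M\<close> backwards and another segment vanish.
\<close>

definition unwound :: "(real \<Rightarrow> complex) \<Rightarrow> (real \<Rightarrow> complex) \<Rightarrow> real \<Rightarrow> real \<Rightarrow> real \<Rightarrow> real \<Rightarrow> complex \<Rightarrow> bool" where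
  "unwound L M a b c d p \<longleftrightarrow> (\<exists>X. convex X \<and> p \<notin> X \<and> L ` {a..b} \<subseteq> X \<and> M ` {c..d} \<subseteq> X) \<or>
      (\<exists>v e1 e2. e1 \<noteq> 0 \<and> e2 \<noteq> 0 \<and> has_arg_variation L p v \<and> has_arg_variation M p v \<and>
         arg_tails L p a b e1 e2 \<and> arg_tails M p c d e1 e2)"

text \<open>Both contours are cut off at points of a common cell at which \<open>g\<close> is small,
  supplied by the crossing lemmas, and the cut points are joined in pairs. The relation
  \<open>W\<close> couples the cells at the two ends. It is trivial for vertical contours, whose
  ends are independent, and equality for right loops, where a single cell has to separate the poles
  on its left from those beyond it.\<close>

theorem contour_integral_deform:
  fixes L M :: "real \<Rightarrow> complex"
  assumes L: "L piecewise_C1_differentiable_on UNIV" and M: "M piecewise_C1_differentiable_on UNIV"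
    and P: "closed P" and g: "g holomorphic_on (- P)" and disj: "range L \<inter> P = {}" "range M \<inter> P = {}"
    and intL: "integrable lborel (\<lambda>s. g (L s) * vector_derivative L (at s))"
    and intM: "integrable lborel (\<lambda>s. g (M s) * vector_derivative M (at s))"
    and e: "norm e1 = 1" "norm e2 = 1"
    and limL: "filterlim (\<lambda>s. Re (L s / e1)) at_top at_top" "filterlim (\<lambda>s. Re (L s / e2)) at_top at_bot"
    and limM: "filterlim (\<lambda>s. Re (M s / e1)) at_top at_top" "filterlim (\<lambda>s. Re (M s / e2)) at_top at_bot"
    and K: "\<And>s. \<bar>Im (L s / e1)\<bar> \<le> K" "\<And>s. \<bar>Im (L s / e2)\<bar> \<le> K" "\<And>s. \<bar>Im (M s / e1)\<bar> \<le> K" "\<And>s. \<bar>Im (M s / e2)\<bar> \<le> K"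
    and C: "C \<ge> 0" "\<delta> > 0"
    and cells: "\<And>R. \<exists>r1\<ge>R. \<exists>r2\<ge>R. W r1 r2 \<and> good_cell g P e1 K C \<delta> r1 \<and> good_cell g P e2 K C \<delta> r2"
    and wn: "\<And>S. \<exists>S'\<ge>S. \<exists>R. \<forall>r1\<ge>R. \<forall>r2\<ge>R. \<forall>a b c d. W r1 r2 \<and>
        good_cell g P e1 K C \<delta> r1 \<and> good_cell g P e2 K C \<delta> r2 \<and>
        a < -S' \<and> b > S' \<and> c < -S' \<and> d > S' \<and>
        L b \<in> cell e1 K r1 \<delta> \<and> M d \<in> cell e1 K r1 \<delta> \<and> L a \<in> cell e2 K r2 \<delta> \<and> M c \<in> cell e2 K r2 \<delta> \<longrightarrow>
        (\<forall>p\<in>P. unwound L M a b c d p)"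
  shows "(LINT s|lborel. g (L s) * vector_derivative L (at s)) = (LINT s|lborel. g (M s) * vector_derivative M (at s))"
    (is "?IL = ?IM")
proof -
  let ?F = "\<lambda>s. g (L s) * vector_derivative L (at s)" and ?G = "\<lambda>s. g (M s) * vector_derivative M (at s)"
  have contL: "continuous_on UNIV L" and contM: "continuous_on UNIV M"
    using L M by (auto simp: piecewise_C1_differentiable_on_def)
  have cg: "continuous_on (-P) g" using g holomorphic_on_imp_continuous_on by blast
  have gL: "continuous_on UNIV (\<lambda>s. g (L s))" and gM: "continuous_on UNIV (\<lambda>s. g (M s))"
    using continuous_on_compose2[OF cg contL] continuous_on_compose2[OF cg contM] disj by blast+
  have K0: "K \<ge> 0" using K(1)[of 0] abs_ge_zero order_trans by blast
  \<comment> \<open>The four tails contribute at most \<eta> each. On the two segments, of length at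
    most \<open>\<delta> + 2 * K\<close>, the integrand is at most
    \<open>C * (\<eta> / \<delta>)\<close>.\<close>
  define A where "A = 4 + C / \<delta> * (2 * (\<delta> + 2 * K))"
  have main: "norm (?IL - ?IM) \<le> \<eta> * A" if \<eta>: "\<eta> > 0" for \<eta> :: real
  proof -
    have mirror: "eventually (\<lambda>S. (LINT s:{..-S}|lborel. norm (F s)) \<le> \<eta>) at_top" if "integrable lborel F" for F :: "real \<Rightarrow> complex"
    proof -
      have "integrable lborel (\<lambda>s. norm (F (- s)))"
        using lborel_integrable_real_affine[OF integrable_norm[OF that], of "-1" 0] by simp
      from tail_integral_small[OF this _ \<eta>] show ?thesis
        by (simp add: set_integral_mirror[of _ "\<lambda>s. norm (F s)"])
    qed
    have "eventually (\<lambda>S. (LINT s:{S..}|lborel. norm (?F s)) \<le> \<eta> \<and> (LINT s:{..-S}|lborel. norm (?F s)) \<le> \<eta> \<and>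
        (LINT s:{S..}|lborel. norm (?G s)) \<le> \<eta> \<and> (LINT s:{..-S}|lborel. norm (?G s)) \<le> \<eta>) at_top"
      by (intro eventually_conj tail_integral_small mirror \<eta> integrable_norm intL intM norm_ge_zero)
    then obtain S0 where S0: "\<And>S. S \<ge> S0 \<Longrightarrow> (LINT s:{S..}|lborel. norm (?F s)) \<le> \<eta> \<and> (LINT s:{..-S}|lborel. norm (?F s)) \<le> \<eta> \<and>
        (LINT s:{S..}|lborel. norm (?G s)) \<le> \<eta> \<and> (LINT s:{..-S}|lborel. norm (?G s)) \<le> \<eta>"
      unfolding eventually_at_top_linorder by blast
    obtain S R where S: "S \<ge> max 0 S0" and R: "\<And>r1 r2 a b c d. r1 \<ge> R \<Longrightarrow> r2 \<ge> R \<Longrightarrow> W r1 r2 \<Longrightarrow>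
        good_cell g P e1 K C \<delta> r1 \<Longrightarrow> good_cell g P e2 K C \<delta> r2 \<Longrightarrow>
        a < -S \<Longrightarrow> b > S \<Longrightarrow> c < -S \<Longrightarrow> d > S \<Longrightarrow>
        L b \<in> cell e1 K r1 \<delta> \<Longrightarrow> M d \<in> cell e1 K r1 \<delta> \<Longrightarrow> L a \<in> cell e2 K r2 \<delta> \<Longrightarrow> M c \<in> cell e2 K r2 \<delta> \<Longrightarrow>
        (\<forall>p\<in>P. unwound L M a b c d p)"
      using wn[of "max 0 S0"] by metis
    \<comment> \<open>Beyond the positions of both paths at the parameters \<open>S\<close> and
      \<open>-S\<close>, so that each path has to cross the chosen cells after \<open>S\<close>,
      respectively before \<open>-S\<close>.\<close>
    define R' where "R' = Max {R, Re (L S / e1) + 1, Re (M S / e1) + 1, Re (L (-S) / e2) + 1, Re (M (-S) / e2) + 1}"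
    have R': "R \<le> R'" "Re (L S / e1) < R'" "Re (M S / e1) < R'" "Re (L (-S) / e2) < R'" "Re (M (-S) / e2) < R'"
      by (auto simp: R'_def less_max_iff_disj)
    obtain r1 r2 where r: "r1 \<ge> R'" "r2 \<ge> R'" "W r1 r2" "good_cell g P e1 K C \<delta> r1" "good_cell g P e2 K C \<delta> r2"
      using cells[of R'] by blast
    have sm: "(LINT s:{S..}|lborel. norm (?F s)) \<le> \<eta>" "(LINT s:{..-S}|lborel. norm (?F s)) \<le> \<eta>"
        "(LINT s:{S..}|lborel. norm (?G s)) \<le> \<eta>" "(LINT s:{..-S}|lborel. norm (?G s)) \<le> \<eta>"
      using S0[of S] S by auto
    obtain b where b: "b > S" "r1 \<le> Re (L b / e1)" "Re (L b / e1) \<le> r1 + \<delta>" "norm (g (L b)) * \<delta> \<le> \<eta>"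
      by (rule upper_crossing_point[OF L e(1) limL(1) gL intL sm(1) _ C(2), of r1]) (use r R' in auto)
    obtain d where d: "d > S" "r1 \<le> Re (M d / e1)" "Re (M d / e1) \<le> r1 + \<delta>" "norm (g (M d)) * \<delta> \<le> \<eta>"
      by (rule upper_crossing_point[OF M e(1) limM(1) gM intM sm(3) _ C(2), of r1]) (use r R' in auto)
    obtain a where a: "a < -S" "r2 \<le> Re (L a / e2)" "Re (L a / e2) \<le> r2 + \<delta>" "norm (g (L a)) * \<delta> \<le> \<eta>"
      by (rule lower_crossing_point[OF L e(2) limL(2) gL intL sm(2) _ C(2), of r2]) (use r R' in auto)
    obtain c where c: "c < -S" "r2 \<le> Re (M c / e2)" "Re (M c / e2) \<le> r2 + \<delta>" "norm (g (M c)) * \<delta> \<le> \<eta>"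
      by (rule lower_crossing_point[OF M e(2) limM(2) gM intM sm(4) _ C(2), of r2]) (use r R' in auto)
    have cl: "L b \<in> cell e1 K r1 \<delta>" "M d \<in> cell e1 K r1 \<delta>" "L a \<in> cell e2 K r2 \<delta>" "M c \<in> cell e2 K r2 \<delta>"
      using a b c d K by (simp_all add: cell_def)
    have seg: "closed_segment (L b) (M d) \<subseteq> - P" "closed_segment (M c) (L a) \<subseteq> - P"
      using closed_segment_subset[OF cl(1,2) convex_cell] closed_segment_subset[OF cl(4,3) convex_cell] r(4,5)
      by (auto simp: good_cell_def)
    have small: "norm (g (L b)) \<le> \<eta> / \<delta>" "norm (g (M d)) \<le> \<eta> / \<delta>" "norm (g (L a)) \<le> \<eta> / \<delta>" "norm (g (M c)) \<le> \<eta> / \<delta>"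
      using a(4) b(4) c(4) d(4) C(2) by (simp_all add: field_simps)
    have bd: "norm (g z) \<le> C * (\<eta> / \<delta>)" if "z \<in> closed_segment (L b) (M d) \<or> z \<in> closed_segment (M c) (L a)" for z
    proof -
      have "norm (g z) \<le> C * max (norm (g (L b))) (norm (g (M d))) \<or> norm (g z) \<le> C * max (norm (g (M c))) (norm (g (L a)))"
        using that
      proof
        assume "z \<in> closed_segment (L b) (M d)"
        then show ?thesis using r(4) cl(1,2) unfolding good_cell_def by blast
      next
        assume "z \<in> closed_segment (M c) (L a)"
        then show ?thesis using r(5) cl(3,4) unfolding good_cell_def by blast
      qed
      moreover have "C * max (norm (g (L b))) (norm (g (M d))) \<le> C * (\<eta> / \<delta>)" "C * max (norm (g (M c))) (norm (g (L a))) \<le> C * (\<eta> / \<delta>)"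
        using small C(1) by (intro mult_left_mono; simp)+
      ultimately show ?thesis by linarith
    qed
    have S2: "-S \<le> S" using S by simp
    note tL = integral_truncation[OF intL less_imp_le[OF a(1)] S2 less_imp_le[OF b(1)]]
    note tM = integral_truncation[OF intM less_imp_le[OF c(1)] S2 less_imp_le[OF d(1)]]
    define I where "I = (LINT s:{a..b}|lborel. ?F s)"
    define J where "J = (LINT s:{c..d}|lborel. ?G s)"
    have "norm (I - J) \<le> C * (\<eta> / \<delta>) * (norm (M d - L b) + norm (L a - M c))"
    proof (rule arcs_integral_diff_le[OF L M _ _ _ g _ _ seg])
      show "open (- P)" using P by auto
      show "a < b" "c < d" using a b c d S2 by linarith+
      show "L ` {a..b} \<subseteq> - P" "M ` {c..d} \<subseteq> - P" using disj by auto
      show "(?F has_integral I) {a..b}" "(?G has_integral J) {c..d}" using tL(1) tM(1) by (simp_all add: I_def J_def)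
      have "R \<le> r1" "R \<le> r2" using r R' by auto
      note W = R[OF this r(3-5) a(1) b(1) c(1) d(1) cl]
      show "(\<exists>X. convex X \<and> p \<notin> X \<and> L ` {a..b} \<subseteq> X \<and> M ` {c..d} \<subseteq> X) \<or>
      (\<exists>v e1 e2. e1 \<noteq> 0 \<and> e2 \<noteq> 0 \<and> has_arg_variation L p v \<and> has_arg_variation M p v \<and>
         arg_tails L p a b e1 e2 \<and> arg_tails M p c d e1 e2)" if "p \<notin> - P" for p
        using W that unfolding unwound_def by blast
    qed (use bd in blast)+
    also have "\<dots> \<le> C * (\<eta> / \<delta>) * ((\<delta> + 2 * K) + (\<delta> + 2 * K))"
      using C \<eta> by (intro mult_left_mono add_mono cell_norm_diff[OF cl(2,1) e(1)] cell_norm_diff[OF cl(3,4) e(2)]) auto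
    finally have IJ: "norm (I - J) \<le> \<eta> * (C / \<delta> * (2 * (\<delta> + 2 * K)))" by (simp add: field_simps)
    have "norm (?IL - ?IM) = norm ((?IL - I) + (I - J) - (?IM - J))" by simp
    also have "\<dots> \<le> norm (?IL - I) + norm (I - J) + norm (?IM - J)"
      using norm_triangle_ineq4[of "(?IL - I) + (I - J)" "?IM - J"] norm_triangle_ineq[of "?IL - I" "I - J"] by linarith
    also have "\<dots> \<le> \<eta> * A" using tL(2) tM(2) sm IJ unfolding I_def J_def A_def by (simp add: distrib_left)
    finally show ?thesis .
  qed
  have A0: "A \<ge> 0" using C K0 by (simp add: A_def)
  have "norm (?IL - ?IM) \<le> 0"
  proof (rule field_le_epsilon)
    fix \<epsilon> :: real assume \<epsilon>: "\<epsilon> > 0"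
    have "norm (?IL - ?IM) \<le> \<epsilon> / (A + 1) * A" using main[of "\<epsilon> / (A + 1)"] \<epsilon> A0 by auto
    also have "\<dots> \<le> \<epsilon>" using \<epsilon> A0 by (simp add: field_simps)
    finally show "norm (?IL - ?IM) \<le> 0 + \<epsilon>" by simp
  qed
  then show ?thesis by simp
qed

text \<open>A pole outside the strip that holds both contours is unwound by convexity of the strip.
  The poles inside it have bounded imaginary part, so from some parameter on the ends stay above,
  respectively below, all of them and the argument tails apply.\<close>

corollary contour_integral_deform_vertical:
  fixes L M :: "real \<Rightarrow> complex"
  assumes L: "L piecewise_C1_differentiable_on UNIV" and M: "M piecewise_C1_differentiable_on UNIV"
    and ends: "contour_ends Vertical L" "contour_ends Vertical M"
    and P: "closed P" and g: "g holomorphic_on (- P)"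
    and var: "\<And>p. p \<in> P \<Longrightarrow> \<exists>v. has_arg_variation L p v \<and> has_arg_variation M p v"
    and intL: "integrable lborel (\<lambda>s. g (L s) * vector_derivative L (at s))"
    and intM: "integrable lborel (\<lambda>s. g (M s) * vector_derivative M (at s))"
    and Im: "\<And>K. \<exists>Y. \<forall>p\<in>P. \<bar>Re p\<bar> \<le> K \<longrightarrow> \<bar>Im p\<bar> \<le> Y"
    and cells: "\<And>K. \<exists>C\<ge>0. \<exists>Y. \<forall>r\<ge>Y. good_cell g P \<i> K C 1 r \<and> good_cell g P (-\<i>) K C 1 r"
  shows "(LINT s|lborel. g (L s) * vector_derivative L (at s)) = (LINT s|lborel. g (M s) * vector_derivative M (at s))"
proof -
  obtain K1 where K1: "\<And>s. \<bar>Re (L s)\<bar> \<le> K1" using ends(1) by (auto simp: bounded_iff)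
  obtain K2 where K2: "\<And>s. \<bar>Re (M s)\<bar> \<le> K2" using ends(2) by (auto simp: bounded_iff)
  define K where "K = max K1 K2"
  have K: "\<bar>Re (L s)\<bar> \<le> K" "\<bar>Re (M s)\<bar> \<le> K" for s
    using K1[of s] K2[of s] by (auto simp: K_def)
  obtain C Y where C: "C \<ge> 0" and Y: "\<And>r. r \<ge> Y \<Longrightarrow> good_cell g P \<i> K C 1 r \<and> good_cell g P (-\<i>) K C 1 r"
    using cells[of K] by blast
  obtain Y' where Y': "\<And>p. p \<in> P \<Longrightarrow> \<bar>Re p\<bar> \<le> K \<Longrightarrow> \<bar>Im p\<bar> \<le> Y'" using Im by blast
  have top: "filterlim (\<lambda>s. Im (L s)) at_top at_top" "filterlim (\<lambda>s. Im (M s)) at_top at_top"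
    and bot: "filterlim (\<lambda>s. - Im (L s)) at_top at_bot" "filterlim (\<lambda>s. - Im (M s)) at_top at_bot"
    using ends by (auto simp: o_def filterlim_uminus_at_top)
  show ?thesis
  proof (rule contour_integral_deform[OF L M P g _ _ intL intM, where ?e1.0 = \<i> and ?e2.0 = "-\<i>" and K = K and C = C and \<delta> = 1 and W = "\<lambda>_ _. True"])
    show "range L \<inter> P = {}" "range M \<inter> P = {}"
      using var by (force simp: has_arg_variation_def)+
    show "\<exists>r1\<ge>R. \<exists>r2\<ge>R. True \<and> good_cell g P \<i> K C 1 r1 \<and> good_cell g P (- \<i>) K C 1 r2" for R
      using Y[of "max R Y"] by (intro exI[of _ "max R Y"] conjI) simp_all
    fix S :: real
    have "eventually (\<lambda>s. Im (L s) > Y' \<and> Im (M s) > Y') at_top"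
      by (intro eventually_conj filterlim_at_top_dense[THEN iffD1, rule_format] top)
    then obtain S1 where S1: "\<And>s. s \<ge> S1 \<Longrightarrow> Im (L s) > Y' \<and> Im (M s) > Y'"
      unfolding eventually_at_top_linorder by blast
    have "eventually (\<lambda>s. - Im (L s) > Y' \<and> - Im (M s) > Y') at_bot"
      by (intro eventually_conj filterlim_at_top_dense[THEN iffD1, rule_format] bot)
    then obtain S2 where S2: "\<And>s. s \<le> S2 \<Longrightarrow> - Im (L s) > Y' \<and> - Im (M s) > Y'"
      unfolding eventually_at_bot_linorder by blast
    define S' where "S' = Max {S, S1, -S2}"
    have S': "S \<le> S'" "S1 \<le> S'" "-S2 \<le> S'" by (auto simp: S'_def)
    have "unwound L M a b c d p" if *: "a < -S'" "b > S'" "c < -S'" "d > S'" and p: "p \<in> P" for a b c d p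
    proof (cases "\<bar>Re p\<bar> \<le> K")
      case False
      have "convex {z. \<bar>Re z\<bar> \<le> K}"
      proof -
        have "{z. \<bar>Re z\<bar> \<le> K} = {z. Re z \<le> K} \<inter> {z. Re z \<ge> -K}" by auto
        then show ?thesis by (simp add: convex_Int convex_halfspace_Re_le convex_halfspace_Re_ge)
      qed
      then show ?thesis unfolding unwound_def
          using K False by (intro disjI1 exI[of _ "{z. \<bar>Re z\<bar> \<le> K}"]) auto
    next
      case True
      have ap: "\<bar>Im p\<bar> \<le> Y'" by (rule Y'[OF p True])
      have tails: "arg_tails N p a b \<i> (-\<i>)"
        if N: "\<And>s. \<bar>Re (N s)\<bar> \<le> K" "filterlim (\<lambda>s. Im (N s)) at_top at_top" "filterlim (\<lambda>s. - Im (N s)) at_top at_bot"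
          "\<And>s. s \<ge> S1 \<Longrightarrow> Im (N s) > Y'" "\<And>s. s \<le> S2 \<Longrightarrow> - Im (N s) > Y'" and ab: "a < -S'" "b > S'" for N a b
        unfolding arg_tails_def
      proof (intro conjI allI impI)
        fix s assume "s \<ge> b"
        then show "Re ((N s - p) / \<i>) > 0" using N(4)[of s] ab S' ap by simp
      next
        fix s assume "s \<le> a"
        then show "Re ((N s - p) / - \<i>) > 0" using N(5)[of s] ab S' ap by simp
      next
        show "((\<lambda>s. Arg ((N s - p) / \<i>)) \<longlongrightarrow> 0) at_top"
        proof (rule Arg_tendsto_0[where K = "K + \<bar>Re p\<bar>"])
          show "filterlim (\<lambda>s. Re ((N s - p) / \<i>)) at_top at_top"
            using filterlim_tendsto_add_at_top[OF tendsto_const[of "- Im p"] N(2)] by simp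
          show "\<bar>Im ((N s - p) / \<i>)\<bar> \<le> K + \<bar>Re p\<bar>" for s using N(1)[of s] by simp
        qed
        show "((\<lambda>s. Arg ((N s - p) / -\<i>)) \<longlongrightarrow> 0) at_bot"
        proof (rule Arg_tendsto_0[where K = "K + \<bar>Re p\<bar>"])
          show "filterlim (\<lambda>s. Re ((N s - p) / -\<i>)) at_top at_bot"
            using filterlim_tendsto_add_at_top[OF tendsto_const[of "Im p"] N(3)] by simp
          show "\<bar>Im ((N s - p) / -\<i>)\<bar> \<le> K + \<bar>Re p\<bar>" for s using N(1)[of s] by simp
        qed
      qed
      have "arg_tails L p a b \<i> (-\<i>)" "arg_tails M p c d \<i> (-\<i>)"
        using tails[of L a b] tails[of M c d] K top bot S1 S2 * by auto
      moreover obtain v where "has_arg_variation L p v" "has_arg_variation M p v" using var[OF p] by blast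
      ultimately show ?thesis unfolding unwound_def
        by (intro disjI2 exI[of _ v] exI[of _ \<i>] exI[of _ "-\<i>"]) auto
    qed
    then show "\<exists>S'\<ge>S. \<exists>R. \<forall>r1\<ge>R. \<forall>r2\<ge>R. \<forall>a b c d. True \<and>
        good_cell g P \<i> K C 1 r1 \<and> good_cell g P (-\<i>) K C 1 r2 \<and>
        a < -S' \<and> b > S' \<and> c < -S' \<and> d > S' \<and>
        L b \<in> cell \<i> K r1 1 \<and> M d \<in> cell \<i> K r1 1 \<and> L a \<in> cell (-\<i>) K r2 1 \<and> M c \<in> cell (-\<i>) K r2 1 \<longrightarrow>
        (\<forall>p\<in>P. unwound L M a b c d p)"
      using S'(1) by blast
  qed (use K top bot C in auto)
qed

text \<open>Monotone tails make a cut point the rightmost point of its truncated tail, so the arc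
  cannot overshoot the cell and come back.\<close>

lemma right_loop_Re_le:
  fixes N :: "real \<Rightarrow> complex"
  assumes N: "antimono_on {..-T} (Re \<circ> N)" "mono_on {T..} (Re \<circ> N)" "T \<le> S"
    and mid: "\<And>s. s \<in> {-S..S} \<Longrightarrow> Re (N s) \<le> \<rho>"
    and ab: "a < -S" "b > S" "Re (N a) \<le> \<rho>" "Re (N b) \<le> \<rho>" and s: "s \<in> {a..b}"
  shows "Re (N s) \<le> \<rho>"
proof -
  consider "s < -S" | "s \<in> {-S..S}" | "s > S" by force
  then show ?thesis
  proof cases
    case 1
    then have "Re (N s) \<le> Re (N a)" using monotone_onD[OF N(1), of a s] N(3) ab s by auto
    then show ?thesis using ab by simp
  next
    case 2 then show ?thesis using mid by simp
  next
    case 3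
    then have "Re (N s) \<le> Re (N b)" using monotone_onD[OF N(2), of s b] N(3) ab s by auto
    then show ?thesis using ab by simp
  qed
qed

lemma right_loop_arg_tails:
  assumes ends: "contour_ends Right_Loop N"
    and N: "antimono_on {..-T} (Re \<circ> N)" "mono_on {T..} (Re \<circ> N)" "T \<le> S"
    and ab: "a < -S" "b > S" "Re p < Re (N a)" "Re p < Re (N b)"
  shows "arg_tails N p a b 1 1"
  unfolding arg_tails_def
proof (intro conjI allI impI)
  fix s assume "s \<ge> b"
  then have "Re (N b) \<le> Re (N s)" using monotone_onD[OF N(2), of b s] N ab by auto
  then show "Re ((N s - p) / 1) > 0" using ab by simp
next
  fix s assume "s \<le> a"
  then have "Re (N a) \<le> Re (N s)" using monotone_onD[OF N(1), of s a] N ab by auto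
  then show "Re ((N s - p) / 1) > 0" using ab by simp
next
  obtain K where K: "\<And>s. \<bar>Im (N s)\<bar> \<le> K" using ends by (auto simp: bounded_iff)
  have 1: "\<bar>Im ((N s - p) / 1)\<bar> \<le> K + \<bar>Im p\<bar>" for s using K[of s] by simp
  have 2: "filterlim (\<lambda>s. Re ((N s - p) / 1)) at_top F" if "filterlim (\<lambda>s. Re (N s)) at_top F" for F
    using filterlim_tendsto_add_at_top[OF tendsto_const[of "- Re p"] that] by simp
  show "((\<lambda>s. Arg ((N s - p) / 1)) \<longlongrightarrow> 0) at_top"
    by (rule Arg_tendsto_0[OF 2 1]) (use ends in \<open>simp add: o_def\<close>)
  show "((\<lambda>s. Arg ((N s - p) / 1)) \<longlongrightarrow> 0) at_bot"
    by (rule Arg_tendsto_0[OF 2 1]) (use ends in \<open>simp add: o_def\<close>)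
qed

text \<open>The poles may run off to +\<infinity>, so no abscissa leaves all of them behind. A pole
  avoids the good cell, hence it lies outside the horizontal strip, beyond the cell or before it. A
  convex set settles the first two cases, equality of the argument variations the last.\<close>

corollary contour_integral_deform_right:
  fixes L M :: "real \<Rightarrow> complex"
  assumes L: "L piecewise_C1_differentiable_on UNIV" and M: "M piecewise_C1_differentiable_on UNIV"
    and ends: "contour_ends Right_Loop L" "contour_ends Right_Loop M"
    and P: "closed P" and g: "g holomorphic_on (- P)"
    and var: "\<And>p. p \<in> P \<Longrightarrow> \<exists>v. has_arg_variation L p v \<and> has_arg_variation M p v"
    and intL: "integrable lborel (\<lambda>s. g (L s) * vector_derivative L (at s))"
    and intM: "integrable lborel (\<lambda>s. g (M s) * vector_derivative M (at s))"
    and cells: "\<And>K. \<exists>C\<ge>0. \<exists>\<delta>>0. \<forall>R. \<exists>r\<ge>R. good_cell g P 1 K C \<delta> r"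
  shows "(LINT s|lborel. g (L s) * vector_derivative L (at s)) = (LINT s|lborel. g (M s) * vector_derivative M (at s))"
proof -
  obtain K1 where K1: "\<And>s. \<bar>Im (L s)\<bar> \<le> K1" using ends(1) by (auto simp: bounded_iff)
  obtain K2 where K2: "\<And>s. \<bar>Im (M s)\<bar> \<le> K2" using ends(2) by (auto simp: bounded_iff)
  define K where "K = max K1 K2"
  have K: "\<bar>Im (L s)\<bar> \<le> K" "\<bar>Im (M s)\<bar> \<le> K" for s
    using K1[of s] K2[of s] by (auto simp: K_def)
  obtain C \<delta> where C: "C \<ge> 0" "\<delta> > 0" and r: "\<And>R. \<exists>r\<ge>R. good_cell g P 1 K C \<delta> r"
    using cells[of K] by blast
  have top: "filterlim (\<lambda>s. Re (L s)) at_top at_top" "filterlim (\<lambda>s. Re (M s)) at_top at_top"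
    and bot: "filterlim (\<lambda>s. Re (L s)) at_top at_bot" "filterlim (\<lambda>s. Re (M s)) at_top at_bot"
    using ends by (auto simp: o_def)
  obtain T1 T2 where T: "antimono_on {..-T1} (Re \<circ> L)" "mono_on {T1..} (Re \<circ> L)" "antimono_on {..-T2} (Re \<circ> M)" "mono_on {T2..} (Re \<circ> M)"
    using ends by auto
  have cL: "continuous_on UNIV L" "continuous_on UNIV M" using L M by (auto simp: piecewise_C1_differentiable_on_def)
  show ?thesis
  proof (rule contour_integral_deform[OF L M P g _ _ intL intM, where ?e1.0 = 1 and ?e2.0 = 1 and K = K and C = C and \<delta> = \<delta> and W = "(=)"])
    show "range L \<inter> P = {}" "range M \<inter> P = {}"
      using var by (force simp: has_arg_variation_def)+
    show "\<exists>r1\<ge>R. \<exists>r2\<ge>R. r1 = r2 \<and> good_cell g P 1 K C \<delta> r1 \<and> good_cell g P 1 K C \<delta> r2" for R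
      using r[of R] by blast
    fix S :: real
    define S' where "S' = Max {S, T1, T2, 0}"
    have S': "S \<le> S'" "T1 \<le> S'" "T2 \<le> S'" "0 \<le> S'" by (auto simp: S'_def)
    have bdd: "\<exists>R. \<forall>s\<in>{-S'..S'}. Re (N s) \<le> R" if "continuous_on UNIV N" for N :: "real \<Rightarrow> complex"
    proof -
      have "compact ((\<lambda>s. Re (N s)) ` {-S'..S'})"
        by (intro compact_continuous_image continuous_intros continuous_on_subset[OF that]) auto
      then show ?thesis
        by (meson bounded_imp_bdd_above bdd_above_def compact_imp_bounded imageI)
    qed
    obtain R1 R2 where R12: "\<And>s. s \<in> {-S'..S'} \<Longrightarrow> Re (L s) \<le> R1" "\<And>s. s \<in> {-S'..S'} \<Longrightarrow> Re (M s) \<le> R2"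
      using bdd[OF cL(1)] bdd[OF cL(2)] by blast
    define R where "R = max R1 R2"
    have R: "Re (L s) \<le> R" "Re (M s) \<le> R" if "s \<in> {-S'..S'}" for s
      using R12[OF that] by (auto simp: R_def)
    have "unwound L M a b c d p" if rr: "r \<ge> R" and gc: "good_cell g P 1 K C \<delta> r"
      and *: "a < -S'" "b > S'" "c < -S'" "d > S'" and p: "p \<in> P"
      and cl: "L b \<in> cell 1 K r \<delta>" "M d \<in> cell 1 K r \<delta>" "L a \<in> cell 1 K r \<delta>" "M c \<in> cell 1 K r \<delta>" for a b c d p r
    proof -
      have nc: "p \<notin> cell 1 K r \<delta>" using gc p by (auto simp: good_cell_def)
      consider "\<bar>Im p\<bar> > K" | "Re p > r + \<delta>" | "Re p < r" using nc by (force simp: cell_def)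
      then show ?thesis
      proof cases
        case 1
        have "convex {z. \<bar>Im z\<bar> \<le> K}"
        proof -
          have "{z. \<bar>Im z\<bar> \<le> K} = {z. Im z \<le> K} \<inter> {z. Im z \<ge> -K}" by auto
          then show ?thesis by (simp add: convex_Int convex_halfspace_Im_le convex_halfspace_Im_ge)
        qed
        then show ?thesis unfolding unwound_def
          using K 1 by (intro disjI1 exI[of _ "{z. \<bar>Im z\<bar> \<le> K}"]) auto
      next
        case 2
        have mid: "Re (L s) \<le> r + \<delta>" "Re (M s) \<le> r + \<delta>" if "s \<in> {-S'..S'}" for s
          using R[OF that] rr C by linarith+
        have ends_le: "Re (L a) \<le> r + \<delta>" "Re (L b) \<le> r + \<delta>" "Re (M c) \<le> r + \<delta>" "Re (M d) \<le> r + \<delta>"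
          using cl by (simp_all add: cell_def)
        have "L ` {a..b} \<subseteq> {z. Re z \<le> r + \<delta>}" "M ` {c..d} \<subseteq> {z. Re z \<le> r + \<delta>}"
          using right_loop_Re_le[OF T(1,2) S'(2) mid(1) *(1,2) ends_le(1,2)] right_loop_Re_le[OF T(3,4) S'(3) mid(2) *(3,4) ends_le(3,4)]
          by blast+
        then have "\<exists>X. convex X \<and> p \<notin> X \<and> L ` {a..b} \<subseteq> X \<and> M ` {c..d} \<subseteq> X"
          using 2 by (intro exI[of _ "{z. Re z \<le> r + \<delta>}"]) (simp add: convex_halfspace_Re_le)
        then show ?thesis by (simp add: unwound_def)
      next
        case 3
        have "Re p < Re (L a)" "Re p < Re (L b)" "Re p < Re (M c)" "Re p < Re (M d)"
          using 3 cl by (simp_all add: cell_def)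
        then have "arg_tails L p a b 1 1" "arg_tails M p c d 1 1"
          using right_loop_arg_tails[OF ends(1) T(1,2) S'(2) *(1,2)] right_loop_arg_tails[OF ends(2) T(3,4) S'(3) *(3,4)] by blast+
        moreover obtain v where "has_arg_variation L p v" "has_arg_variation M p v" using var[OF p] by blast
        ultimately show ?thesis unfolding unwound_def
          by (intro disjI2 exI[of _ v] exI[of _ 1]) auto
      qed
    qed
    then show "\<exists>S'\<ge>S. \<exists>R. \<forall>r1\<ge>R. \<forall>r2\<ge>R. \<forall>a b c d. r1 = r2 \<and>
        good_cell g P 1 K C \<delta> r1 \<and> good_cell g P 1 K C \<delta> r2 \<and>
        a < -S' \<and> b > S' \<and> c < -S' \<and> d > S' \<and>
        L b \<in> cell 1 K r1 \<delta> \<and> M d \<in> cell 1 K r1 \<delta> \<and> L a \<in> cell 1 K r2 \<delta> \<and> M c \<in> cell 1 K r2 \<delta> \<longrightarrow>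
        (\<forall>p\<in>P. unwound L M a b c d p)"
      using S'(1) by (intro exI[of _ S'] conjI exI[of _ R]) blast+
  qed (use K top bot C in auto)
qed

section \<open>Comparability on cells\<close>

lemma Ln_add_one:
  assumes "w \<notin> \<real>\<^sub>\<le>\<^sub>0"
  shows "Ln (w + 1) - Ln w = Ln (1 + 1 / w)"
proof -
  have w: "w \<noteq> 0" "w + 1 \<noteq> 0"
  proof -
    show "w \<noteq> 0" using assms by auto
    show "w + 1 \<noteq> 0"
    proof
      assume "w + 1 = 0"
      then have "w = of_real (-1)" by (simp add: eq_neg_iff_add_eq_0)
      then show False using assms by (simp del: of_real_minus)
    qed
  qed
  \<comment> \<open>\<open>w\<close> and \<open>w + 1\<close> have the same imaginary part, so their
    arguments lie on the same side and no multiple of 2 pi is lost.\<close>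
  have "Im (Ln (w + 1)) - Im (Ln w) < pi \<and> Im (Ln (w + 1)) - Im (Ln w) > - pi"
  proof (cases "Im w = 0")
    case True
    then have "Re w > 0" using assms by (auto simp: complex_nonpos_Reals_iff)
    then have "Im (Ln w) = 0" "Im (Ln (w + 1)) = 0"
      using True by (metis Im_Ln_eq_0 w(1)) (metis Im_Ln_eq_0 w(2) True \<open>Re w > 0\<close> add_pos_pos complex.sel plus_complex.sel one_complex.sel zero_less_one add_0_right)
    then show ?thesis by simp
  next
    case False
    then consider "Im w > 0" | "Im w < 0" by linarith
    then show ?thesis
    proof cases
      case 1
      then have "0 < Im (Ln w)" "Im (Ln w) < pi" "0 < Im (Ln (w + 1))" "Im (Ln (w + 1)) < pi"
        using Im_Ln_pos_lt_imp[of w] Im_Ln_pos_lt_imp[of "w + 1"] Im_Ln_pos_lt[of w] Im_Ln_pos_lt[of "w+1"] w by auto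
      then show ?thesis by linarith
    next
      case 2
      have "Im (Ln z) < 0" "- pi < Im (Ln z)" if "Im z < 0" for z
        using that Im_Ln_pos_le[of z] mpi_less_Im_Ln[of z] Im_Ln_le_pi[of z] by force+
      from this[of w] this[of "w + 1"] 2 show ?thesis by simp
    qed
  qed
  then have "Ln (exp (Ln (w + 1) - Ln w)) = Ln (w + 1) - Ln w" by (intro Ln_exp) auto
  then show ?thesis using w by (simp add: exp_diff add_divide_distrib)
qed

definition gamma_dom :: "real \<Rightarrow> complex set" where
  "gamma_dom M = {z. Re z \<ge> - M \<and> (\<bar>Im z\<bar> \<ge> 2 \<or> Re z \<ge> 2)}"

lemma gamma_dom_slit: "z \<in> gamma_dom M \<Longrightarrow> z \<notin> \<real>\<^sub>\<le>\<^sub>0"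
  by (auto simp: gamma_dom_def complex_nonpos_Reals_iff)

lemma gamma_dom_norm: "z \<in> gamma_dom M \<Longrightarrow> norm z \<ge> 2"
  using abs_Re_le_cmod[of z] abs_Im_le_cmod[of z] by (auto simp: gamma_dom_def)

lemma gamma_dom_add: "z \<in> gamma_dom M \<Longrightarrow> z + of_nat k \<in> gamma_dom M"
  by (auto simp: gamma_dom_def)

text \<open>Telescoping \<open>Ln (z + of_nat m)\<close> and comparing with the limit formula for
  Digamma shows that \<open>Digamma z - Ln z\<close> is the sum of
  \<open>Ln (1 + 1 / (z + of_nat k)) - 1 / (z + of_nat k)\<close>. The terms are of order 1/k^2
  uniformly on the domain. For ratios of Gamma values this crude form of Stirling's formula is
  enough.\<close>

lemma Digamma_Ln_bounded:
  assumes M: "M \<ge> 0"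
  obtains C where "C \<ge> 0" "\<And>z. z \<in> gamma_dom M \<Longrightarrow> norm (Digamma z - Ln z) \<le> C"
proof -
  \<comment> \<open>The first 2 comes from \<open>1 - norm u \<ge> 1 / 2\<close> for
    \<open>u = 1 / (z + of_nat k)\<close>, the square of \<open>M + 2\<close> from
    \<open>real k + 1 \<le> (M + 2) * norm (z + of_nat k)\<close>.\<close>
  define b where "b k = 2 * (M + 2)\<^sup>2 * (1 / (real k + 1)\<^sup>2)" for k :: nat
  have "summable (\<lambda>k. 1 / (real (Suc k))\<^sup>2)"
    using inverse_power_summable[of 2] by (subst summable_Suc_iff) (simp add: inverse_eq_divide)
  then have sb: "summable b" unfolding b_def by (intro summable_mult) (simp add: add.commute)
  have "norm (Digamma z - Ln z) \<le> suminf b" if z: "z \<in> gamma_dom M" for z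
  proof -
    have slit: "z + of_nat k \<notin> \<real>\<^sub>\<le>\<^sub>0" for k using gamma_dom_slit[OF gamma_dom_add[OF z]] .
    have n2: "norm (z + of_nat k) \<ge> 2" for k using gamma_dom_norm[OF gamma_dom_add[OF z]] .
    let ?t = "\<lambda>k. Ln (1 + 1 / (z + of_nat k)) - 1 / (z + of_nat k)"
    have bk: "norm (?t k) \<le> b k" for k
    proof -
      let ?u = "1 / (z + of_nat k)"
      have u: "norm ?u \<le> 1 / 2" using n2[of k] frac_le[of 1 1 2 "norm (z + of_nat k)"] by (simp add: norm_divide)
      have "norm (?t k) \<le> (norm ?u)\<^sup>2 / (1 - norm ?u)" using Ln_approx_linear[of ?u] u by simp
      also have "\<dots> \<le> (norm ?u)\<^sup>2 / (1 / 2)" using u by (intro divide_left_mono) auto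
      also have "\<dots> = 2 * (1 / (norm (z + of_nat k))\<^sup>2)" by (simp add: norm_divide power_divide)
      also have "\<dots> \<le> 2 * ((M + 2)\<^sup>2 / (real k + 1)\<^sup>2)"
      proof -
        have "real k \<le> norm (z + of_nat k) + M"
          using z complex_Re_le_cmod[of "z + of_nat k"] by (auto simp: gamma_dom_def)
        moreover have "(M + 1) * 1 \<le> (M + 1) * norm (z + of_nat k)"
          using n2[of k] M by (intro mult_left_mono) auto
        ultimately have "real k + 1 \<le> (M + 2) * norm (z + of_nat k)" by (simp add: algebra_simps)
        then have "(real k + 1)\<^sup>2 \<le> ((M + 2) * norm (z + of_nat k))\<^sup>2" by (intro power_mono) auto
        moreover have "norm (z + of_nat k) > 0" using n2[of k] by linarith
        ultimately show ?thesis by (simp only: power_mult_distrib) (simp add: divide_simps mult.commute)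
      qed
      finally show ?thesis by (simp add: b_def)
    qed
    have tele: "Ln (z + of_nat m) = Ln z + (\<Sum>k<m. Ln (1 + 1 / (z + of_nat k)))" for m
    proof (induction m)
      case (Suc m)
      have "Ln (z + of_nat (Suc m)) = Ln (z + of_nat m) + Ln (1 + 1 / (z + of_nat m))"
        using Ln_add_one[OF slit[of m]] by (simp add: algebra_simps)
      with Suc show ?case by simp
    qed simp
    have z0: "z \<noteq> 0" using n2[of 0] by auto
    have "(\<lambda>m. 1 + z / of_nat m) \<longlonglongrightarrow> 1 + 0"
      by (intro tendsto_intros tendsto_divide_0[OF tendsto_const] tendsto_of_nat)
    then have "(\<lambda>m. Ln (1 + z / of_nat m)) \<longlonglongrightarrow> Ln 1"
      by (intro tendsto_Ln) (auto simp: complex_nonpos_Reals_iff)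
    moreover have "eventually (\<lambda>m. Ln (1 + z / of_nat m) = Ln (z + of_nat m) - of_real (ln (real m))) sequentially"
      using eventually_gt_at_top[of 0]
    proof eventually_elim
      case (elim m)
      then have "1 + z / of_nat m = (z + of_nat m) / of_real (real m)" by (simp add: field_simps)
      moreover have "z + of_nat m \<noteq> 0" using n2[of m] by auto
      ultimately show ?case using elim Ln_divide_of_real[of "real m" "z + of_nat m"] by simp
    qed
    ultimately have 1: "(\<lambda>m. Ln (z + of_nat m) - of_real (ln (real m))) \<longlonglongrightarrow> 0"
      by (auto intro: Lim_transform_eventually)
    have "(\<lambda>m. (of_real (ln (real m)) - (\<Sum>n<m. inverse (z + of_nat n))) + (Ln (z + of_nat m) - of_real (ln (real m))) - Ln z)
        \<longlonglongrightarrow> Digamma z + 0 - Ln z"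
      by (intro tendsto_intros Digamma_LIMSEQ 1 z0)
    then have "(\<lambda>m. \<Sum>k<m. ?t k) \<longlonglongrightarrow> Digamma z - Ln z"
      by (simp add: tele sum_subtractf inverse_eq_divide)
    moreover have "norm (\<Sum>k<m. ?t k) \<le> suminf b" for m
    proof -
      have "norm (\<Sum>k<m. ?t k) \<le> (\<Sum>k<m. b k)" by (intro sum_norm_le bk)
      also have "\<dots> \<le> suminf b" by (intro sum_le_suminf sb) (auto simp: b_def)
      finally show ?thesis .
    qed
    ultimately show ?thesis by (intro Lim_bounded[OF tendsto_norm]) auto
  qed
  moreover have "suminf b \<ge> 0" by (intro suminf_nonneg sb) (auto simp: b_def)
  ultimately show thesis using that by blast
qed

text \<open>\<open>Digamma x - Ln z\<close> is bounded for \<open>x\<close> on the segment, so by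
  the mean value inequality \<open>ln_Gamma w - ln_Gamma z\<close> differs from
  \<open>(w - z) * Ln z\<close> by a bounded amount. The real part of the latter is
  \<open>Re (w - z) * ln (norm z)\<close> up to the bounded product
  \<open>Im (w - z) * Im (Ln z)\<close>.\<close>

lemma Gamma_ratio_bound:
  assumes M: "M \<ge> 0" and K: "K \<ge> 0"
  obtains C where "C > 0"
    "\<And>z w. closed_segment z w \<subseteq> gamma_dom M \<Longrightarrow> norm (w - z) \<le> K \<Longrightarrow>
       norm (Gamma w) \<le> C * norm z powr Re (w - z) * norm (Gamma z)"
proof -
  obtain C1 where C1: "C1 \<ge> 0" "\<And>z. z \<in> gamma_dom M \<Longrightarrow> norm (Digamma z - Ln z) \<le> C1"
    by (rule Digamma_Ln_bounded[OF M]) blast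
  \<comment> \<open>Moving by at most \<open>K\<close> outside the disc of radius 2 changes the
    logarithm of the norm by at most \<open>ln (1 + K)\<close> and the argument by at most
    \<open>2 * pi\<close>.\<close>
  define C2 where "C2 = C1 + (ln (1 + K) + 2 * pi)"
  have C2: "C2 \<ge> 0" using C1 K by (simp add: C2_def)
  show thesis
  proof (rule that[of "exp (C2 * K + K * pi)"])
    fix z w assume seg: "closed_segment z w \<subseteq> gamma_dom M" and wz: "norm (w - z) \<le> K"
    have zw: "z \<in> gamma_dom M" "w \<in> gamma_dom M" using seg by auto
    have z0: "z \<noteq> 0" using gamma_dom_norm[OF zw(1)] by auto
    have ratio: "ln (norm y) - ln (norm x) \<le> ln (1 + K)" if "norm x \<ge> 2" "norm y \<ge> 2" "norm (x - y) \<le> K" for x y :: complex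
    proof -
      have "norm y \<le> norm x + K" using norm_triangle_ineq2[of y x] that by (simp add: norm_minus_commute)
      also have "\<dots> \<le> norm x * (1 + K)" using that K mult_right_mono[of 1 "norm x" K] by (simp add: algebra_simps)
      finally have le: "norm y \<le> norm x * (1 + K)" .
      have pos: "norm x > 0" "norm y > 0" using that by linarith+
      have "ln (norm y) \<le> ln (norm x * (1 + K))" using le pos K by (subst ln_le_cancel_iff) auto
      also have "\<dots> = ln (norm x) + ln (1 + K)" using pos K by (subst ln_mult) auto
      finally show ?thesis by simp
    qed
    have "norm ((ln_Gamma w - w * Ln z) - (ln_Gamma z - z * Ln z)) \<le> C2 * norm (w - z)"
    proof (rule field_differentiable_bound[of "closed_segment z w" "\<lambda>x. ln_Gamma x - x * Ln z" "\<lambda>x. Digamma x - Ln z"])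
      fix x assume x: "x \<in> closed_segment z w"
      then have xd: "x \<in> gamma_dom M" using seg by auto
      show "((\<lambda>x. ln_Gamma x - x * Ln z) has_field_derivative (Digamma x - Ln z)) (at x within closed_segment z w)"
        using gamma_dom_slit[OF xd] by (auto intro!: derivative_eq_intros)
      have xz: "norm (x - z) \<le> K" using segment_bound1[OF x] wz by (simp add: norm_minus_commute)
      have "norm (Ln x - Ln z) \<le> \<bar>Re (Ln x - Ln z)\<bar> + \<bar>Im (Ln x - Ln z)\<bar>" by (rule cmod_le)
      moreover have "\<bar>Im (Ln x - Ln z)\<bar> \<le> 2 * pi"
        using Im_Ln_le_pi[of x] Im_Ln_le_pi[of z] mpi_less_Im_Ln[of x] mpi_less_Im_Ln[of z] z0 gamma_dom_norm[OF xd] by fastforce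
      moreover have "\<bar>Re (Ln x - Ln z)\<bar> \<le> ln (1 + K)"
      proof -
        have "x \<noteq> 0" using gamma_dom_norm[OF xd] by auto
        then show ?thesis using ratio[of x z] ratio[of z x] gamma_dom_norm[OF xd] gamma_dom_norm[OF zw(1)] xz z0
          by (auto simp: norm_minus_commute)
      qed
      ultimately have "norm (Ln x - Ln z) \<le> ln (1 + K) + 2 * pi" by linarith
      then show "norm (Digamma x - Ln z) \<le> C2"
        using C1(2)[OF xd] norm_triangle_ineq[of "Digamma x - Ln x" "Ln x - Ln z"] by (simp add: C2_def)
    qed auto
    also have "\<dots> \<le> C2 * K" using wz C2 by (intro mult_left_mono)
    finally have *: "Re ((ln_Gamma w - w * Ln z) - (ln_Gamma z - z * Ln z)) \<le> C2 * K"
      using complex_Re_le_cmod order_trans by blast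
    have eq: "Re ((w - z) * Ln z) = Re (w - z) * ln (norm z) - Im (w - z) * Im (Ln z)"
      using z0 by (simp add: algebra_simps)
    have "- (Im (w - z) * Im (Ln z)) \<le> \<bar>Im (w - z)\<bar> * \<bar>Im (Ln z)\<bar>" by (simp add: abs_mult[symmetric])
    also have "\<dots> \<le> K * pi" using abs_Im_le_cmod[of "w - z"] wz Im_Ln_le_pi[of z] mpi_less_Im_Ln[of z] z0 K
      by (intro mult_mono) auto
    finally have "Re ((w - z) * Ln z) \<le> Re (w - z) * ln (norm z) + K * pi" using eq by linarith
    with * have le: "Re (ln_Gamma w) \<le> Re (ln_Gamma z) + Re (w - z) * ln (norm z) + (C2 * K + K * pi)"
      by (simp add: algebra_simps)
    have nz: "x \<notin> \<int>\<^sub>\<le>\<^sub>0" if "x \<in> gamma_dom M" for x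
      using gamma_dom_slit[OF that] nonpos_Ints_subset_nonpos_Reals by blast
    have "norm (Gamma w) = exp (Re (ln_Gamma w))" "norm (Gamma z) = exp (Re (ln_Gamma z))"
      using nz[OF zw(1)] nz[OF zw(2)] by (simp_all add: Gamma_complex_altdef)
    then show "norm (Gamma w) \<le> exp (C2 * K + K * pi) * norm z powr Re (w - z) * norm (Gamma z)"
      using le z0 by (simp add: powr_def exp_add[symmetric] algebra_simps)
  qed auto
qed

text \<open>
  The exponent \<open>d\<close> is additive under products; it reflects \<open>\<Gamma>(z)/\<Gamma>(w) \<approx> r powr Re (z - w)\<close> for
  neighbouring \<open>z\<close> and \<open>w\<close> at distance \<open>r\<close> from the origin.
\<close>

definition comparable :: "real set \<Rightarrow> complex \<Rightarrow> real \<Rightarrow> real \<Rightarrow> real \<Rightarrow> (complex \<Rightarrow> complex) \<Rightarrow> bool" where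
  "comparable G e K \<delta> d f \<longleftrightarrow> (\<exists>C\<ge>0. \<exists>R. \<forall>r\<in>G. r \<ge> R \<longrightarrow>
     (\<forall>z\<in>cell e K r \<delta>. \<forall>w\<in>cell e K r \<delta>. norm (f z) \<le> C * r powr (d * Re (z - w)) * norm (f w)))"

lemma comparableI:
  assumes "C \<ge> 0" "\<And>r z w. r \<in> G \<Longrightarrow> r \<ge> R \<Longrightarrow> z \<in> cell e K r \<delta> \<Longrightarrow> w \<in> cell e K r \<delta> \<Longrightarrow>
     norm (f z) \<le> C * r powr (d * Re (z - w)) * norm (f w)"
  shows "comparable G e K \<delta> d f"
  unfolding comparable_def using assms by blast

lemma comparableE:
  assumes "comparable G e K \<delta> d f"
  obtains C R where "C \<ge> 0" "\<And>r z w. r \<in> G \<Longrightarrow> r \<ge> R \<Longrightarrow> z \<in> cell e K r \<delta> \<Longrightarrow> w \<in> cell e K r \<delta> \<Longrightarrow>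
     norm (f z) \<le> C * r powr (d * Re (z - w)) * norm (f w)"
  using assms unfolding comparable_def by blast

lemma comparable_mult:
  assumes "comparable G e K \<delta> d f" "comparable G e K \<delta> d' g"
  shows "comparable G e K \<delta> (d + d') (\<lambda>z. f z * g z)"
proof -
  obtain C R where C: "C \<ge> 0" "\<And>r z w. r \<in> G \<Longrightarrow> r \<ge> R \<Longrightarrow> z \<in> cell e K r \<delta> \<Longrightarrow> w \<in> cell e K r \<delta> \<Longrightarrow>
     norm (f z) \<le> C * r powr (d * Re (z - w)) * norm (f w)" using assms(1) by (rule comparableE) blast
  obtain C' R' where C': "C' \<ge> 0" "\<And>r z w. r \<in> G \<Longrightarrow> r \<ge> R' \<Longrightarrow> z \<in> cell e K r \<delta> \<Longrightarrow> w \<in> cell e K r \<delta> \<Longrightarrow>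
     norm (g z) \<le> C' * r powr (d' * Re (z - w)) * norm (g w)" using assms(2) by (rule comparableE) blast
  show ?thesis
  proof (rule comparableI[of "C * C'" _ "max R R'"])
    fix r z w assume *: "r \<in> G" "r \<ge> max R R'" "z \<in> cell e K r \<delta>" "w \<in> cell e K r \<delta>"
    have "norm (f z * g z) \<le> (C * r powr (d * Re (z - w)) * norm (f w)) * (C' * r powr (d' * Re (z - w)) * norm (g w))"
      unfolding norm_mult by (rule mult_mono) (use C(2)[OF *(1) _ *(3,4)] C'(2)[OF *(1) _ *(3,4)] C(1) * in auto)
    also have "\<dots> = C * C' * r powr ((d + d') * Re (z - w)) * norm (f w * g w)"
      by (simp add: norm_mult distrib_right powr_add)
    finally show "norm (f z * g z) \<le> C * C' * r powr ((d + d') * Re (z - w)) * norm (f w * g w)" .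
  qed (use C C' in auto)
qed

lemma comparable_inverse:
  assumes "comparable G e K \<delta> d f"
  shows "comparable G e K \<delta> (- d) (\<lambda>z. inverse (f z))"
proof -
  obtain C R where C: "C \<ge> 0" "\<And>r z w. r \<in> G \<Longrightarrow> r \<ge> R \<Longrightarrow> z \<in> cell e K r \<delta> \<Longrightarrow> w \<in> cell e K r \<delta> \<Longrightarrow>
     norm (f z) \<le> C * r powr (d * Re (z - w)) * norm (f w)" using assms(1) by (rule comparableE) blast
  show ?thesis
  proof (rule comparableI[OF C(1), of _ "max R 1"])
    fix r z w assume *: "r \<in> G" "r \<ge> max R 1" "z \<in> cell e K r \<delta>" "w \<in> cell e K r \<delta>"
    have **: "norm (f w) \<le> C * r powr (d * Re (w - z)) * norm (f z)" using C(2)[OF *(1) _ *(4,3)] * by auto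
    show "norm (inverse (f z)) \<le> C * r powr (- d * Re (z - w)) * norm (inverse (f w))"
    proof (cases "f z = 0 \<or> f w = 0")
      case True
      \<comment> \<open>By comparability in both directions a zero at one of the two points is a
        zero at the other, and \<open>inverse 0 = 0\<close>.\<close>
      then have "f z = 0"
        using ** C(2)[OF *(1) _ *(3,4)] * by auto
      then show ?thesis using C by simp
    next
      case False
      have "- d * Re (z - w) = d * Re (w - z)" by (simp add: algebra_simps)
      then show ?thesis using ** False by (simp only: norm_inverse) (simp add: divide_simps mult_ac)
    qed
  qed
qed

lemma comparable_cong:
  assumes "comparable G e K \<delta> d f" "\<And>r z. r \<in> G \<Longrightarrow> r \<ge> R0 \<Longrightarrow> z \<in> cell e K r \<delta> \<Longrightarrow> g z = f z"
  shows "comparable G e K \<delta> d g"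
proof -
  obtain C R where C: "C \<ge> 0" "\<And>r z w. r \<in> G \<Longrightarrow> r \<ge> R \<Longrightarrow> z \<in> cell e K r \<delta> \<Longrightarrow> w \<in> cell e K r \<delta> \<Longrightarrow>
     norm (f z) \<le> C * r powr (d * Re (z - w)) * norm (f w)" using assms(1) by (rule comparableE) blast
  show ?thesis by (rule comparableI[OF C(1), of _ "max R R0"]) (use C(2) assms(2) in auto)
qed

lemma comparable_near_const:
  assumes "c > 0" "\<And>r z. r \<in> G \<Longrightarrow> r \<ge> R0 \<Longrightarrow> z \<in> cell e K r \<delta> \<Longrightarrow> c \<le> norm (f z) \<and> norm (f z) \<le> C"
  shows "comparable G e K \<delta> 0 f"
proof (rule comparableI[of "\<bar>C\<bar> / c" _ "max R0 1"])
  fix r z w assume *: "r \<in> G" "r \<ge> max R0 1" "z \<in> cell e K r \<delta>" "w \<in> cell e K r \<delta>"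
  have "norm (f z) \<le> \<bar>C\<bar>" "c \<le> norm (f w)" using assms(2)[OF *(1) _ *(3)] assms(2)[OF *(1) _ *(4)] * by auto
  then have "norm (f z) * c \<le> \<bar>C\<bar> * norm (f w)" using assms(1) by (intro mult_mono) auto
  then show "norm (f z) \<le> \<bar>C\<bar> / c * r powr (0 * Re (z - w)) * norm (f w)"
    using assms(1) * by (simp add: field_simps)
qed (use assms in auto)

lemma comparable_const: "comparable G e K \<delta> 0 (\<lambda>z. c)"
  by (rule comparableI[of 1 _ 1]) auto

lemma comparable_prod_list:
  assumes "\<And>x. x \<in> set xs \<Longrightarrow> comparable G e K \<delta> (d x) (f x)"
  shows "comparable G e K \<delta> (\<Sum>x\<leftarrow>xs. d x) (\<lambda>z. \<Prod>x\<leftarrow>xs. f x z)"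
  using assms by (induction xs) (auto intro: comparable_const comparable_mult)

text \<open>The diameter of a cell does not depend on \<open>r\<close>, so
  \<open>z0 powr (z - w)\<close> is bounded and the exponent is 0.\<close>

lemma comparable_powr:
  assumes e: "norm e = 1" and z0: "z0 \<noteq> 0"
  shows "comparable G e K \<delta> 0 (\<lambda>z. z0 powr z)"
proof (rule comparableI[of "exp (\<bar>\<delta> + 2 * K\<bar> * norm (Ln z0))" _ 1])
  fix r z w assume *: "r \<in> G" "r \<ge> 1" "z \<in> cell e K r \<delta>" "w \<in> cell e K r \<delta>"
  have eq: "norm (z0 powr z) = norm (exp ((z - w) * Ln z0)) * norm (z0 powr w)"
    using z0 by (simp add: powr_def norm_mult[symmetric] exp_add[symmetric] algebra_simps del: norm_exp_eq_Re)
  have "norm (exp ((z - w) * Ln z0)) \<le> exp (norm ((z - w) * Ln z0))" by (rule norm_exp)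
  also have "\<dots> \<le> exp (\<bar>\<delta> + 2 * K\<bar> * norm (Ln z0))"
    using cell_norm_diff[OF *(3,4) e] by (auto simp: norm_mult intro!: mult_right_mono)
  finally have "norm (z0 powr z) \<le> exp (\<bar>\<delta> + 2 * K\<bar> * norm (Ln z0)) * norm (z0 powr w)"
    unfolding eq by (rule mult_right_mono) simp
  then show "norm (z0 powr z) \<le> exp (\<bar>\<delta> + 2 * K\<bar> * norm (Ln z0)) * r powr (0 * Re (z - w)) * norm (z0 powr w)"
    using * by simp
qed auto

lemma cell_norm:
  assumes "z \<in> cell e K r \<delta>" "norm e = 1"
  shows "r \<le> norm z" "norm z \<le> \<bar>r\<bar> + \<bar>\<delta>\<bar> + K"
proof -
  have n: "norm z = norm (z / e)" using assms by (simp add: norm_divide)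
  show "r \<le> norm z" using assms(1) complex_Re_le_cmod[of "z / e"] unfolding n cell_def by auto
  show "norm z \<le> \<bar>r\<bar> + \<bar>\<delta>\<bar> + K" using assms(1) cmod_le[of "z / e"] unfolding n cell_def by auto
qed

text \<open>A far cell is mapped into \<open>gamma_dom\<close>, where the ratio bound produces the
  factor \<open>norm (c + of_real B * w) powr (B * Re (z - w))\<close>. Its base is comparable with
  \<open>r\<close> and its exponent is bounded, so \<open>r\<close> may take the place of the base.
  In the direction 1 a negative \<open>B\<close> would lead into the poles.\<close>

lemma comparable_Gamma:
  assumes e: "(e = \<i> \<or> e = - \<i>) \<and> B \<noteq> 0 \<or> e = 1 \<and> B > 0" and K: "K \<ge> 0" "\<delta> \<ge> 0"
  shows "comparable G e K \<delta> B (\<lambda>z. Gamma (c + of_real B * z))"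
proof -
  define M where "M = norm c + \<bar>B\<bar> * K"
  define T where "T = \<bar>B\<bar> * (\<delta> + 2 * K)"
  have B0: "\<bar>B\<bar> > 0" and e1: "norm e = 1" using e by auto
  have "M \<ge> 0" "T \<ge> 0" using K by (auto simp: M_def T_def)
  then obtain C where C: "C > 0" "\<And>z w. closed_segment z w \<subseteq> gamma_dom M \<Longrightarrow> norm (w - z) \<le> T \<Longrightarrow>
       norm (Gamma w) \<le> C * norm z powr Re (w - z) * norm (Gamma z)"
    by (rule Gamma_ratio_bound) blast
  \<comment> \<open>Chosen such that \<open>q1 * r \<le> norm (c + of_real B * w)\<close> and
    \<open>norm (c + of_real B * w) \<le> q2 * r\<close> for large \<open>r\<close>; then \<Lambda>
    bounds the distance between the logarithms of this norm and of \<open>r\<close>.\<close>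
  define q1 where "q1 = \<bar>B\<bar> / 2"
  define q2 where "q2 = \<bar>B\<bar> * (2 + \<delta> + K)"
  have q: "q1 > 0" "q2 > 0" using B0 K by (auto simp: q1_def q2_def add_pos_nonneg)
  define \<Lambda> where "\<Lambda> = max \<bar>ln q1\<bar> \<bar>ln q2\<bar>"
  show ?thesis
  proof (rule comparableI[of "C * exp (T * \<Lambda>)" _ "max 1 ((2 + 2 * norm c) / \<bar>B\<bar>)"])
    fix r z w assume *: "r \<in> G" "r \<ge> max 1 ((2 + 2 * norm c) / \<bar>B\<bar>)" and z: "z \<in> cell e K r \<delta>" and w: "w \<in> cell e K r \<delta>"
    have r1: "r \<ge> 1" and rB: "2 + 2 * norm c \<le> \<bar>B\<bar> * r" using * B0 by (auto simp: field_simps)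
    have dom: "c + of_real B * x \<in> gamma_dom M" if x: "x \<in> cell e K r \<delta>" for x
    proof -
      have re: "Re x \<ge> -K" "e \<noteq> 1 \<Longrightarrow> \<bar>Re x\<bar> \<le> K" "e = 1 \<Longrightarrow> Re x \<ge> r" "e \<noteq> 1 \<Longrightarrow> \<bar>Im x\<bar> \<ge> r"
        using x e K r1 by (auto simp: cell_def)
      show ?thesis
      proof (cases "e = 1")
        case True
        then have "B > 0" using e by (auto simp: complex_eq_iff)
        then have "B * r \<le> B * Re x" using re True by simp
        moreover have "Re (c + of_real B * x) = Re c + B * Re x" "- Re c \<le> norm c" "0 \<le> norm c"
          using abs_Re_le_cmod[of c] by auto
        moreover have "2 + 2 * norm c \<le> B * r" using rB \<open>B > 0\<close> by simp
        ultimately have "Re (c + of_real B * x) \<ge> 2" by linarith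
        then show ?thesis using \<open>M \<ge> 0\<close> by (simp add: gamma_dom_def)
      next
        case False
        have "\<bar>B * Re x\<bar> \<le> \<bar>B\<bar> * K" using re(2)[OF False] by (auto simp: abs_mult intro!: mult_left_mono)
        then have 1: "Re (c + of_real B * x) \<ge> - M" using abs_Re_le_cmod[of c] by (simp add: M_def)
        have "\<bar>B * Im x\<bar> \<ge> \<bar>B\<bar> * r" using re(4)[OF False] by (auto simp: abs_mult intro!: mult_left_mono)
        then have "\<bar>Im (c + of_real B * x)\<bar> \<ge> 2" using abs_Im_le_cmod[of c] rB by simp
        with 1 show ?thesis by (simp add: gamma_dom_def)
      qed
    qed
    have seg: "closed_segment (c + of_real B * w) (c + of_real B * z) \<subseteq> gamma_dom M"
    proof
      fix y assume "y \<in> closed_segment (c + of_real B * w) (c + of_real B * z)"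
      then obtain u where u: "0 \<le> u" "u \<le> 1" "y = (1 - u) *\<^sub>R (c + of_real B * w) + u *\<^sub>R (c + of_real B * z)"
        by (auto simp: in_segment)
      have "y = c + of_real B * ((1 - u) *\<^sub>R w + u *\<^sub>R z)"
        by (simp add: u scaleR_conv_of_real algebra_simps)
      moreover have "(1 - u) *\<^sub>R w + u *\<^sub>R z \<in> cell e K r \<delta>"
        using convexD_alt[OF convex_cell w z u(1,2)] .
      ultimately show "y \<in> gamma_dom M" using dom by simp
    qed
    have diff: "(c + of_real B * z) - (c + of_real B * w) = of_real B * (z - w)" by (simp add: algebra_simps)
    have "norm ((c + of_real B * z) - (c + of_real B * w)) \<le> T"
      unfolding diff T_def using cell_norm_diff[OF z w e1] by (auto simp: norm_mult intro!: mult_left_mono)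
    from C(2)[OF seg this] have 1: "norm (Gamma (c + of_real B * z)) \<le> C * norm (c + of_real B * w) powr (B * Re (z - w)) * norm (Gamma (c + of_real B * w))"
      unfolding diff by simp
    have 2: "norm (c + of_real B * w) powr (B * Re (z - w)) \<le> r powr (B * Re (z - w)) * exp (T * \<Lambda>)"
    proof -
      define N where "N = norm (c + of_real B * w)"
      define t where "t = B * Re (z - w)"
      have nB: "norm (of_real B * w) = \<bar>B\<bar> * norm w" by (simp add: norm_mult)
      have "\<bar>B\<bar> * r \<le> \<bar>B\<bar> * norm w" using cell_norm(1)[OF w e1] by (intro mult_left_mono) auto
      then have lo: "q1 * r \<le> N" using norm_triangle_ineq2[of "of_real B * w" "-c"] rB unfolding N_def q1_def nB
        by (simp add: add.commute)
      have "\<bar>B\<bar> * norm w \<le> \<bar>B\<bar> * (r + \<delta> + K)" using cell_norm(2)[OF w e1] r1 K by (intro mult_left_mono) auto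
      then have "N \<le> norm c + \<bar>B\<bar> * (r + \<delta> + K)" using norm_triangle_ineq[of c "of_real B * w"] unfolding N_def nB by linarith
      also have "\<dots> \<le> \<bar>B\<bar> * r + \<bar>B\<bar> * (r + \<delta> * r + K * r)"
      proof (intro add_mono mult_left_mono)
        show "norm c \<le> \<bar>B\<bar> * r" using rB norm_ge_zero[of c] by linarith
      qed (use r1 K mult_left_mono[of 1 r \<delta>] mult_left_mono[of 1 r K] in auto)
      also have "\<dots> = q2 * r" by (simp add: q2_def algebra_simps)
      finally have hi: "N \<le> q2 * r" .
      have N0: "N > 0" using lo q r1 by (smt (verit) mult_pos_pos)
      have "ln q1 + ln r \<le> ln N" using lo q r1 N0 by (subst ln_mult_pos[symmetric]) auto
      moreover have "ln N \<le> ln q2 + ln r" using hi q r1 N0 by (subst ln_mult_pos[symmetric]) auto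
      ultimately have "\<bar>ln N - ln r\<bar> \<le> \<Lambda>" by (auto simp: \<Lambda>_def)
      moreover have "\<bar>t\<bar> \<le> T"
        using cell_norm_diff[OF z w e1] abs_Re_le_cmod[of "z - w"] unfolding t_def T_def abs_mult by (intro mult_left_mono) auto
      ultimately have "\<bar>t\<bar> * \<bar>ln N - ln r\<bar> \<le> T * \<Lambda>" by (intro mult_mono) (auto simp: \<Lambda>_def \<open>T \<ge> 0\<close>)
      then have "t * (ln N - ln r) \<le> T * \<Lambda>" unfolding abs_mult[symmetric] by linarith
      then have "t * ln N \<le> t * ln r + T * \<Lambda>" by (simp add: algebra_simps)
      then show ?thesis using N0 r1 unfolding N_def[symmetric] t_def[symmetric]
        by (simp add: powr_def exp_add[symmetric])
    qed
    have "C * norm (c + of_real B * w) powr (B * Re (z - w)) * norm (Gamma (c + of_real B * w)) \<le>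
        C * (r powr (B * Re (z - w)) * exp (T * \<Lambda>)) * norm (Gamma (c + of_real B * w))"
      using 2 C(1) by (intro mult_right_mono mult_left_mono) auto
    with 1 show "norm (Gamma (c + of_real B * z)) \<le> C * exp (T * \<Lambda>) * r powr (B * Re (z - w)) * norm (Gamma (c + of_real B * w))"
      by (simp add: mult_ac)
  qed (use C in auto)
qed

lemma comparable_rGamma:
  assumes "(e = \<i> \<or> e = - \<i>) \<and> B \<noteq> 0 \<or> e = 1 \<and> B > 0" "K \<ge> 0" "\<delta> \<ge> 0"
  shows "comparable G e K \<delta> (- B) (\<lambda>z. rGamma (c + of_real B * z))"
  using comparable_inverse[OF comparable_Gamma[OF assms, of G c]] by (simp add: Gamma_def)

text \<open>For \<open>z\<close> between \<open>z0\<close> and \<open>z1\<close> the numbers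
  \<open>d * Re (z - z0)\<close> and \<open>d * Re (z - z1)\<close> are not both positive.
  Comparison with the end point of nonpositive exponent removes the power of
  \<open>r\<close>.\<close>

lemma comparable_good_cell:
  assumes "comparable G e K \<delta> d f"
  obtains C R where "C \<ge> 0" "\<And>r z z0 z1. r \<in> G \<Longrightarrow> r \<ge> R \<Longrightarrow> z0 \<in> cell e K r \<delta> \<Longrightarrow> z1 \<in> cell e K r \<delta> \<Longrightarrow>
     z \<in> closed_segment z0 z1 \<Longrightarrow> norm (f z) \<le> C * max (norm (f z0)) (norm (f z1))"
proof -
  obtain C R where C: "C \<ge> 0" "\<And>r z w. r \<in> G \<Longrightarrow> r \<ge> R \<Longrightarrow> z \<in> cell e K r \<delta> \<Longrightarrow> w \<in> cell e K r \<delta> \<Longrightarrow>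
     norm (f z) \<le> C * r powr (d * Re (z - w)) * norm (f w)" using assms(1) by (rule comparableE) blast
  show thesis
  proof (rule that[OF C(1), of "max R 1"])
    fix r z z0 z1 assume *: "r \<in> G" "r \<ge> max R 1" "z0 \<in> cell e K r \<delta>" "z1 \<in> cell e K r \<delta>" "z \<in> closed_segment z0 z1"
    have z: "z \<in> cell e K r \<delta>" using closed_segment_subset[OF *(3,4) convex_cell] *(5) by auto
    obtain u where u: "0 \<le> u" "u \<le> 1" "z = (1 - u) *\<^sub>R z0 + u *\<^sub>R z1" using *(5) by (auto simp: in_segment)
    have "d * Re (z - z0) \<le> 0 \<or> d * Re (z - z1) \<le> 0"
    proof -
      define D where "D = d * Re (z1 - z0)"
      have "d * Re (z - z0) = u * D" "d * Re (z - z1) = - ((1 - u) * D)"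
        by (simp_all add: u D_def algebra_simps)
      then show ?thesis using u by (cases "D \<le> 0") (auto simp: mult_nonneg_nonpos)
    qed
    moreover have "norm (f z) \<le> C * max (norm (f z0)) (norm (f z1))" if "d * Re (z - w) \<le> 0" "w = z0 \<or> w = z1" for w
    proof -
      have wc: "w \<in> cell e K r \<delta>" using that * by auto
      have "norm (f z) \<le> C * r powr (d * Re (z - w)) * norm (f w)" using C(2)[OF *(1) _ z wc] * by auto
      also have "\<dots> \<le> C * 1 * max (norm (f z0)) (norm (f z1))"
        using that * C(1) powr_mono[of "d * Re (z - w)" 0 r] by (intro mult_mono mult_left_mono) auto
      finally show ?thesis by simp
    qed
    ultimately show "norm (f z) \<le> C * max (norm (f z0)) (norm (f z1))" by blast
  qed
qed

text \<open>Induction on the family. While \<open>t\<close> runs through an interval of length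
  \<open>lam\<close>, the value \<open>c + B * t\<close> moves by at most 1/2. Values within
  \<open>B * lam / 8\<close> of an integer in the first and also in the last quarter would give two
  different integers at distance less than 1, so one of the quarters is free. \<delta> and \<eta> do
  not depend on \<open>r\<close>, which keeps the cells uniform.\<close>

lemma away_from_int_subinterval:
  fixes Fam :: "(real \<times> real) list"
  assumes "\<forall>(c, B)\<in>set Fam. B > 0" "l > 0"
  shows "\<exists>\<delta>>0. \<exists>\<eta>>0. \<forall>r. \<exists>r'\<ge>r. r' + \<delta> \<le> r + l \<and>
     (\<forall>(c, B)\<in>set Fam. \<forall>t\<in>{r'..r' + \<delta>}. \<forall>n::int. \<bar>c + B * t - of_int n\<bar> \<ge> \<eta>)"
  using assms
proof (induction Fam)
  case Nil
  then show ?case by (intro exI[of _ l] conjI exI[of _ 1]) auto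
next
  case (Cons a Fam)
  obtain c B where a: "a = (c, B)" by force
  have B: "B > 0" using Cons.prems a by auto
  obtain \<delta> \<eta> where IH: "\<delta> > 0" "\<eta> > 0" "\<And>r. \<exists>r'\<ge>r. r' + \<delta> \<le> r + l \<and>
     (\<forall>(c, B)\<in>set Fam. \<forall>t\<in>{r'..r' + \<delta>}. \<forall>n::int. \<bar>c + B * t - of_int n\<bar> \<ge> \<eta>)"
    using Cons by (auto simp: split_beta)
  define lam where "lam = min \<delta> (1 / (2 * B))"
  have lam: "lam > 0" "lam \<le> \<delta>" "B * lam \<le> 1 / 2" using IH(1,2) B by (auto simp: lam_def min_def field_simps)
  show ?case
  proof (rule exI[of _ "lam / 4"], rule conjI[rotated], rule exI[of _ "min \<eta> (B * lam / 8)"], intro conjI allI)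
    fix r
    obtain r' where r': "r' \<ge> r" "r' + \<delta> \<le> r + l"
      and far: "\<And>c B t n. (c, B) \<in> set Fam \<Longrightarrow> t \<in> {r'..r' + \<delta>} \<Longrightarrow> \<bar>c + B * t - of_int n\<bar> \<ge> \<eta>"
      using IH(3)[of r] by blast
    have "\<exists>s\<in>{r', r' + 3 * lam / 4}. \<forall>t\<in>{s..s + lam / 4}. \<forall>n::int. \<bar>c + B * t - of_int n\<bar> \<ge> B * lam / 8"
    proof (rule ccontr)
      assume "\<not> ?thesis"
      then obtain t1 t2 and n1 n2 :: int where t: "t1 \<in> {r'..r' + lam / 4}" "t2 \<in> {r' + 3 * lam / 4..r' + 3 * lam / 4 + lam / 4}"
        "\<bar>c + B * t1 - of_int n1\<bar> < B * lam / 8" "\<bar>c + B * t2 - of_int n2\<bar> < B * lam / 8"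
        by (auto simp: not_le)
      have "B * (lam / 2) \<le> B * (t2 - t1)" "B * (t2 - t1) \<le> B * lam"
        using t B by (auto intro!: mult_left_mono)
      then have "\<bar>of_int (n2 - n1) :: real\<bar> < 1" "of_int (n2 - n1) > (0::real)"
        using t(3,4)[unfolded abs_less_iff] lam(3) mult_pos_pos[OF B lam(1)]
        unfolding abs_less_iff right_diff_distrib of_int_diff by linarith+
      then have "\<bar>n2 - n1\<bar> < 1" "n2 - n1 > 0" by (simp_all only: of_int_less_1_iff of_int_0_less_iff flip: of_int_abs)
      then show False by linarith
    qed
    then obtain s where s: "s \<in> {r', r' + 3 * lam / 4}" "\<And>t n. t \<in> {s..s + lam / 4} \<Longrightarrow> \<bar>c + B * t - of_int n\<bar> \<ge> B * lam / 8"
      by blast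
    have "s \<ge> r" "s + lam / 4 \<le> r + l" "{s..s + lam / 4} \<subseteq> {r'..r' + \<delta>}"
      using s(1) r' lam by auto
    moreover have "min \<eta> (B * lam / 8) \<le> \<bar>c' + B' * t - of_int n\<bar>"
      if "(c', B') \<in> set (a # Fam)" "t \<in> {s..s + lam / 4}" for c' B' t and n :: int
    proof (cases "(c', B') = a")
      case True
      then show ?thesis using s(2)[OF that(2), of n] by (simp add: a min_le_iff_disj)
    next
      case False
      then have "\<eta> \<le> \<bar>c' + B' * t - of_int n\<bar>" using that calculation(3) by (intro far) auto
      then show ?thesis by (simp add: min_le_iff_disj)
    qed
    ultimately show "\<exists>r'\<ge>r. r' + lam / 4 \<le> r + l \<and>
     (\<forall>(c', B')\<in>set (a # Fam). \<forall>t\<in>{r'..r' + lam / 4}. \<forall>n::int. \<bar>c' + B' * t - of_int n\<bar> \<ge> min \<eta> (B * lam / 8))"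
      by (intro exI[of _ s] conjI) auto
  qed (use lam IH(1,2) B in auto)
qed

text \<open>Since |sin (s + \<i> t)|^2 = (sin s)^2 + (sinh t)^2 for real s and t, the sine of the
  real part is a lower bound. Reduction by the nearest integer brings it into the range where the
  sine is monotone.\<close>

lemma norm_sin_bounds:
  fixes z :: complex
  assumes far: "\<And>n::int. \<bar>Re z - of_int n\<bar> \<ge> \<eta>" and im: "\<bar>Im z\<bar> \<le> Y" and \<eta>: "0 < \<eta>" "\<eta> \<le> 1 / 2"
  shows "sin (pi * \<eta>) \<le> norm (sin (of_real pi * z))" "norm (sin (of_real pi * z)) \<le> exp (pi * Y)"
proof -
  define k where "k = round (Re z)"
  have rd: "\<bar>Re z - of_int k\<bar> \<le> 1 / 2" unfolding k_def using of_int_round_abs_le[of "Re z"] by (simp add: abs_minus_commute)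
  have sk: "sin (pi * of_int k) = 0" by (simp add: sin_times_pi_eq_0 mult.commute)
  have "(cos (pi * of_int k))\<^sup>2 = 1" using sin_cos_squared_add[of "pi * of_int k"] unfolding sk by simp
  then have "cos (pi * of_int k) = 1 \<or> cos (pi * of_int k) = -1" by (simp only: power2_eq_1_iff)
  then have "\<bar>cos (pi * of_int k)\<bar> = 1" by (elim disjE) (simp_all only: abs_minus_cancel abs_one)
  moreover have "sin (pi * Re z - pi * of_int k) = sin (pi * Re z) * cos (pi * of_int k)"
    unfolding sin_diff sk by (simp only: mult_zero_right diff_zero)
  ultimately have "\<bar>sin (pi * Re z)\<bar> = \<bar>sin (pi * Re z - pi * of_int k)\<bar>"
    by (simp only: abs_mult mult_1_right)
  also have "\<dots> = \<bar>sin (pi * (Re z - of_int k))\<bar>" by (simp only: right_diff_distrib)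
  also have "\<dots> = sin (pi * \<bar>Re z - of_int k\<bar>)"
  proof -
    have abs_sin: "\<bar>sin (pi * y)\<bar> = sin (pi * \<bar>y\<bar>)" if "\<bar>y\<bar> \<le> 1 / 2" for y
    proof -
      have "sin (pi * \<bar>y\<bar>) \<ge> 0" using that by (intro sin_ge_zero) (auto intro: mult_left_le)
      moreover have "sin (pi * \<bar>y\<bar>) = sin (pi * y) \<or> sin (pi * \<bar>y\<bar>) = - sin (pi * y)"
        by (cases "y \<ge> 0") simp_all
      ultimately show ?thesis by linarith
    qed
    show ?thesis by (rule abs_sin[OF rd])
  qed
  finally have eq: "\<bar>sin (pi * Re z)\<bar> = sin (pi * \<bar>Re z - of_int k\<bar>)" .
  have "sin (pi * \<eta>) \<le> sin (pi * \<bar>Re z - of_int k\<bar>)"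
  proof (rule sin_monotone_2pi_le)
    have "0 \<le> pi * \<eta>" using \<eta> by simp
    then show "- (pi / 2) \<le> pi * \<eta>" using pi_ge_zero by linarith
    show "pi * \<eta> \<le> pi * \<bar>Re z - of_int k\<bar>" by (rule mult_left_mono[OF far pi_ge_zero])
    show "pi * \<bar>Re z - of_int k\<bar> \<le> pi / 2" using mult_left_mono[OF rd pi_ge_zero] by simp
  qed
  with eq have 1: "sin (pi * \<eta>) \<le> \<bar>sin (pi * Re z)\<bar>" by simp
  have "E + inverse E \<ge> 2" if "E > 0" for E :: real
  proof -
    have "E + inverse E - 2 = (E - 1)\<^sup>2 / E" using that by (simp add: field_simps power2_eq_square)
    also have "\<dots> \<ge> 0" using that by simp
    finally show ?thesis by simp
  qed
  from this[of "exp (2 * Im (of_real pi * z))"]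
  have "\<bar>sin (pi * Re z)\<bar>\<^sup>2 \<le> (norm (sin (of_real pi * z)))\<^sup>2"
    using norm_sin_squared[of "of_real pi * z"] cos_double_sin[of "pi * Re z"] by simp
  then have "\<bar>sin (pi * Re z)\<bar> \<le> norm (sin (of_real pi * z))" by (rule power2_le_imp_le) simp
  with 1 show "sin (pi * \<eta>) \<le> norm (sin (of_real pi * z))" by simp
  have "norm (exp (\<i> * (of_real pi * z))) \<le> exp (pi * Y)" "norm (exp (- (\<i> * (of_real pi * z)))) \<le> exp (pi * Y)"
    using mult_left_mono[of "- Im z" Y pi] im by (auto simp: abs_le_iff)
  then have "norm (exp (\<i> * (of_real pi * z)) - exp (- (\<i> * (of_real pi * z)))) \<le> 2 * exp (pi * Y)"
    using norm_triangle_ineq4[of "exp (\<i> * (of_real pi * z))" "exp (- (\<i> * (of_real pi * z)))"] by linarith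
  then show "norm (sin (of_real pi * z)) \<le> exp (pi * Y)"
    by (simp add: sin_exp_eq norm_divide norm_mult)
qed

section \<open>The hypergeometric series and Euler's integral\<close>

definition hyp_coeff :: "complex \<Rightarrow> complex \<Rightarrow> complex \<Rightarrow> nat \<Rightarrow> complex" where
  "hyp_coeff \<gamma> \<mu> v k = pochhammer (- \<gamma>) k * Gamma (\<mu> + of_nat k) / fact k * v ^ k"

text \<open>For \<open>c\<close> outside the nonpositive integers this is \<Gamma>(\<mu>) /
  \<Gamma>(c) times the Gauss series 2F1(-\<gamma>, \<mu>; c; v). The reciprocal Gamma factors
  remove the poles in \<open>c\<close>.\<close>

definition hyp_F :: "complex \<Rightarrow> complex \<Rightarrow> complex \<Rightarrow> complex \<Rightarrow> complex" where
  "hyp_F \<gamma> \<mu> v c = (\<Sum>k. hyp_coeff \<gamma> \<mu> v k * rGamma (c + of_nat k))"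

lemma tendsto_nat_shift_ratio:
  "(\<lambda>n. norm (of_nat n + \<alpha> :: complex) / (real n + q)) \<longlonglongrightarrow> 1" if "q > 0"
proof -
  have "filterlim (\<lambda>n. real n + q) at_top sequentially"
    using filterlim_tendsto_add_at_top[OF tendsto_const[of q] filterlim_real_sequentially] by (simp add: add.commute)
  then have "filterlim (\<lambda>n. of_real (real n + q) :: complex) at_infinity sequentially"
    by (rule filterlim_compose[OF filterlim_of_real_at_infinity])
  then have "(\<lambda>n. 1 + (\<alpha> - of_real q) / of_real (real n + q)) \<longlonglongrightarrow> 1 + 0"
    by (intro tendsto_add tendsto_const tendsto_divide_0[OF tendsto_const])
  then have "(\<lambda>n. norm (1 + (\<alpha> - of_real q) / of_real (real n + q))) \<longlonglongrightarrow> norm (1 + 0 :: complex)"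
    by (rule tendsto_norm)
  moreover have "1 + (\<alpha> - of_real q) / of_real (real n + q) = (of_nat n + \<alpha>) / of_real (real n + q)" for n
  proof -
    have "complex_of_real (real n + q) \<noteq> 0" using that by (simp only: of_real_eq_0_iff)
    then show ?thesis by (simp add: divide_simps)
  qed
  moreover have "norm ((of_nat n + \<alpha>) / of_real (real n + q)) = norm (of_nat n + \<alpha>) / (real n + q)" for n
    using that by (simp only: norm_divide norm_of_real)
  ultimately show ?thesis by simp
qed

lemma eventually_quadratic_ratio:
  assumes "v < c" "v \<ge> 0" "p > 0" "q > 0"
  shows "eventually (\<lambda>n. norm (of_nat n + \<alpha> :: complex) * norm (of_nat n + \<beta> :: complex) * v \<le> c * ((real n + p) * (real n + q))) sequentially"
proof -
  have "(\<lambda>n. (norm (of_nat n + \<alpha>) / (real n + p)) * (norm (of_nat n + \<beta>) / (real n + q)) * v) \<longlonglongrightarrow> 1 * 1 * v"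
    by (intro tendsto_mult tendsto_nat_shift_ratio tendsto_const assms)
  then have "eventually (\<lambda>n. (norm (of_nat n + \<alpha>) / (real n + p)) * (norm (of_nat n + \<beta>) / (real n + q)) * v < c) sequentially"
    using assms(1) by (auto dest: order_tendstoD)
  then show ?thesis
  proof eventually_elim
    case (elim n)
    have "(real n + p) * (real n + q) > 0" using assms by (intro mult_pos_pos) auto
    moreover have "(norm (of_nat n + \<alpha>) / (real n + p)) * (norm (of_nat n + \<beta>) / (real n + q)) * v =
      (norm (of_nat n + \<alpha>) * norm (of_nat n + \<beta>) * v) / ((real n + p) * (real n + q))" by simp
    ultimately show ?case using elim by (simp only: pos_divide_less_eq less_imp_le)
  qed
qed

lemma hyp_coeff_Suc:
  assumes "Re \<mu> > 0"
  shows "hyp_coeff \<gamma> \<mu> v (Suc k) = hyp_coeff \<gamma> \<mu> v k * ((of_nat k - \<gamma>) * (of_nat k + \<mu>) * v / of_nat (Suc k))"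
proof -
  have "\<mu> + of_nat k \<notin> \<int>\<^sub>\<le>\<^sub>0"
    using assms by (auto elim!: nonpos_Ints_cases simp: complex_eq_iff)
  then have G: "Gamma (\<mu> + of_nat (Suc k)) = (\<mu> + of_nat k) * Gamma (\<mu> + of_nat k)"
    using Gamma_plus1[of "\<mu> + of_nat k"] by (simp add: add_ac)
  show ?thesis
    unfolding hyp_coeff_def pochhammer_Suc G fact_Suc power_Suc by (simp add: divide_simps del: of_nat_Suc)
qed

text \<open>The coefficients alone grow factorially. Division by \<open>fact n\<close> stands for
  the decay of \<open>rGamma (c + of_nat k)\<close> and lowers the limit of the ratios to
  \<open>norm v\<close>; \<open>c\<close> is the midpoint between this limit and 1.\<close>

lemma summable_hyp_majorant:
  assumes \<mu>: "Re \<mu> > 0" and v: "norm v < 1"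
  shows "summable (\<lambda>n. norm (hyp_coeff \<gamma> \<mu> v (n + k0)) / fact n)"
proof -
  define c where "c = (1 + norm v) / 2"
  have c: "norm v < c" "c < 1" using v by (auto simp: c_def)
  have "eventually (\<lambda>n. norm (of_nat n + (of_nat k0 - \<gamma>)) * norm (of_nat n + (of_nat k0 + \<mu>)) * norm v
      \<le> c * ((real n + real (Suc k0)) * (real n + 1))) sequentially"
    using c by (intro eventually_quadratic_ratio) auto
  then obtain N where N: "\<And>n. n \<ge> N \<Longrightarrow> norm (of_nat n + (of_nat k0 - \<gamma>)) * norm (of_nat n + (of_nat k0 + \<mu>)) * norm v
      \<le> c * ((real n + real (Suc k0)) * (real n + 1))" by (auto simp: eventually_sequentially)
  show ?thesis
  proof (rule summable_ratio_test[of c N])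
    fix n assume n: "n \<ge> N"
    let ?A = "norm (of_nat n + (of_nat k0 - \<gamma>)) * norm (of_nat n + (of_nat k0 + \<mu>)) * norm v"
    have e: "of_nat (n + k0) - \<gamma> = of_nat n + (of_nat k0 - \<gamma>)" "of_nat (n + k0) + \<mu> = of_nat n + (of_nat k0 + \<mu>)"
      "real (Suc (n + k0)) = real n + real (Suc k0)" "real (Suc n) = real n + 1" by simp_all
    have H: "norm (hyp_coeff \<gamma> \<mu> v (Suc n + k0)) = norm (hyp_coeff \<gamma> \<mu> v (n + k0)) * (?A / (real n + real (Suc k0)))"
      unfolding add_Suc hyp_coeff_Suc[OF \<mu>] norm_mult norm_divide norm_of_nat e by (rule refl)
    have "norm (norm (hyp_coeff \<gamma> \<mu> v (Suc n + k0)) / fact (Suc n)) =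
       norm (hyp_coeff \<gamma> \<mu> v (n + k0)) / fact n * (?A / ((real n + real (Suc k0)) * (real n + 1)))"
      unfolding H fact_Suc e by (simp add: norm_mult mult_ac del: of_nat_Suc)
    also have "\<dots> \<le> norm (hyp_coeff \<gamma> \<mu> v (n + k0)) / fact n * c"
    proof (rule mult_left_mono)
      have "(real n + real (Suc k0)) * (real n + 1) > 0" by (intro mult_pos_pos) auto
      then show "?A / ((real n + real (Suc k0)) * (real n + 1)) \<le> c" using N[OF n] by (simp only: pos_divide_le_eq)
    qed auto
    finally show "norm (norm (hyp_coeff \<gamma> \<mu> v (Suc n + k0)) / fact (Suc n)) \<le> c * norm (norm (hyp_coeff \<gamma> \<mu> v (n + k0)) / fact n)"
      by (simp add: mult.commute)
  qed (use c in auto)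
qed

text \<open>The shift exceeds \<open>R\<close> by at least 1, so every factor of the Pochhammer
  product dominates the corresponding factor of \<open>fact n\<close>, uniformly for
  \<open>norm c \<le> R\<close>.\<close>

lemma rGamma_shift_bound:
  obtains D where "D \<ge> 0" "\<And>c n. norm (c::complex) \<le> R \<Longrightarrow> norm (rGamma (c + of_nat (n + Suc (nat \<lceil>R\<rceil>)))) \<le> D / fact n"
proof -
  define k0 where "k0 = Suc (nat \<lceil>R\<rceil>)"
  have "compact ((\<lambda>c::complex. rGamma (c + of_nat k0)) ` cball 0 R)"
    by (intro compact_continuous_image holomorphic_on_imp_continuous_on holomorphic_intros) auto
  from compact_imp_bounded[OF this] obtain D
    where D': "\<forall>x\<in>(\<lambda>c::complex. rGamma (c + of_nat k0)) ` cball 0 R. norm x \<le> D"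
    unfolding bounded_iff by blast
  have D: "norm (rGamma (c + of_nat k0)) \<le> D" if "norm c \<le> R" for c :: complex
    using D' that by auto
  show thesis
  proof (rule that[of "\<bar>D\<bar>"])
    fix c :: complex and n assume c: "norm c \<le> R"
    have k0: "real k0 \<ge> R + 1" unfolding k0_def by linarith
    have "fact n \<le> norm (pochhammer (c + of_nat k0) n)"
    proof (induction n)
      case (Suc n)
      have "real (n + 1) \<le> norm (c + of_nat k0 + of_nat n)"
        using norm_triangle_ineq2[of "of_nat (k0 + n)" "-c"] k0 c
        unfolding norm_of_nat by (simp add: add.commute add.left_commute)
      with Suc have "fact n * real (n + 1) \<le> norm (pochhammer (c + of_nat k0) n) * norm (c + of_nat k0 + of_nat n)"
        by (intro mult_mono) auto
      then show ?case unfolding pochhammer_Suc norm_mult fact_Suc by (simp add: mult.commute)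
    qed auto
    then have "fact n * norm (rGamma (c + of_nat k0 + of_nat n)) \<le> norm (rGamma (c + of_nat k0))"
      unfolding pochhammer_rGamma[of "c + of_nat k0" n] norm_mult by (intro mult_right_mono) auto
    also have "\<dots> \<le> \<bar>D\<bar>" using D[OF c] by simp
    finally have "norm (rGamma (c + of_nat k0 + of_nat n)) \<le> \<bar>D\<bar> / fact n"
      by (simp only: pos_le_divide_eq[OF fact_gt_zero] mult.commute[of _ "fact n"])
    moreover have "c + of_nat (n + k0) = c + of_nat k0 + of_nat n" by simp
    ultimately show "norm (rGamma (c + of_nat (n + Suc (nat \<lceil>R\<rceil>)))) \<le> \<bar>D\<bar> / fact n"
      unfolding k0_def[symmetric] by (simp only:)
  qed auto
qed

lemma hyp_F_sums:
  assumes \<mu>: "Re \<mu> > 0" and v: "norm v < 1"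
  shows "summable (\<lambda>k. norm (hyp_coeff \<gamma> \<mu> v k * rGamma (c + of_nat k)))"
    "(\<lambda>k. hyp_coeff \<gamma> \<mu> v k * rGamma (c + of_nat k)) sums hyp_F \<gamma> \<mu> v c"
proof -
  define k0 where "k0 = Suc (nat \<lceil>norm c\<rceil>)"
  obtain D where D: "D \<ge> 0" "\<And>n. norm (rGamma (c + of_nat (n + k0))) \<le> D / fact n"
    unfolding k0_def by (rule rGamma_shift_bound[of "norm c"]) blast
  have "summable (\<lambda>n. norm (hyp_coeff \<gamma> \<mu> v (n + k0)) / fact n * D)"
    by (intro summable_mult2 summable_hyp_majorant assms)
  then have "summable (\<lambda>n. norm (hyp_coeff \<gamma> \<mu> v (n + k0) * rGamma (c + of_nat (n + k0))))"
  proof (rule summable_comparison_test')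
    fix n
    show "norm (norm (hyp_coeff \<gamma> \<mu> v (n + k0) * rGamma (c + of_nat (n + k0)))) \<le> norm (hyp_coeff \<gamma> \<mu> v (n + k0)) / fact n * D"
      using mult_left_mono[OF D(2)[of n], of "norm (hyp_coeff \<gamma> \<mu> v (n + k0))"] by (simp add: norm_mult mult.commute)
  qed
  then show s: "summable (\<lambda>k. norm (hyp_coeff \<gamma> \<mu> v k * rGamma (c + of_nat k)))"
    using summable_iff_shift[of "\<lambda>k. norm (hyp_coeff \<gamma> \<mu> v k * rGamma (c + of_nat k))" k0] by blast
  then show "(\<lambda>k. hyp_coeff \<gamma> \<mu> v k * rGamma (c + of_nat k)) sums hyp_F \<gamma> \<mu> v c"
    unfolding hyp_F_def by (rule summable_sums[OF summable_norm_cancel])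
qed

text \<open>The first \<open>k0\<close> terms are split off because only the shifted reciprocal
  Gamma values have a uniform bound; the Weierstrass test applies to the rest.\<close>

lemma hyp_F_holomorphic:
  assumes \<mu>: "Re \<mu> > 0" and v: "norm v < 1"
  shows "hyp_F \<gamma> \<mu> v holomorphic_on UNIV"
proof (rule holomorphic_uniform_sequence[of _ "\<lambda>n c. \<Sum>k<n. hyp_coeff \<gamma> \<mu> v k * rGamma (c + of_nat k)"])
  fix x :: complex
  define R where "R = norm x + 1"
  define k0 where "k0 = Suc (nat \<lceil>R\<rceil>)"
  obtain D where D: "D \<ge> 0" "\<And>(c::complex) n. norm c \<le> R \<Longrightarrow> norm (rGamma (c + of_nat (n + k0))) \<le> D / fact n"
    unfolding k0_def by (rule rGamma_shift_bound[of R]) blast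
  have sub: "cball x 1 \<subseteq> cball 0 R"
  proof
    fix y assume "y \<in> cball x 1"
    then have "norm (y - x) \<le> 1" by (simp add: dist_norm norm_minus_commute)
    then show "y \<in> cball 0 R" using norm_triangle_ineq2[of y x] by (simp add: R_def)
  qed
  have "uniform_limit (cball x 1) (\<lambda>n c. \<Sum>k<n. hyp_coeff \<gamma> \<mu> v (k + k0) * rGamma (c + of_nat (k + k0)))
     (\<lambda>c. \<Sum>k. hyp_coeff \<gamma> \<mu> v (k + k0) * rGamma (c + of_nat (k + k0))) sequentially"
  proof (rule Weierstrass_m_test)
    fix n c assume "c \<in> cball x 1"
    then have "norm c \<le> R" using sub by auto
    then show "norm (hyp_coeff \<gamma> \<mu> v (n + k0) * rGamma (c + of_nat (n + k0))) \<le> norm (hyp_coeff \<gamma> \<mu> v (n + k0)) / fact n * D"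
      using mult_left_mono[OF D(2)[of c n], of "norm (hyp_coeff \<gamma> \<mu> v (n + k0))"] by (simp add: norm_mult mult.commute)
  next
    show "summable (\<lambda>n. norm (hyp_coeff \<gamma> \<mu> v (n + k0)) / fact n * D)"
      by (intro summable_mult2 summable_hyp_majorant assms)
  qed
  then have "uniform_limit (cball x 1) (\<lambda>n c. (\<Sum>k<k0. hyp_coeff \<gamma> \<mu> v k * rGamma (c + of_nat k)) +
      (\<Sum>k<n. hyp_coeff \<gamma> \<mu> v (k + k0) * rGamma (c + of_nat (k + k0))))
     (\<lambda>c. (\<Sum>k<k0. hyp_coeff \<gamma> \<mu> v k * rGamma (c + of_nat k)) + (\<Sum>k. hyp_coeff \<gamma> \<mu> v (k + k0) * rGamma (c + of_nat (k + k0)))) sequentially"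
    by (intro uniform_limit_add uniform_limit_const)
  moreover have "(\<Sum>k<k0. hyp_coeff \<gamma> \<mu> v k * rGamma (c + of_nat k)) + (\<Sum>k. hyp_coeff \<gamma> \<mu> v (k + k0) * rGamma (c + of_nat (k + k0))) = hyp_F \<gamma> \<mu> v c" for c
    unfolding hyp_F_def using suminf_split_initial_segment[OF summable_norm_cancel[OF hyp_F_sums(1)[OF assms, of \<gamma> c]], of k0] by simp
  moreover have "(\<Sum>k<k0. hyp_coeff \<gamma> \<mu> v k * rGamma (c + of_nat k)) + (\<Sum>k<n. hyp_coeff \<gamma> \<mu> v (k + k0) * rGamma (c + of_nat (k + k0))) =
     (\<Sum>k<n+k0. hyp_coeff \<gamma> \<mu> v k * rGamma (c + of_nat k))" for c n
    by (induction n) (simp_all add: add_ac)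
  ultimately have "uniform_limit (cball x 1) (\<lambda>n c. \<Sum>k<n+k0. hyp_coeff \<gamma> \<mu> v k * rGamma (c + of_nat k)) (hyp_F \<gamma> \<mu> v) sequentially"
    by simp
  note U = this[unfolded uniform_limit_sequentially_iff]
  have "uniform_limit (cball x 1) (\<lambda>n c. \<Sum>k<n. hyp_coeff \<gamma> \<mu> v k * rGamma (c + of_nat k)) (hyp_F \<gamma> \<mu> v) sequentially"
    unfolding uniform_limit_sequentially_iff
  proof (intro allI impI)
    fix e :: real assume "e > 0"
    with U obtain N where N: "\<forall>n\<ge>N. \<forall>c\<in>cball x 1. dist (\<Sum>k<n + k0. hyp_coeff \<gamma> \<mu> v k * rGamma (c + of_nat k)) (hyp_F \<gamma> \<mu> v c) < e" by blast
    show "\<exists>N. \<forall>n\<ge>N. \<forall>c\<in>cball x 1. dist (\<Sum>k<n. hyp_coeff \<gamma> \<mu> v k * rGamma (c + of_nat k)) (hyp_F \<gamma> \<mu> v c) < e"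
    proof (intro exI[of _ "N + k0"] ballI allI impI)
      fix n c assume "N + k0 \<le> n" "c \<in> cball x 1"
      then show "dist (\<Sum>k<n. hyp_coeff \<gamma> \<mu> v k * rGamma (c + of_nat k)) (hyp_F \<gamma> \<mu> v c) < e"
        using N[rule_format, of "n - k0" c] by simp
    qed
  qed
  then show "\<exists>d>0. cball x d \<subseteq> UNIV \<and> uniform_limit (cball x d) (\<lambda>n c. \<Sum>k<n. hyp_coeff \<gamma> \<mu> v k * rGamma (c + of_nat k)) (hyp_F \<gamma> \<mu> v) sequentially"
    by (intro exI[of _ 1]) auto
qed (auto intro!: holomorphic_intros)

text \<open>The leading term is \<open>Gamma \<mu> * rGamma c\<close>. After division by it the k-th
  term contains the reciprocal of \<open>pochhammer c k\<close>, whose first factor supplies the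
  decay \<open>1 / norm c\<close> and whose other factors are bounded below independently of
  \<open>c\<close>. Thus far out \<open>hyp_F\<close> has no zeros and varies like
  \<open>rGamma\<close>.\<close>

lemma hyp_F_asymp:
  assumes \<mu>: "Re \<mu> > 0" and v: "norm v < 1" and M: "M \<ge> 0"
  obtains S where "\<And>c. c \<in> gamma_dom M \<Longrightarrow> norm (hyp_F \<gamma> \<mu> v c / (Gamma \<mu> * rGamma c) - 1) \<le> S / norm c"
proof -
  \<comment> \<open>A lower bound for \<open>norm (c + of_nat j)\<close> on
    \<open>gamma_dom M\<close>: 1 because the norm is at least 2 there, \<open>real j - M\<close>
    through the real part.\<close>
  define d where "d j = max 1 (real j - M)" for j :: nat
  have d1: "d j \<ge> 1" for j by (simp add: d_def)
  define b where "b k = norm (hyp_coeff \<gamma> \<mu> v (Suc k)) / norm (Gamma \<mu>) / (\<Prod>j<k. d (Suc j))" for k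
  have pd: "(\<Prod>j<k. d (Suc j)) > 0" for k by (intro prod_pos) (use d1 in \<open>auto intro: less_le_trans[OF zero_less_one]\<close>)
  define c where "c = (1 + norm v) / 2"
  have c: "norm v < c" "c < 1" "c > 0" using v by (auto simp: c_def add_pos_nonneg)
  have nz: "z \<notin> \<int>\<^sub>\<le>\<^sub>0" if "z \<in> gamma_dom M" for z
    using gamma_dom_slit[OF that] nonpos_Ints_subset_nonpos_Reals by blast
  have \<mu>0: "\<mu> \<notin> \<int>\<^sub>\<le>\<^sub>0" using \<mu> by (auto elim!: nonpos_Ints_cases)
  have "summable b"
  proof -
    define m where "m = nat \<lceil>M\<rceil>"
    have m: "real m \<ge> M" unfolding m_def by linarith
    have "eventually (\<lambda>n. norm (of_nat n + (of_nat (m + 1) - \<gamma>)) * norm (of_nat n + (of_nat (m + 1) + \<mu>)) * norm v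
      \<le> c * ((real n + real (m + 2)) * (real n + 1))) sequentially"
      using c by (intro eventually_quadratic_ratio) auto
    then obtain N where N: "\<And>n. n \<ge> N \<Longrightarrow> norm (of_nat n + (of_nat (m + 1) - \<gamma>)) * norm (of_nat n + (of_nat (m + 1) + \<mu>)) * norm v
      \<le> c * ((real n + real (m + 2)) * (real n + 1))" by (auto simp: eventually_sequentially)
    show ?thesis
    proof (rule summable_ratio_test[of c "N + m"])
      fix k assume k: "k \<ge> N + m"
      define n where "n = k - m"
      have n: "n \<ge> N" "k = n + m" using k by (auto simp: n_def)
      let ?A = "norm (of_nat (Suc k) - \<gamma>) * norm (of_nat (Suc k) + \<mu>) * norm v"
      have A: "?A \<le> c * (real (Suc (Suc k)) * d (Suc k))"
      proof -
        have "?A \<le> c * ((real n + real (m + 2)) * (real n + 1))" using N[OF n(1)] by (simp add: n(2) algebra_simps)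
        also have "\<dots> \<le> c * (real (Suc (Suc k)) * d (Suc k))"
          using c m by (intro mult_left_mono mult_mono) (auto simp: n(2) d_def)
        finally show ?thesis .
      qed
      have pos: "real (Suc (Suc k)) * d (Suc k) > 0" using d1[of "Suc k"] by (intro mult_pos_pos) auto
      have "norm (b (Suc k)) = norm (b k) * (?A / (real (Suc (Suc k)) * d (Suc k)))"
        unfolding b_def hyp_coeff_Suc[OF \<mu>, of \<gamma> v "Suc k"] using pd[of k] d1[of "Suc k"]
        by (simp add: norm_mult norm_divide abs_mult prod_nonneg del: of_nat_Suc)
      also have "\<dots> \<le> norm (b k) * c" using A pos by (intro mult_left_mono) (simp_all only: pos_divide_le_eq norm_ge_zero)
      finally show "norm (b (Suc k)) \<le> c * norm (b k)" by (simp add: mult.commute)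
    qed (use c in auto)
  qed
  show thesis
  proof (rule that[of "suminf b"])
    fix c assume c: "c \<in> gamma_dom M"
    have c0: "c \<noteq> 0" "norm c > 0" using gamma_dom_norm[OF c] by auto
    have rg: "rGamma c \<noteq> 0" "Gamma \<mu> \<noteq> 0" using nz[OF c] \<mu>0 by (auto simp: rGamma_eq_zero_iff Gamma_eq_zero_iff)
    let ?t = "\<lambda>k. hyp_coeff \<gamma> \<mu> v k * rGamma (c + of_nat k) / (Gamma \<mu> * rGamma c)"
    have "?t sums (hyp_F \<gamma> \<mu> v c / (Gamma \<mu> * rGamma c))"
      by (intro sums_divide hyp_F_sums \<mu> v)
    then have s: "(\<lambda>k. ?t (Suc k)) sums (hyp_F \<gamma> \<mu> v c / (Gamma \<mu> * rGamma c) - 1)"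
      using rg by (subst sums_Suc_iff) (simp add: hyp_coeff_def)
    have bd: "norm (?t (Suc k)) \<le> b k / norm c" for k
    proof -
      have pc: "norm (pochhammer c (Suc k)) \<ge> norm c * (\<Prod>j<k. d (Suc j))"
      proof (induction k)
        case (Suc k)
        have "d (Suc k) \<le> norm (c + of_nat (Suc k))"
          using gamma_dom_norm[OF gamma_dom_add[OF c, of "Suc k"]] c complex_Re_le_cmod[of "c + of_nat (Suc k)"]
          by (auto simp: d_def gamma_dom_def)
        then have "norm c * (\<Prod>j<k. d (Suc j)) * d (Suc k) \<le> norm (pochhammer c (Suc k)) * norm (c + of_nat (Suc k))"
          using Suc d1[of "Suc k"] by (intro mult_mono) auto
        then show ?case by (simp add: pochhammer_Suc[of c "Suc k"] norm_mult mult.assoc del: of_nat_Suc)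
      qed simp
      have p0: "pochhammer c (Suc k) \<noteq> 0" using less_le_trans[OF mult_pos_pos[OF c0(2) pd[of k]] pc] by auto
      have "?t (Suc k) = hyp_coeff \<gamma> \<mu> v (Suc k) / Gamma \<mu> / pochhammer c (Suc k)"
        using rg p0 pochhammer_rGamma[of c "Suc k"] by (simp add: field_simps del: of_nat_Suc)
      then have "norm (?t (Suc k)) = norm (hyp_coeff \<gamma> \<mu> v (Suc k)) / norm (Gamma \<mu>) / norm (pochhammer c (Suc k))"
        by (simp only: norm_divide)
      also have "\<dots> \<le> norm (hyp_coeff \<gamma> \<mu> v (Suc k)) / norm (Gamma \<mu>) / (norm c * (\<Prod>j<k. d (Suc j)))"
        using pc pd[of k] c0 p0 by (intro divide_left_mono mult_pos_pos) auto
      also have "\<dots> = b k / norm c" by (simp add: b_def)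
      finally show ?thesis .
    qed
    have "norm (\<Sum>k. ?t (Suc k)) \<le> (\<Sum>k. b k / norm c)"
      by (intro norm_suminf_le bd summable_divide \<open>summable b\<close>)
    then show "norm (hyp_F \<gamma> \<mu> v c / (Gamma \<mu> * rGamma c) - 1) \<le> suminf b / norm c"
      using s \<open>summable b\<close> by (simp add: sums_iff suminf_divide)
  qed
qed

section \<open>Principal powers of real numbers; the Gamma and Beta integrals\<close>

lemma Ln_of_real_neg: "t < 0 \<Longrightarrow> Ln (complex_of_real t) = of_real (ln (- t)) + \<i> * of_real pi"
  using Ln_of_real[of "- t"] Ln_minus[of "complex_of_real (- t)"] by (auto simp: complex_eq_iff)

text \<open>Principal powers jump across the negative axis; on the reals this case distinction makes
  them measurable.\<close>

lemma powr_of_real_cases: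
  "complex_of_real t powr s =
    (if t = 0 then 0 else if t > 0 then exp (s * of_real (ln t)) else exp (s * (of_real (ln (- t)) + \<i> * of_real pi)))"
  by (simp add: powr_def Ln_of_real_neg Ln_of_real)

lemma borel_measurable_of_real_powr [measurable]:
  assumes [measurable]: "f \<in> borel_measurable M" "g \<in> borel_measurable M"
  shows "(\<lambda>x. complex_of_real (f x) powr g x) \<in> borel_measurable M"
  unfolding powr_of_real_cases by measurable

lemma powr_times_of_real:
  fixes z s :: complex
  assumes "p > 0" "z \<noteq> 0"
  shows "(z * of_real p) powr s = z powr s * of_real p powr s"
proof -
  have "Ln (of_real p * z) = of_real (ln p) + Ln z" using assms Ln_times_of_real[of p z] by (simp add: Ln_of_real)
  then have "(of_real p * z) powr s = exp (s * of_real (ln p) + s * Ln z)"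
    using assms by (simp add: powr_def distrib_left)
  also have "\<dots> = of_real p powr s * z powr s"
    using assms by (simp add: powr_def Ln_of_real exp_add)
  finally show ?thesis by (simp only: mult.commute)
qed

lemma of_real_mult_powr:
  assumes "p > 0" "x \<noteq> 0"
  shows "complex_of_real (x * p) powr s = of_real x powr s * of_real p powr s"
  using powr_times_of_real[of p "of_real x" s] assms by simp

lemma Re_pos_not_nonpos_Int: "Re z > 0 \<Longrightarrow> z \<notin> \<int>\<^sub>\<le>\<^sub>0"
  by (auto elim!: nonpos_Ints_cases)

lemma norm_of_real_powr: "t > 0 \<Longrightarrow> norm (complex_of_real t powr s) = t powr Re s"
  by (simp add: norm_powr_real_powr)

definition gamma_density :: "complex \<Rightarrow> real \<Rightarrow> complex" where
  "gamma_density a s = indicator {0<..} s * (of_real s powr (a - 1) * exp (- of_real s))"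

lemma gamma_density_nonpos: "s \<le> 0 \<Longrightarrow> gamma_density a s = 0"
  by (simp add: gamma_density_def)

lemma gamma_density_measurable [measurable]: "gamma_density a \<in> borel_measurable borel"
  unfolding gamma_density_def by measurable

lemma gamma_density_integral:
  assumes "Re a > 0"
  shows "integrable lborel (gamma_density a)" "integral\<^sup>L lborel (gamma_density a) = Gamma a"
proof -
  have eq: "indicator {0<..} s *\<^sub>R (of_real s powr (a - 1) / of_real (exp s)) = gamma_density a s" for s :: real
    by (simp add: gamma_density_def indicator_def exp_minus divide_inverse exp_of_real)
  have "set_integrable lebesgue {0<..} (\<lambda>t. complex_of_real t powr (a - 1) / of_real (exp t))"
    using absolutely_integrable_Gamma_integral'[OF assms] by simp
  then have "integrable lebesgue (gamma_density a)" by (simp add: set_integrable_def eq)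
  then show i: "integrable lborel (gamma_density a)"
    using integrable_completion[of "gamma_density a" lborel] by simp
  then have "(gamma_density a has_integral integral\<^sup>L lborel (gamma_density a)) UNIV"
    by (rule has_integral_integral_lborel)
  moreover have "(gamma_density a has_integral Gamma a) UNIV"
  proof -
    have "gamma_density a = (\<lambda>s. if s \<in> {0<..} then of_real s powr (a - 1) / of_real (exp s) else 0)"
      unfolding fun_eq_iff eq[symmetric] by (simp add: indicator_def)
    then show ?thesis using Gamma_integral_complex'[OF assms] by (simp only: has_integral_restrict_UNIV)
  qed
  ultimately show "integral\<^sup>L lborel (gamma_density a) = Gamma a" by (rule has_integral_unique)
qed

definition beta_density :: "complex \<Rightarrow> complex \<Rightarrow> real \<Rightarrow> complex" where
  "beta_density a b \<tau> = indicator {0<..<1} \<tau> * (of_real \<tau> powr (a - 1) * of_real (1 - \<tau>) powr (b - 1))"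

lemma beta_density_measurable [measurable]: "beta_density a b \<in> borel_measurable borel"
  unfolding beta_density_def by measurable

lemma beta_density_integrable:
  assumes "Re a > 0" "Re b > 0"
  shows "integrable lborel (beta_density a b)"
proof (rule Bochner_Integration.integrable_bound)
  show "integrable lborel (\<lambda>t. indicator {0..1} t *\<^sub>R (t powr (Re a - 1) * (1 - t) powr (Re b - 1)))"
    using integrable_Beta[OF assms] by (simp add: set_integrable_def)
  show "AE t in lborel. norm (beta_density a b t) \<le> norm (indicator {0..1} t *\<^sub>R (t powr (Re a - 1) * (1 - t) powr (Re b - 1)))"
  proof (rule AE_I2)
    fix t :: real
    show "norm (beta_density a b t) \<le> norm (indicator {0..1} t *\<^sub>R (t powr (Re a - 1) * (1 - t) powr (Re b - 1)))"
      using norm_of_real_powr[of t "a - 1"] norm_of_real_powr[of "1 - t" "b - 1"]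
      by (cases "t \<in> {0<..<1}") (simp_all add: beta_density_def norm_mult del: of_real_diff)
  qed
qed auto

text \<open>Convolution of two Gamma densities. With \<open>t = u * \<tau>\<close> the inner
  integral becomes \<open>gamma_density (a + b) u\<close> times the Beta integral, while in the
  other order of integration the double integral is the product of two Gamma integrals.\<close>

lemma beta_density_integral:
  assumes a: "Re a > 0" and b: "Re b > 0"
  shows "integral\<^sup>L lborel (beta_density a b) = Gamma a * Gamma b * rGamma (a + b)"
proof -
  define f where "f t u = gamma_density a t * gamma_density b (u - t)" for t u
  have fm [measurable]: "case_prod f \<in> borel_measurable (lborel \<Otimes>\<^sub>M lborel)"
    unfolding f_def split_beta by measurable
  have sh: "integrable lborel (\<lambda>u. gamma_density b (u - t))" "(LINT u|lborel. gamma_density b (u - t)) = Gamma b"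
    "(LINT u|lborel. norm (gamma_density b (u - t))) = (LINT u|lborel. norm (gamma_density b u))" for t
    using lborel_integrable_real_affine[OF gamma_density_integral(1)[OF b], of 1 "-t"]
      lborel_integral_real_affine[of 1 "gamma_density b" "-t"] gamma_density_integral(2)[OF b]
      lborel_integral_real_affine[of 1 "\<lambda>u. norm (gamma_density b u)" "-t"]
    by (simp_all add: add.commute)
  have int: "integrable (lborel \<Otimes>\<^sub>M lborel) (case_prod f)"
  proof (rule lborel_pair.Fubini_integrable[OF fm])
    show "integrable lborel (\<lambda>x. LINT y|lborel. norm (case (x, y) of (t, u) \<Rightarrow> f t u))"
      using gamma_density_integral(1)[OF a] by (simp add: f_def norm_mult sh)
    show "AE x in lborel. integrable lborel (\<lambda>y. case (x, y) of (t, u) \<Rightarrow> f t u)"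
      using sh(1) by (simp add: f_def)
  qed
  have inner: "(LINT t|lborel. f t u) = gamma_density (a + b) u * integral\<^sup>L lborel (beta_density a b)" for u
  proof (cases "u > 0")
    case True
    have pt: "f (u * \<tau>) u = of_real (u powr (-1)) * (gamma_density (a + b) u * beta_density a b \<tau>)" for \<tau>
    proof (cases "\<tau> \<in> {0<..<1}")
      case in01: True
      have 1: "u - u * \<tau> = u * (1 - \<tau>)" by (simp add: algebra_simps)
      have pos: "0 < u * \<tau>" "0 < u * (1 - \<tau>)" using True in01 by (auto intro: mult_pos_pos)
      have "f (u * \<tau>) u = (of_real (u * \<tau>) powr (a - 1) * of_real (u * (1 - \<tau>)) powr (b - 1)) *
           (exp (- of_real (u * \<tau>)) * exp (- of_real (u * (1 - \<tau>))))"
        using pos unfolding f_def gamma_density_def 1 by simp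
      also have "exp (- of_real (u * \<tau>)) * exp (- of_real (u * (1 - \<tau>))) = exp (- complex_of_real u)"
        unfolding exp_add[symmetric] by (simp add: algebra_simps)
      also have "of_real (u * \<tau>) powr (a - 1) * of_real (u * (1 - \<tau>)) powr (b - 1) =
          (of_real u powr (a - 1) * of_real u powr (b - 1)) * (of_real \<tau> powr (a - 1) * complex_of_real (1 - \<tau>) powr (b - 1))"
        using of_real_mult_powr[of \<tau> u] of_real_mult_powr[of "1 - \<tau>" u] True in01 by simp
      also have "of_real u powr (a - 1) * of_real u powr (b - 1) = of_real (u powr (-1)) * complex_of_real u powr (a + b - 1)"
      proof -
        have "complex_of_real (u powr (-1)) = of_real u powr (-1)" using powr_of_real[of u "-1"] True by simp
        then show ?thesis by (simp only: powr_add[symmetric]) (simp add: algebra_simps)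
      qed
      finally show ?thesis using True in01 by (simp add: gamma_density_def beta_density_def)
    next
      case False
      then have "\<tau> \<le> 0 \<or> 1 \<le> \<tau>" by auto
      then have "u * \<tau> \<le> 0 \<or> u - u * \<tau> \<le> 0"
        using True mult_left_mono[of 1 \<tau> u] by (auto simp: mult_nonneg_nonpos)
      then have "f (u * \<tau>) u = 0"
        unfolding f_def by (elim disjE) (simp_all only: gamma_density_nonpos mult_zero_left mult_zero_right)
      then show ?thesis using False by (simp add: beta_density_def)
    qed
    have "(LINT t|lborel. f t u) = \<bar>u\<bar> *\<^sub>R (LINT \<tau>|lborel. f (0 + u * \<tau>) u)"
      using True by (intro lborel_integral_real_affine) auto
    also have "\<dots> = of_real u * (of_real (u powr (-1)) * (gamma_density (a + b) u * integral\<^sup>L lborel (beta_density a b)))"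
      using True by (simp add: pt scaleR_conv_of_real)
    also have "of_real u * of_real (u powr (-1)) = (1::complex)"
      using True by (simp add: powr_minus flip: of_real_mult)
    then have "of_real u * (of_real (u powr (-1)) * (gamma_density (a + b) u * integral\<^sup>L lborel (beta_density a b))) = gamma_density (a + b) u * integral\<^sup>L lborel (beta_density a b)"
      by (metis mult.assoc mult_1)
    finally show ?thesis .
  next
    case False
    have "f t u = 0" for t using False by (auto simp: f_def gamma_density_def indicator_def)
    then show ?thesis using False by (simp add: gamma_density_def)
  qed
  have ab: "Re (a + b) > 0" using a b by simp
  have "Gamma (a + b) * integral\<^sup>L lborel (beta_density a b) = (LINT u|lborel. LINT t|lborel. f t u)"
    by (simp add: inner gamma_density_integral[OF ab])
  also have "\<dots> = (LINT t|lborel. LINT u|lborel. f t u)"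
    by (rule lborel_pair.Fubini_integral[OF int])
  also have "\<dots> = Gamma a * Gamma b"
    by (simp add: f_def sh gamma_density_integral[OF a])
  finally have eq: "Gamma (a + b) * integral\<^sup>L lborel (beta_density a b) = Gamma a * Gamma b" .
  have "a + b \<notin> \<int>\<^sub>\<le>\<^sub>0" using ab by (rule Re_pos_not_nonpos_Int)
  then have "rGamma (a + b) * Gamma (a + b) = 1" by (simp add: Gamma_def rGamma_eq_zero_iff)
  then have "integral\<^sup>L lborel (beta_density a b) = rGamma (a + b) * (Gamma (a + b) * integral\<^sup>L lborel (beta_density a b))"
    by (simp only: mult.assoc[symmetric] mult_1)
  then show ?thesis unfolding eq by (simp only: mult.commute)
qed

lemma summable_binomial_pochhammer:
  assumes "norm (v::complex) < 1"
  shows "summable (\<lambda>k. norm (pochhammer (- \<gamma>) k / fact k * v ^ k))"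
    "(\<lambda>k. pochhammer (- \<gamma>) k / fact k * v ^ k) sums (1 - v) powr \<gamma>"
proof -
  have eq: "(\<gamma> gchoose k) * (- z) ^ k = pochhammer (- \<gamma>) k / fact k * z ^ k" for k and z :: complex
    by (simp add: gbinomial_pochhammer power_mult_distrib[symmetric] flip: mult.assoc)
  show "(\<lambda>k. pochhammer (- \<gamma>) k / fact k * v ^ k) sums (1 - v) powr \<gamma>"
    using gen_binomial_complex[of "-v" \<gamma>] assms by (simp add: eq)
  obtain r where r: "norm v < r" "r < 1" using dense[OF assms] by blast
  have "0 \<le> r" using r norm_ge_zero[of v] by linarith
  then have "summable (\<lambda>k. pochhammer (- \<gamma>) k / fact k * of_real r ^ k)"
    using gen_binomial_complex[of "- of_real r" \<gamma>] r by (auto simp: eq sums_iff)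
  then show "summable (\<lambda>k. norm (pochhammer (- \<gamma>) k / fact k * v ^ k))"
    by (rule powser_insidea) (use r \<open>0 \<le> r\<close> in simp)
qed

text \<open>Euler's representation of 2F1: the binomial series of
  \<open>(1 - v * \<tau>) powr \<gamma>\<close> is integrated term by term, and
  \<open>\<tau> ^ k\<close> merely raises the first Beta parameter by \<open>k\<close>. Since \<tau>
  < 1, all these densities are dominated by \<open>beta_density \<mu> b\<close>.\<close>

lemma euler_integral:
  assumes \<mu>: "Re \<mu> > 0" and b: "Re b > 0" and v: "\<bar>v\<bar> < 1"
  shows "(LINT \<tau>|lborel. beta_density \<mu> b \<tau> * of_real (1 - v * \<tau>) powr \<gamma>) = Gamma b * hyp_F \<gamma> \<mu> (of_real v) (\<mu> + b)"
proof -
  let ?a = "\<lambda>k. pochhammer (- \<gamma>) k / fact k * of_real v ^ k"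
  have nv: "norm (complex_of_real v) < 1" using v by simp
  have bk: "beta_density \<mu> b \<tau> * of_real \<tau> ^ k = beta_density (\<mu> + of_nat k) b \<tau>" for \<tau> k
  proof (cases "\<tau> \<in> {0<..<1}")
    case True
    have "of_real \<tau> powr (\<mu> + of_nat k - 1) = of_real \<tau> powr (\<mu> - 1) * of_real \<tau> powr (of_nat k :: complex)"
      by (simp add: algebra_simps flip: powr_add)
    also have "of_real \<tau> powr (of_nat k :: complex) = of_real \<tau> ^ k" using True by (subst powr_nat') auto
    finally show ?thesis using True by (simp add: beta_density_def)
  qed (simp add: beta_density_def)
  have int: "integrable lborel (\<lambda>\<tau>. ?a k * beta_density (\<mu> + of_nat k) b \<tau>)" for k
    using \<mu> b by (intro integrable_mult_right beta_density_integrable) auto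
  have le: "norm (beta_density (\<mu> + of_nat k) b \<tau>) \<le> norm (beta_density \<mu> b \<tau>)" for k \<tau>
    unfolding bk[symmetric] norm_mult norm_power
    by (cases "\<tau> \<in> {0<..<1}") (auto simp: beta_density_def intro!: mult_left_le power_le_one)
  have "(LINT \<tau>|lborel. (\<Sum>k. ?a k * beta_density (\<mu> + of_nat k) b \<tau>)) = (\<Sum>k. LINT \<tau>|lborel. ?a k * beta_density (\<mu> + of_nat k) b \<tau>)"
  proof (rule integral_suminf[OF int])
    have sm: "summable (\<lambda>k. norm (?a k) * norm (beta_density \<mu> b \<tau>))" for \<tau>
      by (intro summable_mult2 summable_binomial_pochhammer nv)
    have "summable (\<lambda>k. norm (?a k * beta_density (\<mu> + of_nat k) b \<tau>))" for \<tau>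
      by (rule summable_comparison_test'[OF sm[of \<tau>], of 0])
        (simp only: norm_mult real_norm_def abs_norm_cancel abs_mult, intro mult_left_mono le mult_nonneg_nonneg norm_ge_zero)
    then show "AE x in lborel. summable (\<lambda>k. norm (?a k * beta_density (\<mu> + of_nat k) b x))" by simp
    have "summable (\<lambda>k. norm (?a k) * (LINT \<tau>|lborel. norm (beta_density \<mu> b \<tau>)))"
      by (intro summable_mult2 summable_binomial_pochhammer nv)
    then show "summable (\<lambda>k. LINT x|lborel. norm (?a k * beta_density (\<mu> + of_nat k) b x))"
    proof (rule summable_comparison_test'[of _ 0])
      fix k
      have "norm (LINT x|lborel. norm (?a k * beta_density (\<mu> + of_nat k) b x)) = (LINT x|lborel. norm (?a k) * norm (beta_density (\<mu> + of_nat k) b x))"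
        unfolding norm_mult by (subst real_norm_def, rule abs_of_nonneg) (intro integral_nonneg_AE AE_I2 mult_nonneg_nonneg norm_ge_zero)
      also have "\<dots> \<le> (LINT x|lborel. norm (?a k) * norm (beta_density \<mu> b x))"
        using \<mu> b by (intro integral_mono mult_left_mono le integrable_mult_right integrable_norm beta_density_integrable) auto
      finally show "norm (LINT x|lborel. norm (?a k * beta_density (\<mu> + of_nat k) b x)) \<le> norm (?a k) * (LINT \<tau>|lborel. norm (beta_density \<mu> b \<tau>))"
        by simp
    qed
  qed
  moreover have "(\<Sum>k. ?a k * beta_density (\<mu> + of_nat k) b \<tau>) = beta_density \<mu> b \<tau> * of_real (1 - v * \<tau>) powr \<gamma>" for \<tau>
  proof (cases "\<tau> \<in> {0<..<1}")
    case True
    have "norm (complex_of_real (v * \<tau>)) < 1"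
      using v True mult_left_le[of \<tau> "\<bar>v\<bar>"] by (simp add: abs_mult del: of_real_mult)
    from summable_binomial_pochhammer(2)[OF this, of \<gamma>]
    have "(\<lambda>k. beta_density \<mu> b \<tau> * (pochhammer (- \<gamma>) k / fact k * of_real (v * \<tau>) ^ k)) sums (beta_density \<mu> b \<tau> * (1 - of_real (v * \<tau>)) powr \<gamma>)"
      by (rule sums_mult)
    then have "(\<lambda>k. ?a k * beta_density (\<mu> + of_nat k) b \<tau>) sums (beta_density \<mu> b \<tau> * (1 - of_real (v * \<tau>)) powr \<gamma>)"
      by (simp add: bk[symmetric] power_mult_distrib mult_ac)
    then show ?thesis by (simp add: sums_iff)
  qed (simp add: beta_density_def)
  moreover have "(LINT \<tau>|lborel. ?a k * beta_density (\<mu> + of_nat k) b \<tau>) = Gamma b * (hyp_coeff \<gamma> \<mu> (of_real v) k * rGamma (\<mu> + b + of_nat k))" for k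
    using beta_density_integral[of "\<mu> + of_nat k" b] \<mu> b by (simp add: hyp_coeff_def add_ac)
  moreover have "(\<Sum>k. Gamma b * (hyp_coeff \<gamma> \<mu> (of_real v) k * rGamma (\<mu> + b + of_nat k))) = Gamma b * hyp_F \<gamma> \<mu> (of_real v) (\<mu> + b)"
    unfolding hyp_F_def by (rule suminf_mult[OF summable_norm_cancel[OF hyp_F_sums(1)[OF \<mu> nv]]])
  ultimately show ?thesis by simp
qed

text \<open>The substitution \<open>t = x - (x - u) * \<tau>\<close> gives
  \<open>t = x * (1 - v * \<tau>)\<close>. As \<open>1 - v * \<tau>\<close> is positive, the
  principal power splits off \<open>x powr \<gamma>\<close> for negative \<open>x\<close> as
  well.\<close>

lemma euler_integral_interval:
  assumes \<mu>: "Re \<mu> > 0" and b: "Re b > 0" and ux: "u < x" "x \<noteq> 0" and v: "\<bar>(x - u) / x\<bar> < 1"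
  shows "(LINT t|lborel. indicator {u<..<x} t * (of_real t powr \<gamma> * of_real (x - t) powr (\<mu> - 1) * of_real (t - u) powr (b - 1))) =
    of_real x powr \<gamma> * of_real (x - u) powr (\<mu> + b - 1) * (Gamma b * hyp_F \<gamma> \<mu> (of_real ((x - u) / x)) (\<mu> + b))"
proof -
  define d where "d = x - u"
  define v' where "v' = d / x"
  have d: "d > 0" and v': "\<bar>v'\<bar> < 1" using ux v by (auto simp: d_def v'_def)
  let ?f = "\<lambda>t. indicator {u<..<x} t * (of_real t powr \<gamma> * of_real (x - t) powr (\<mu> - 1) * of_real (t - u) powr (b - 1))"
  have pt: "?f (x + (- d) * \<tau>) = of_real x powr \<gamma> * (of_real d powr (\<mu> - 1) * of_real d powr (b - 1)) * (beta_density \<mu> b \<tau> * of_real (1 - v' * \<tau>) powr \<gamma>)" for \<tau>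
  proof (cases "\<tau> \<in> {0<..<1}")
    case True
    have vt: "1 - v' * \<tau> > 0" using v' True mult_left_le[of \<tau> "\<bar>v'\<bar>"] abs_le_iff[of "v' * \<tau>" "\<bar>v'\<bar>"] by (auto simp: abs_mult)
    have e: "x + (- d) * \<tau> = x * (1 - v' * \<tau>)" "x - (x + (- d) * \<tau>) = d * \<tau>" "x + (- d) * \<tau> - u = d * (1 - \<tau>)"
      using ux by (simp_all add: v'_def d_def field_simps)
    have "d * \<tau> > 0" "d * (1 - \<tau>) > 0" using d True by auto
    then have "x + (- d) * \<tau> \<in> {u<..<x}" using e by auto
    then show ?thesis
      using of_real_mult_powr[OF vt ux(2), of \<gamma>] of_real_mult_powr[of \<tau> d "\<mu> - 1"] of_real_mult_powr[of "1 - \<tau>" d "b - 1"] d True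
      unfolding e(2,3) unfolding e(1) by (simp add: beta_density_def del: of_real_diff of_real_mult)
  next
    case False
    then have "\<tau> \<le> 0 \<or> 1 \<le> \<tau>" by auto
    then have "d * \<tau> \<le> 0 \<or> d * \<tau> \<ge> d"
      using d mult_left_mono[of 1 \<tau> d] by (auto simp: mult_nonneg_nonpos)
    moreover have "u = x - d" by (simp add: d_def)
    moreover have "x + (- d) * \<tau> = x - d * \<tau>" by simp
    ultimately have "x + (- d) * \<tau> \<notin> {u<..<x}" unfolding greaterThanLessThan_iff by linarith
    then show ?thesis using False by (simp add: beta_density_def)
  qed
  have "(LINT t|lborel. ?f t) = \<bar>- d\<bar> *\<^sub>R (LINT \<tau>|lborel. ?f (x + (- d) * \<tau>))"
    using d by (intro lborel_integral_real_affine) auto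
  also have "\<dots> = of_real d * (of_real x powr \<gamma> * (of_real d powr (\<mu> - 1) * of_real d powr (b - 1)) * (Gamma b * hyp_F \<gamma> \<mu> (of_real v') (\<mu> + b)))"
    unfolding pt using d euler_integral[OF \<mu> b v', of \<gamma>] by (simp add: scaleR_conv_of_real del: of_real_diff of_real_mult)
  also have "\<dots> = of_real x powr \<gamma> * (of_real d * (of_real d powr (\<mu> - 1) * of_real d powr (b - 1))) * (Gamma b * hyp_F \<gamma> \<mu> (of_real v') (\<mu> + b))"
    by (simp add: mult_ac)
  also have "of_real d * (of_real d powr (\<mu> - 1) * of_real d powr (b - 1)) = complex_of_real d powr (1 + ((\<mu> - 1) + (b - 1)))"
    unfolding powr_add using d by simp
  finally show ?thesis by (simp add: d_def v'_def algebra_simps)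
qed

section \<open>Kernels of Fox functions\<close>

lemma prod_list_holomorphic:
  assumes "\<And>x. x \<in> set xs \<Longrightarrow> f x holomorphic_on A"
  shows "(\<lambda>z. \<Prod>x\<leftarrow>xs. f x z) holomorphic_on A"
  using assms by (induction xs) (auto intro!: holomorphic_intros)

lemma fox_kernel_holomorphic:
  assumes "A \<inter> (fox_right_poles m bq \<union> fox_left_poles n ap) = {}"
  shows "fox_kernel m n ap bq holomorphic_on A"
proof -
  have 1: "(\<lambda>\<xi>. \<Prod>(b, B)\<leftarrow>take m bq. Gamma (b - of_real B * \<xi>)) holomorphic_on A"
    unfolding split_def
    by (intro prod_list_holomorphic holomorphic_intros) (use assms in \<open>fastforce simp: fox_right_poles_def\<close>)
  have 2: "(\<lambda>\<xi>. \<Prod>(a, B)\<leftarrow>take n ap. Gamma (1 - a + of_real B * \<xi>)) holomorphic_on A"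
    unfolding split_def
    by (intro prod_list_holomorphic holomorphic_intros) (use assms in \<open>fastforce simp: fox_left_poles_def\<close>)
  have 3: "(\<lambda>\<xi>. \<Prod>(b, B)\<leftarrow>drop m bq. rGamma (1 - b + of_real B * \<xi>)) holomorphic_on A"
    and 4: "(\<lambda>\<xi>. \<Prod>(a, B)\<leftarrow>drop n ap. rGamma (a - of_real B * \<xi>)) holomorphic_on A"
    unfolding split_def by (intro prod_list_holomorphic holomorphic_intros)+
  show ?thesis unfolding fox_kernel_def[abs_def] by (intro holomorphic_intros 1 2 3 4)
qed

lemma closed_affine_nonpos_Ints: "closed {\<xi>. c + of_real B * \<xi> \<in> (\<int>\<^sub>\<le>\<^sub>0 :: complex set)}"
  using continuous_closed_vimage[OF closed_nonpos_Ints, of "\<lambda>\<xi>. c + of_real B * \<xi>"]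
  by (auto simp: vimage_def intro!: continuous_intros)

lemma closed_fox_right_poles: "closed (fox_right_poles m bq)"
proof -
  have "fox_right_poles m bq = (\<Union>x\<in>set (take m bq). {\<xi>. fst x + of_real (- snd x) * \<xi> \<in> \<int>\<^sub>\<le>\<^sub>0})"
    by (auto simp: fox_right_poles_def split: prod.splits)
  then show ?thesis using closed_affine_nonpos_Ints by (auto intro!: closed_UN simp del: of_real_minus)
qed

lemma closed_fox_left_poles: "closed (fox_left_poles n ap)"
proof -
  have "fox_left_poles n ap = (\<Union>x\<in>set (take n ap). {\<xi>. (1 - fst x) + of_real (snd x) * \<xi> \<in> \<int>\<^sub>\<le>\<^sub>0})"
    by (auto simp: fox_left_poles_def split: prod.splits)
  then show ?thesis using closed_affine_nonpos_Ints by (auto intro!: closed_UN)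
qed

section \<open>Fox kernels on far cells\<close>

definition comparable_ex :: "real set \<Rightarrow> complex \<Rightarrow> real \<Rightarrow> real \<Rightarrow> (complex \<Rightarrow> complex) \<Rightarrow> bool" where
  "comparable_ex G e K \<delta> f \<longleftrightarrow> (\<exists>d. comparable G e K \<delta> d f)"

lemma comparable_ex_mult:
  "comparable_ex G e K \<delta> f \<Longrightarrow> comparable_ex G e K \<delta> g \<Longrightarrow> comparable_ex G e K \<delta> (\<lambda>z. f z * g z)"
  unfolding comparable_ex_def using comparable_mult by blast

lemma comparable_ex_prod_list:
  assumes "\<And>x. x \<in> set xs \<Longrightarrow> comparable_ex G e K \<delta> (f x)"
  shows "comparable_ex G e K \<delta> (\<lambda>z. \<Prod>x\<leftarrow>xs. f x z)"
proof -
  obtain d where "\<And>x. x \<in> set xs \<Longrightarrow> comparable G e K \<delta> (d x) (f x)"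
    using assms unfolding comparable_ex_def by metis
  then show ?thesis unfolding comparable_ex_def using comparable_prod_list by blast
qed

text \<open>Far up or down the arguments of all factors have large imaginary part, so coefficients
  of either sign are treated alike and no reflection is involved.\<close>

lemma comparable_ex_fox_kernel_vertical:
  assumes e: "e = \<i> \<or> e = - \<i>" and K: "K \<ge> 0" "\<delta> \<ge> 0"
    and ap: "\<forall>(c, A)\<in>set ap. A > 0" and bq: "\<forall>(b, B)\<in>set bq. B > 0"
  shows "comparable_ex G e K \<delta> (fox_kernel m n ap bq)"
proof -
  have G: "comparable_ex G e K \<delta> (\<lambda>z. Gamma (c + of_real B * z))" "comparable_ex G e K \<delta> (\<lambda>z. rGamma (c + of_real B * z))" if "B \<noteq> 0" for c B
    using comparable_Gamma[where e = e and B = B and K = K and \<delta> = \<delta> and G = G and c = c] comparable_rGamma[where e = e and B = B and K = K and \<delta> = \<delta> and G = G and c = c] e K that unfolding comparable_ex_def by blast+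
  have nz: "snd x \<noteq> 0" if "x \<in> set ap \<or> x \<in> set bq" for x
    using that ap bq by fastforce
  have G': "comparable_ex G e K \<delta> (\<lambda>z. Gamma (c - of_real B * z))" "comparable_ex G e K \<delta> (\<lambda>z. rGamma (c - of_real B * z))" if "B \<noteq> 0" for c B
    using G[of "- B" c] that by simp_all
  show ?thesis
    unfolding fox_kernel_def[abs_def] split_def
    by (intro comparable_ex_mult comparable_ex_prod_list G G' nz) (auto dest: in_set_takeD in_set_dropD)
qed

lemma cell_one: "z \<in> cell 1 K r \<delta> \<longleftrightarrow> r \<le> Re z \<and> Re z \<le> r + \<delta> \<and> \<bar>Im z\<bar> \<le> K"
  by (simp add: cell_def)

lemma comparable_sin_right:
  assumes G: "\<And>r t n. r \<in> G \<Longrightarrow> t \<in> {r..r + \<delta>} \<Longrightarrow> \<bar>- Re b + B * t - of_int n\<bar> \<ge> \<eta>" and \<eta>: "\<eta> > 0" and B: "B > 0"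
  shows "comparable G 1 K \<delta> 0 (\<lambda>z. sin (of_real pi * (b - of_real B * z)))"
proof (rule comparable_near_const[where c = "sin (pi * min \<eta> (1/2))" and C = "exp (pi * (\<bar>Im b\<bar> + B * K))" and ?R0.0 = 0])
  show "0 < sin (pi * min \<eta> (1 / 2))"
  proof (rule sin_gt_zero)
    show "0 < pi * min \<eta> (1 / 2)" using \<eta> by simp
    have "pi * min \<eta> (1 / 2) \<le> pi * (1 / 2)" by (intro mult_left_mono) auto
    also have "\<dots> < pi" by simp
    finally show "pi * min \<eta> (1 / 2) < pi" .
  qed
  fix r z assume r: "r \<in> G" and z: "z \<in> cell 1 K r \<delta>"
  have far: "\<bar>Re (b - of_real B * z) - of_int n\<bar> \<ge> min \<eta> (1 / 2)" for n :: int
  proof -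
    have "\<eta> \<le> \<bar>- Re b + B * Re z - of_int (- n)\<bar>" using z by (intro G[OF r]) (auto simp: cell_one)
    also have "\<dots> = \<bar>Re (b - of_real B * z) - of_int n\<bar>" by simp
    finally show ?thesis by simp
  qed
  have "\<bar>B * Im z\<bar> \<le> B * K" using z B by (auto simp: cell_one abs_mult)
  then have im: "\<bar>Im (b - of_real B * z)\<bar> \<le> \<bar>Im b\<bar> + B * K" by simp
  show "sin (pi * min \<eta> (1 / 2)) \<le> norm (sin (of_real pi * (b - of_real B * z))) \<and>
        norm (sin (of_real pi * (b - of_real B * z))) \<le> exp (pi * (\<bar>Im b\<bar> + B * K))"
    using norm_sin_bounds[OF far im] \<eta> by simp
qed

text \<open>To the right the argument \<open>b - of_real B * z\<close> runs along the poles of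
  Gamma. The reflection formula replaces the factor by
  \<open>Gamma ((1 - b) + of_real B * z)\<close>, which is regular there, and a sine, which lies
  between positive constants as long as the real part of its argument over pi keeps the distance
  \<eta> from the integers.\<close>

lemma comparable_reflected_right:
  assumes G: "\<And>r t n. r \<in> G \<Longrightarrow> t \<in> {r..r + \<delta>} \<Longrightarrow> \<bar>- Re b + B * t - of_int n\<bar> \<ge> \<eta>" and \<eta>: "\<eta> > 0" and B: "B > 0"
    and K: "K \<ge> 0" "\<delta> \<ge> 0"
  shows "comparable_ex G 1 K \<delta> (\<lambda>z. rGamma (b - of_real B * z))" "comparable_ex G 1 K \<delta> (\<lambda>z. Gamma (b - of_real B * z))"
proof -
  have "comparable G 1 K \<delta> (0 + (0 + B)) (\<lambda>z. inverse (of_real pi) * (sin (of_real pi * (b - of_real B * z)) * Gamma ((1 - b) + of_real B * z)))"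
    using B K by (intro comparable_mult comparable_const comparable_sin_right[OF G \<eta> B] comparable_Gamma) auto
  then have *: "comparable G 1 K \<delta> (0 + (0 + B)) (\<lambda>z. rGamma (b - of_real B * z))"
  proof (rule comparable_cong[where ?R0.0 = "Re b / B"])
    fix r z assume r: "r \<ge> Re b / B" and z: "z \<in> cell 1 K r \<delta>"
    have "Re b \<le> B * Re z" using r z B by (auto simp: cell_one field_simps intro: order_trans)
    then have "(1 - b) + of_real B * z \<notin> \<int>\<^sub>\<le>\<^sub>0" by (intro Re_pos_not_nonpos_Int) simp
    moreover have "1 - (b - of_real B * z) = (1 - b) + of_real B * z" by simp
    ultimately show "rGamma (b - of_real B * z) = inverse (of_real pi) * (sin (of_real pi * (b - of_real B * z)) * Gamma ((1 - b) + of_real B * z))"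
      using rGamma_reflection_complex[of "b - of_real B * z"] by (simp add: Gamma_def rGamma_eq_zero_iff field_simps)
  qed
  then show "comparable_ex G 1 K \<delta> (\<lambda>z. rGamma (b - of_real B * z))" unfolding comparable_ex_def by blast
  have "comparable G 1 K \<delta> (- (0 + (0 + B))) (\<lambda>z. Gamma (b - of_real B * z))"
    using comparable_inverse[OF *] by (simp add: Gamma_def)
  then show "comparable_ex G 1 K \<delta> (\<lambda>z. Gamma (b - of_real B * z))" unfolding comparable_ex_def by blast
qed

lemma comparable_ex_fox_kernel_right:
  assumes ap: "\<forall>(c, A)\<in>set ap. A > 0" and bq: "\<forall>(b, B)\<in>set bq. B > 0" and K: "K \<ge> 0"
  obtains G \<delta> where "\<delta> > 0" "\<And>R. \<exists>r\<ge>R. r \<in> G" "comparable_ex G 1 K \<delta> (fox_kernel m n ap bq)"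
    "\<And>r. r \<in> G \<Longrightarrow> cell 1 K r \<delta> \<inter> fox_right_poles m bq = {}"
proof -
  \<comment> \<open>Both lists enter, since the factors \<open>Gamma (b - B * z)\<close> and
    \<open>rGamma (a - A * z)\<close> both have to be reflected.\<close>
  define Fam where "Fam = map (\<lambda>(b, B). (- Re b, B)) (bq @ ap)"
  have "\<forall>(c, B)\<in>set Fam. B > 0" using ap bq by (auto simp: Fam_def)
  from away_from_int_subinterval[OF this zero_less_one]
  obtain \<delta> \<eta> where \<delta>: "\<delta> > 0" "\<eta> > 0" and far: "\<And>r. \<exists>r'\<ge>r. r' + \<delta> \<le> r + 1 \<and>
     (\<forall>(c, B)\<in>set Fam. \<forall>t\<in>{r'..r' + \<delta>}. \<forall>n::int. \<bar>c + B * t - of_int n\<bar> \<ge> \<eta>)" by blast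
  define G where "G = {r. \<forall>(c, B)\<in>set Fam. \<forall>t\<in>{r..r + \<delta>}. \<forall>n::int. \<bar>c + B * t - of_int n\<bar> \<ge> \<eta>}"
  have GG: "\<eta> \<le> \<bar>- Re (fst x) + snd x * t - of_int n\<bar>" if "x \<in> set bq \<or> x \<in> set ap" "r \<in> G" "t \<in> {r..r + \<delta>}" for x r t n
  proof -
    have "(- Re (fst x), snd x) \<in> set Fam" using that(1) by (force simp: Fam_def)
    then show ?thesis using that(2,3) unfolding G_def by fastforce
  qed
  have pos: "snd x > 0" if "x \<in> set ap \<or> x \<in> set bq" for x
    using that ap bq by fastforce
  show thesis
  proof (rule that[of \<delta> G])
    show "\<exists>r\<ge>R. r \<in> G" for R using far[of R] unfolding G_def by blast
    have r1: "comparable_ex G 1 K \<delta> (\<lambda>z. Gamma (fst x - of_real (snd x) * z))" if "x \<in> set (take m bq)" for x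
      using comparable_reflected_right(2)[where G = G and \<delta> = \<delta> and b = "fst x" and B = "snd x" and \<eta> = \<eta> and K = K] GG[of x] pos[of x] in_set_takeD[OF that] \<delta> K by simp
    have r2: "comparable_ex G 1 K \<delta> (\<lambda>z. rGamma (fst x - of_real (snd x) * z))" if "x \<in> set (drop n ap)" for x
      using comparable_reflected_right(1)[where G = G and \<delta> = \<delta> and b = "fst x" and B = "snd x" and \<eta> = \<eta> and K = K] GG[of x] pos[of x] in_set_dropD[OF that] \<delta> K by simp
    have r3: "comparable_ex G 1 K \<delta> (\<lambda>z. Gamma (1 - fst x + of_real (snd x) * z))" if "x \<in> set (take n ap)" for x
      using comparable_Gamma[where e = 1 and B = "snd x" and K = K and \<delta> = \<delta> and G = G and c = "1 - fst x"] pos[of x] in_set_takeD[OF that] \<delta> K unfolding comparable_ex_def by auto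
    have r4: "comparable_ex G 1 K \<delta> (\<lambda>z. rGamma (1 - fst x + of_real (snd x) * z))" if "x \<in> set (drop m bq)" for x
      using comparable_rGamma[where e = 1 and B = "snd x" and K = K and \<delta> = \<delta> and G = G and c = "1 - fst x"] pos[of x] in_set_dropD[OF that] \<delta> K unfolding comparable_ex_def by auto
    show "comparable_ex G 1 K \<delta> (fox_kernel m n ap bq)"
      unfolding fox_kernel_def[abs_def] split_def
      by (intro comparable_ex_mult comparable_ex_prod_list r1 r2 r3 r4)
    fix r assume r: "r \<in> G"
    show "cell 1 K r \<delta> \<inter> fox_right_poles m bq = {}"
    proof (rule ccontr)
      assume "cell 1 K r \<delta> \<inter> fox_right_poles m bq \<noteq> {}"
      then obtain \<xi> x where x: "\<xi> \<in> cell 1 K r \<delta>" "x \<in> set (take m bq)" "fst x - of_real (snd x) * \<xi> \<in> \<int>\<^sub>\<le>\<^sub>0"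
        by (auto simp: fox_right_poles_def)
      then obtain i where "fst x - of_real (snd x) * \<xi> = of_int i" by (auto elim!: nonpos_Ints_cases)
      then have "Re (fst x - of_real (snd x) * \<xi>) = of_int i" by simp
      moreover have "\<eta> \<le> \<bar>- Re (fst x) + snd x * Re \<xi> - of_int (- i)\<bar>"
        using x in_set_takeD[OF x(2)] by (intro GG[OF _ r]) (auto simp: cell_one)
      ultimately show False using \<delta> by simp
    qed
  qed (use \<delta> in auto)
qed

lemma fox_left_poles_Re_bounded:
  assumes ap: "\<forall>(c, A)\<in>set ap. A > 0"
  shows "\<exists>R. \<forall>\<xi>\<in>fox_left_poles n ap. Re \<xi> \<le> R"
proof -
  let ?S = "insert 0 ((\<lambda>x. (Re (fst x) - 1) / snd x) ` set (take n ap))"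
  have "Re \<xi> \<le> Max ?S" if \<xi>: "\<xi> \<in> fox_left_poles n ap" for \<xi>
  proof -
    obtain x where x: "x \<in> set (take n ap)" "1 - fst x + of_real (snd x) * \<xi> \<in> \<int>\<^sub>\<le>\<^sub>0"
      using \<xi> unfolding fox_left_poles_def by force
    then have "Re (1 - fst x + of_real (snd x) * \<xi>) \<le> 0" using Re_pos_not_nonpos_Int by (metis not_le)
    moreover have "snd x > 0" using in_set_takeD[OF x(1)] ap by fastforce
    ultimately have "Re \<xi> \<le> (Re (fst x) - 1) / snd x" by (simp add: field_simps)
    also have "\<dots> \<le> Max ?S" using x(1) by (intro Max_ge) auto
    finally show ?thesis .
  qed
  then show ?thesis by blast
qed

lemma fox_poles_Im_bounded:
  assumes ap: "\<forall>(c, A)\<in>set ap. A > 0" and bq: "\<forall>(b, B)\<in>set bq. B > 0"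
  shows "\<exists>Y. \<forall>\<xi>\<in>fox_right_poles m bq \<union> fox_left_poles n ap. \<bar>Im \<xi>\<bar> \<le> Y"
proof -
  let ?S = "insert 0 ((\<lambda>x. \<bar>Im (fst x) / snd x\<bar>) ` (set (take m bq) \<union> set (take n ap)))"
  have "\<bar>Im \<xi>\<bar> \<le> Max ?S" if \<xi>: "\<xi> \<in> fox_right_poles m bq \<union> fox_left_poles n ap" for \<xi>
  proof -
    obtain x where x: "x \<in> set (take m bq) \<union> set (take n ap)"
      "fst x - of_real (snd x) * \<xi> \<in> \<int>\<^sub>\<le>\<^sub>0 \<or> 1 - fst x + of_real (snd x) * \<xi> \<in> \<int>\<^sub>\<le>\<^sub>0"
      using \<xi> unfolding fox_left_poles_def fox_right_poles_def by force
    have Im0: "Im z = 0" if "z \<in> \<int>\<^sub>\<le>\<^sub>0" for z using that by (auto elim!: nonpos_Ints_cases)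
    have "Im (fst x) = snd x * Im \<xi>" using x(2) Im0 by (elim disjE) (force dest: Im0)+
    moreover have "snd x > 0" using x(1) ap bq by (fastforce dest: in_set_takeD)
    ultimately have "\<bar>Im \<xi>\<bar> = \<bar>Im (fst x) / snd x\<bar>" by simp
    also have "\<dots> \<le> Max ?S" using x(1) by (intro Max_ge) auto
    finally show ?thesis .
  qed
  then show ?thesis by blast
qed

lemma comparable_ex_good_cell:
  assumes "comparable_ex G e K \<delta> f"
  obtains C R where "C \<ge> 0" "\<And>r z z0 z1. r \<in> G \<Longrightarrow> r \<ge> R \<Longrightarrow> z0 \<in> cell e K r \<delta> \<Longrightarrow> z1 \<in> cell e K r \<delta> \<Longrightarrow>
     z \<in> closed_segment z0 z1 \<Longrightarrow> norm (f z) \<le> C * max (norm (f z0)) (norm (f z1))"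
proof -
  obtain d where "comparable G e K \<delta> d f" using assms unfolding comparable_ex_def ..
  then show thesis by (rule comparable_good_cell[OF _ that])
qed

lemma countable_affine_nonpos_Ints: "countable {z. c + z \<in> (\<int>\<^sub>\<le>\<^sub>0 :: complex set)}"
proof -
  have "countable (\<int>\<^sub>\<le>\<^sub>0 :: complex set)"
    by (rule countable_subset[of _ \<int>]) (auto simp: nonpos_Ints_def countable_int)
  moreover have "{z. c + z \<in> (\<int>\<^sub>\<le>\<^sub>0 :: complex set)} \<subseteq> (\<lambda>w. w - c) ` \<int>\<^sub>\<le>\<^sub>0" by force
  ultimately show ?thesis by (meson countable_image countable_subset)
qed

section \<open>The loop integral as a sum of residues\<close>

abbreviation "loop_kernel \<gamma> \<mu> \<equiv> fox_kernel 1 2 [(1 + \<gamma>, 1), (1 - \<mu>, 1)] [(0, 1)]"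

lemma loop_kernel_eq: "loop_kernel \<gamma> \<mu> \<eta> = Gamma (- \<eta>) * (Gamma (- \<gamma> + \<eta>) * Gamma (\<mu> + \<eta>))"
  by (simp add: fox_kernel_def)

lemma loop_right_poles: "fox_right_poles 1 [(0, 1)] = range of_nat"
  by (auto simp: fox_right_poles_def elim!: nonpos_Ints_cases')

lemma loop_left_poles: "fox_left_poles 2 [(1 + \<gamma>, 1), (1 - \<mu>, 1)] = {z. - \<gamma> + z \<in> \<int>\<^sub>\<le>\<^sub>0} \<union> {z. \<mu> + z \<in> \<int>\<^sub>\<le>\<^sub>0}"
  by (auto simp: fox_left_poles_def numeral_2_eq_2)

lemma tendsto_Gamma_uminus_pole:
  "((\<lambda>z::complex. Gamma (- z) * (z - of_nat k)) \<longlongrightarrow> - ((- 1) ^ k / fact k)) (at (of_nat k))"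
proof -
  have "filterlim (\<lambda>z::complex. - z) (at (- of_nat k)) (at (of_nat k))"
    by (rule filterlim_atI) (auto intro!: tendsto_intros eventually_neq_at_within)
  from filterlim_compose[OF Gamma_residues[of k] this]
  have "((\<lambda>z::complex. - (Gamma (- z) * (- z + of_nat k))) \<longlongrightarrow> - ((- 1) ^ k / fact k)) (at (of_nat k))"
    by (intro tendsto_minus)
  then show ?thesis by (simp add: algebra_simps)
qed

text \<open>The loop is cut off in a good cell and closed by a segment on which the integrand is
  small. It then runs clockwise around finitely many of the points 0, 1, 2, ..., and the residue
  theorem yields a partial sum of the series for \<open>hyp_F\<close>.\<close>

lemma right_loop_integral:
  fixes L :: "real \<Rightarrow> complex"
  assumes L: "fox_contour Right_Loop 1 2 [(1 + \<gamma>, 1), (1 - \<mu>, 1)] [(0, 1)] L"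
    and \<mu>: "Re \<mu> > 0" and v: "norm (v::complex) < 1" "v \<noteq> 0"
    and int: "integrable lborel (\<lambda>r. loop_kernel \<gamma> \<mu> (L r) * rGamma (c + L r) * (- v) powr L r * vector_derivative L (at r))"
  shows "(LINT r|lborel. loop_kernel \<gamma> \<mu> (L r) * rGamma (c + L r) * (- v) powr L r * vector_derivative L (at r)) =
    2 * of_real pi * \<i> * (Gamma (- \<gamma>) * hyp_F \<gamma> \<mu> v c)"
proof -
  define ap :: fox_params where "ap = [(1 + \<gamma>, 1), (1 - \<mu>, 1)]"
  define bq :: fox_params where "bq = [(0, 1)]"
  define g where "g z = loop_kernel \<gamma> \<mu> z * rGamma (c + z) * (- v) powr z" for z
  define lp where "lp = fox_left_poles 2 ap"
  have Lpc: "L piecewise_C1_differentiable_on UNIV" and ends: "contour_ends Right_Loop L"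
    and rp: "\<And>k. has_arg_variation L (of_nat k) (-1)" and lv: "\<And>z. z \<in> lp \<Longrightarrow> has_arg_variation L z 0"
    using L unfolding fox_contour_def loop_right_poles right_of_def left_of_def lp_def ap_def by auto
  have lpc: "closed lp" unfolding lp_def by (rule closed_fox_left_poles)
  have rpc: "closed (range (of_nat :: nat \<Rightarrow> complex))"
    using closed_fox_right_poles[of 1 bq] unfolding bq_def loop_right_poles .
  have disj: "of_nat k \<notin> lp" for k
  proof
    assume "of_nat k \<in> lp"
    from lv[OF this] rp[of k] have "(-1::real) = 0"
      unfolding has_arg_variation_def using tendsto_unique[OF trivial_limit_at_top_linorder] by blast
    then show False by simp
  qed
  have \<gamma>: "- \<gamma> \<notin> \<int>\<^sub>\<le>\<^sub>0" using disj[of 0] by (simp add: lp_def ap_def loop_left_poles)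
  have gh: "g holomorphic_on A" if "A \<inter> (range of_nat \<union> lp) = {}" for A
    unfolding g_def[abs_def] using that v
    by (intro holomorphic_intros fox_kernel_holomorphic) (auto simp: loop_right_poles lp_def ap_def simp del: One_nat_def)
  have avoid: "L s \<notin> range of_nat \<union> lp" for s
    using rp lv unfolding has_arg_variation_def by (metis UnE imageE rangeI)
  have contL: "continuous_on UNIV L" using Lpc by (auto simp: piecewise_C1_differentiable_on_def)
  have cgL: "continuous_on UNIV (\<lambda>s. g (L s))"
    using continuous_on_compose2[OF holomorphic_on_imp_continuous_on[OF gh[of "range L"]] contL] avoid by blast
  have int': "integrable lborel (\<lambda>s. g (L s) * vector_derivative L (at s))"
    using int by (simp add: g_def)
  define I where "I = (LINT s|lborel. g (L s) * vector_derivative L (at s))"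
  obtain K where K: "\<And>s. \<bar>Im (L s)\<bar> \<le> K" using ends by (auto simp: bounded_iff)
  have K0: "K \<ge> 0" using K[of 0] abs_ge_zero order_trans by blast
  have pos: "\<forall>(c, A)\<in>set ap. A > 0" "\<forall>(b, B)\<in>set bq. B > 0" by (auto simp: ap_def bq_def)
  obtain G \<delta> where \<delta>: "\<delta> > 0" and G: "\<And>R. \<exists>r\<ge>R. r \<in> G" and cmp: "comparable_ex G 1 K \<delta> (fox_kernel 1 2 ap bq)"
    and cell: "\<And>r. r \<in> G \<Longrightarrow> cell 1 K r \<delta> \<inter> fox_right_poles 1 bq = {}"
    by (rule comparable_ex_fox_kernel_right[OF pos K0]) blast
  have cmp_rG: "comparable_ex G 1 K \<delta> (\<lambda>z. rGamma (c + z))"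
    using comparable_rGamma[of 1 1 K \<delta> G c] K0 \<delta> by (auto simp: comparable_ex_def)
  have cmp_pw: "comparable_ex G 1 K \<delta> (\<lambda>z. (- v) powr z)"
    using comparable_powr[of 1 "- v" G K \<delta>] v by (auto simp: comparable_ex_def)
  have cg: "comparable_ex G 1 K \<delta> g"
    unfolding g_def[abs_def] using comparable_ex_mult[OF comparable_ex_mult[OF cmp cmp_rG] cmp_pw] by (simp add: ap_def bq_def)
  obtain C R1 where C: "C \<ge> 0" and R1: "\<And>r z z0 z1. r \<in> G \<Longrightarrow> r \<ge> R1 \<Longrightarrow> z0 \<in> cell 1 K r \<delta> \<Longrightarrow> z1 \<in> cell 1 K r \<delta> \<Longrightarrow>
     z \<in> closed_segment z0 z1 \<Longrightarrow> norm (g z) \<le> C * max (norm (g z0)) (norm (g z1))"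
    by (rule comparable_ex_good_cell[OF cg]) (rule that)
  obtain R2 where R2: "\<And>z. z \<in> lp \<Longrightarrow> Re z \<le> R2" using fox_left_poles_Re_bounded[OF pos(1), of 2] unfolding lp_def by blast
  have clp: "countable lp" unfolding lp_def ap_def loop_left_poles by (intro countable_Un countable_affine_nonpos_Ints)
  obtain T where T: "antimono_on {..-T} (Re \<circ> L)" "mono_on {T..} (Re \<circ> L)" using ends by auto
  have top: "filterlim (\<lambda>s. Re (L s / 1)) at_top at_top" "filterlim (\<lambda>s. Re (L s / 1)) at_top at_bot"
    using ends by (auto simp: o_def)
  define t where "t k = 2 * of_real pi * \<i> * (Gamma (- \<gamma>) * (hyp_coeff \<gamma> \<mu> v k * rGamma (c + of_nat k)))" for k
  \<comment> \<open>The factor -1 is the winding number of the clockwise loop. It cancels the sign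
    of the residue of \<Gamma>(-z), and \<open>(- 1) ^ k\<close> turns \<open>(- v) ^ k\<close> into
    \<open>v ^ k\<close>.\<close>
  have res: "2 * of_real pi * \<i> * ((- 1) * residue g (of_nat k)) = t k" for k
  proof -
    define h where "h z = Gamma (- \<gamma> + z) * Gamma (\<mu> + z) * rGamma (c + z) * (- v) powr z" for z
    define A where "A = - (lp \<union> (of_nat ` {j. j \<noteq> k}))"
    have "closed (of_nat ` {j. j \<noteq> k} :: complex set)" by (rule closed_of_nat_image)
    then have A: "open A" "of_nat k \<in> A" using lpc disj by (auto simp: A_def)
    have "h holomorphic_on A"
      unfolding h_def[abs_def] using v by (intro holomorphic_intros) (auto simp: A_def lp_def ap_def loop_left_poles)
    then have "isCont h (of_nat k)"
      using A holomorphic_on_imp_continuous_on continuous_on_eq_continuous_at by blast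
    then have "(h \<longlongrightarrow> h (of_nat k)) (at (of_nat k))" by (simp add: isCont_def)
    from tendsto_mult[OF tendsto_Gamma_uminus_pole[of k] this]
    have "((\<lambda>z. g z * (z - of_nat k)) \<longlongrightarrow> - ((- 1) ^ k / fact k) * h (of_nat k)) (at (of_nat k))"
      unfolding g_def h_def loop_kernel_eq by (simp add: mult_ac)
    moreover have "(A - {of_nat k}) \<inter> (range of_nat \<union> lp) = {}" by (auto simp: A_def)
    ultimately have r: "residue g (of_nat k) = - ((- 1) ^ k / fact k) * h (of_nat k)"
      by (intro residue_simple'[OF A gh])
    define X where "X = pochhammer (- \<gamma>) k * Gamma (- \<gamma>) * Gamma (\<mu> + of_nat k) * rGamma (c + of_nat k)"
    have hk: "h (of_nat k) = X * (- v) ^ k"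
      using v pochhammer_Gamma[OF \<gamma>, of k] \<gamma> by (simp add: h_def X_def powr_nat' Gamma_eq_zero_iff)
    have sgn: "(- 1) ^ k * (- v) ^ k = v ^ k" by (simp flip: power_mult_distrib)
    have "(- 1) * residue g (of_nat k) = X * ((- 1) ^ k * (- v) ^ k) / fact k" unfolding r hk by simp
    then show ?thesis unfolding sgn t_def hyp_coeff_def X_def by simp
  qed
  \<comment> \<open>The good cells dictate which partial sums are reached, so the approximation is
    along a subsequence. This suffices because the series is already known to converge.\<close>
  have approx: "\<exists>n\<ge>N. norm (I - (\<Sum>k<n. t k)) \<le> \<epsilon> * (2 + C / \<delta> * (\<delta> + 2 * K))" if \<epsilon>: "\<epsilon> > 0" for \<epsilon> :: real and N
  proof -
    let ?F = "\<lambda>s. g (L s) * vector_derivative L (at s)"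
    have mirror: "eventually (\<lambda>S. (LINT s:{..-S}|lborel. norm (?F s)) \<le> \<epsilon>) at_top"
    proof -
      have "integrable lborel (\<lambda>s. norm (?F (- s)))"
        using lborel_integrable_real_affine[OF integrable_norm[OF int'], of "-1" 0] by simp
      from tail_integral_small[OF this _ \<epsilon>] show ?thesis
        by (simp add: set_integral_mirror[of _ "\<lambda>s. norm (?F s)"])
    qed
    have "eventually (\<lambda>S. (LINT s:{S..}|lborel. norm (?F s)) \<le> \<epsilon> \<and> (LINT s:{..-S}|lborel. norm (?F s)) \<le> \<epsilon> \<and> S \<ge> max 0 T) at_top"
      by (intro eventually_conj tail_integral_small mirror \<epsilon> integrable_norm int' norm_ge_zero eventually_ge_at_top)
    then obtain S where S: "(LINT s:{S..}|lborel. norm (?F s)) \<le> \<epsilon>" "(LINT s:{..-S}|lborel. norm (?F s)) \<le> \<epsilon>" "S \<ge> 0" "S \<ge> T"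
      by (auto dest!: eventually_happens)
    have "compact ((\<lambda>s. Re (L s)) ` {-S..S})"
      by (intro compact_continuous_image continuous_intros continuous_on_subset[OF contL]) auto
    then obtain R3 where R3: "\<And>s. s \<in> {-S..S} \<Longrightarrow> Re (L s) \<le> R3"
      by (meson bounded_imp_bdd_above bdd_above_def compact_imp_bounded imageI)
    obtain r where r: "r \<ge> Max {R1, R2 + 1, R3, Re (L S) + 1, Re (L (-S)) + 1, real N + 1, 0}" "r \<in> G" using G by blast
    then have r': "r \<ge> R1" "r > R2" "r \<ge> R3" "r > Re (L S)" "r > Re (L (-S))" "r > real N" "r \<ge> 0" by auto
    obtain b where b: "b > S" "r \<le> Re (L b / 1)" "Re (L b / 1) \<le> r + \<delta>" "norm (g (L b)) * \<delta> \<le> \<epsilon>"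
      by (rule upper_crossing_point[OF Lpc _ top(1) cgL int' S(1) _ \<delta>, of r]) (use r' in auto)
    obtain a where a: "a < -S" "r \<le> Re (L a / 1)" "Re (L a / 1) \<le> r + \<delta>" "norm (g (L a)) * \<delta> \<le> \<epsilon>"
      by (rule lower_crossing_point[OF Lpc _ top(2) cgL int' S(2) _ \<delta>, of r]) (use r' in auto)
    have ab: "a < b" using a b S by simp
    have cl: "L b \<in> cell 1 K r \<delta>" "L a \<in> cell 1 K r \<delta>" using a b K by (auto simp: cell_one)
    have seg: "closed_segment (L b) (L a) \<subseteq> cell 1 K r \<delta>" by (rule closed_segment_subset[OF cl convex_cell])
    have nc: "of_nat k \<notin> cell 1 K r \<delta>" for k using cell[OF r(2)] unfolding bq_def loop_right_poles by auto
    have nat_cases: "real k < r \<or> real k > r + \<delta>" for k using nc[of k] K0 by (auto simp: cell_one)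
    define n where "n = nat \<lceil>r\<rceil>"
    have n: "k < n \<longleftrightarrow> real k < r" for k unfolding n_def by linarith
    have nN: "n \<ge> N" unfolding n_def using r'(6) by linarith
    \<comment> \<open>The poles beyond the cell are taken out of the domain, so that finitely many
      singularities remain inside it. The complement of a closed countable set is open and
      connected, as the residue theorem demands.\<close>
    define A where "A = - (lp \<union> of_nat ` {k. k \<ge> n})"
    define p where "p = (L \<circ> linepath a b) +++ linepath (L b) (L a)"
    have vp: "valid_path p" and loop: "pathfinish p = pathstart p"
      unfolding p_def using valid_path_arc[OF Lpc ab] by (auto intro!: valid_path_join)
    have pim: "path_image p = L ` {a..b} \<union> closed_segment (L b) (L a)"
      unfolding p_def using ab by (simp add: path_image_join path_image_arc)
    have seg_avoid: "closed_segment (L b) (L a) \<inter> (range of_nat \<union> lp) = {}"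
    proof -
      have "z \<notin> lp" if "z \<in> cell 1 K r \<delta>" for z using that R2[of z] r' by (auto simp: cell_one)
      then show ?thesis using seg nc by blast
    qed
    have pav: "path_image p \<inter> (range of_nat \<union> lp) = {}"
      unfolding pim using seg_avoid avoid by blast
    have wn_split: "winding_number p z = winding_number (L \<circ> linepath a b) z + winding_number (linepath (L b) (L a)) z" if "z \<notin> path_image p" for z
      unfolding p_def using that ab valid_path_arc[OF Lpc ab] unfolding pim
      by (intro winding_number_join) (auto simp: path_image_arc valid_path_imp_path)
    have wn: "winding_number p z = of_real v0" if z: "z \<notin> path_image p" "Re z < r" and v0: "has_arg_variation L z v0" "v0 \<in> \<int>" for z v0
    proof -
      have zz: "Re z < Re (L a)" "Re z < Re (L b)" using z a b by auto
      have "arg_tails L z a b 1 1" by (rule right_loop_arg_tails[OF ends T S(4) a(1) b(1) zz])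
      from winding_number_arg_tails[OF Lpc v0(1) ab _ _ this]
      have "Re (winding_number p z) = v0"
        using winding_number_linepath_Arg(1)[of "L b" z 1 "L a"] zz wn_split[OF z(1)] by (simp add: diff_divide_distrib)
      moreover have "winding_number p z \<in> \<int>"
        using integer_winding_number[OF valid_path_imp_path[OF vp] loop z(1)] .
      ultimately show ?thesis by (auto elim!: Ints_cases)
    qed
    have "contour_integral p g = 2 * pi * \<i> * (\<Sum>z\<in>of_nat ` {..<n}. winding_number p z * residue g z)"
    proof (rule Residue_theorem)
      have "closed (of_nat ` {k. k \<ge> n} :: complex set)" by (rule closed_of_nat_image)
      then show "open A" using lpc by (auto simp: A_def)
      have "countable (lp \<union> of_nat ` {k. k \<ge> n})" using clp by auto
      then show "connected A" unfolding A_def by (intro path_connected_imp_connected path_connected_complement_countable) auto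
      show "finite (of_nat ` {..<n} :: complex set)" by simp
      have "range of_nat = of_nat ` {..<n} \<union> (of_nat ` {k. k \<ge> n} :: complex set)"
        unfolding image_Un[symmetric] by (rule arg_cong[where f = "image of_nat"]) auto
      then have "(A - of_nat ` {..<n}) \<inter> (range of_nat \<union> lp) = {}" unfolding A_def by blast
      then show "g holomorphic_on A - of_nat ` {..<n}" by (rule gh)
      show "valid_path p" "pathfinish p = pathstart p" by fact+
      show "path_image p \<subseteq> A - of_nat ` {..<n}" using pav by (auto simp: A_def)
      show "\<forall>z. z \<notin> A \<longrightarrow> winding_number p z = 0"
      proof (intro allI impI)
        fix z assume "z \<notin> A"
        then consider "z \<in> lp" | k where "z = of_nat k" "k \<ge> n" by (auto simp: A_def)
        then show "winding_number p z = 0"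
        proof cases
          case 1
          then show ?thesis using wn[of z 0] lv[of z] R2[of z] r' pav by auto
        next
          case 2
          then have kr: "Re z > r + \<delta>" using nat_cases[of k] n[of k] by auto
          have "path_image p \<subseteq> {z. Re z \<le> r + \<delta>}"
          proof -
            have "Re (L s) \<le> r + \<delta>" if "s \<in> {a..b}" for s
              by (rule right_loop_Re_le[OF T S(4) _ a(1) b(1) _ _ that]) (use R3 r' \<delta> a b in \<open>auto intro: order_trans\<close>)
            then show ?thesis unfolding pim using seg by (auto simp: cell_one)
          qed
          then show ?thesis
            using kr by (intro winding_number_zero_outside[OF valid_path_imp_path[OF vp] convex_halfspace_Re_le loop]) auto
        qed
      qed
    qed
    also have "(\<Sum>z\<in>of_nat ` {..<n}. winding_number p z * residue g z) = (\<Sum>k<n. (- 1) * residue g (of_nat k))"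
    proof -
      have "winding_number p (of_nat k) = -1" if "k < n" for k
        using wn[of "of_nat k" "-1"] rp[of k] that n[of k] pav by auto
      then show ?thesis by (subst sum.reindex) (auto simp: inj_on_def)
    qed
    also have "2 * pi * \<i> * \<dots> = (\<Sum>k<n. t k)" by (simp add: sum_distrib_left flip: res)
    finally have ci: "contour_integral p g = (\<Sum>k<n. t k)" .
    have S2: "-S \<le> S" using S by simp
    note tr = integral_truncation[OF int' less_imp_le[OF a(1)] S2 less_imp_le[OF b(1)]]
    define J where "J = (LINT s:{a..b}|lborel. ?F s)"
    have i1: "(g has_contour_integral J) (L \<circ> linepath a b)"
      unfolding J_def by (rule has_contour_integral_arc[OF Lpc ab tr(1)])
    have i2: "g contour_integrable_on linepath (L b) (L a)"
      using seg_avoid by (intro contour_integrable_continuous_linepath holomorphic_on_imp_continuous_on gh)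
    have "(g has_contour_integral J + contour_integral (linepath (L b) (L a)) g) p"
      unfolding p_def using valid_path_arc[OF Lpc ab] i1 i2
      by (intro has_contour_integral_join has_contour_integral_integral) auto
    then have eq: "(\<Sum>k<n. t k) = J + contour_integral (linepath (L b) (L a)) g"
      using ci contour_integral_unique by metis
    have gb: "norm (g (L b)) \<le> \<epsilon> / \<delta>" "norm (g (L a)) \<le> \<epsilon> / \<delta>" using a(4) b(4) \<delta> by (simp_all add: field_simps)
    have "norm (contour_integral (linepath (L b) (L a)) g) \<le> (C * (\<epsilon> / \<delta>)) * norm (L a - L b)"
    proof (rule contour_integral_bound_linepath[OF i2])
      show "0 \<le> C * (\<epsilon> / \<delta>)" using C \<epsilon> \<delta> by simp
      fix z assume "z \<in> closed_segment (L b) (L a)"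
      then have "norm (g z) \<le> C * max (norm (g (L b))) (norm (g (L a)))" by (rule R1[OF r(2) r'(1) cl])
      also have "\<dots> \<le> C * (\<epsilon> / \<delta>)" using gb C by (intro mult_left_mono) auto
      finally show "norm (g z) \<le> C * (\<epsilon> / \<delta>)" .
    qed
    also have "\<dots> \<le> (C * (\<epsilon> / \<delta>)) * (\<delta> + 2 * K)"
      using C \<epsilon> \<delta> by (intro mult_left_mono cell_norm_diff[OF cl(2,1)]) auto
    finally have sb: "norm (contour_integral (linepath (L b) (L a)) g) \<le> \<epsilon> * (C / \<delta> * (\<delta> + 2 * K))" by (simp add: mult_ac)
    have "norm (I - (\<Sum>k<n. t k)) \<le> norm (I - J) + norm (contour_integral (linepath (L b) (L a)) g)"
      unfolding eq using norm_triangle_ineq4[of "I - J" "contour_integral (linepath (L b) (L a)) g"] by (simp add: algebra_simps)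
    also have "\<dots> \<le> (\<epsilon> + \<epsilon>) + \<epsilon> * (C / \<delta> * (\<delta> + 2 * K))"
      using tr(2) S sb unfolding I_def J_def by (intro add_mono) auto
    finally show ?thesis using nN by (intro exI[of _ n]) (simp add: algebra_simps)
  qed
  define lim where "lim = 2 * of_real pi * \<i> * (Gamma (- \<gamma>) * hyp_F \<gamma> \<mu> v c)"
  have "t sums lim" unfolding t_def lim_def by (intro sums_mult hyp_F_sums \<mu> v)
  then have lim: "(\<lambda>n. \<Sum>k<n. t k) \<longlonglongrightarrow> lim" by (simp add: sums_def)
  define D where "D = 2 + C / \<delta> * (\<delta> + 2 * K)"
  have D: "D > 0" using C \<delta> K0 by (auto simp: D_def intro!: add_pos_nonneg)
  have "norm (I - lim) \<le> 0"
  proof (rule field_le_epsilon)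
    fix e :: real assume e: "e > 0"
    from lim obtain N where N: "\<And>n. n \<ge> N \<Longrightarrow> norm ((\<Sum>k<n. t k) - lim) < e / 2"
      using e by (metis LIMSEQ_iff half_gt_zero)
    obtain n where n: "n \<ge> N" "norm (I - (\<Sum>k<n. t k)) \<le> e / 2 / D * D"
      using approx[of "e / 2 / D" N] e D by (auto simp: D_def)
    have "norm (I - lim) \<le> norm (I - (\<Sum>k<n. t k)) + norm ((\<Sum>k<n. t k) - lim)"
      using norm_triangle_ineq[of "I - (\<Sum>k<n. t k)" "(\<Sum>k<n. t k) - lim"] by simp
    also have "\<dots> \<le> 0 + e" using n(2) N[OF n(1)] D by simp
    finally show "norm (I - lim) \<le> 0 + e" .
  qed
  then show ?thesis by (simp add: I_def g_def lim_def)
qed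

section \<open>Changing the contour\<close>

lemma good_cell_mono: "good_cell g P e K' C \<delta> r \<Longrightarrow> K \<le> K' \<Longrightarrow> good_cell g P e K C \<delta> r"
proof -
  assume g: "good_cell g P e K' C \<delta> r" and "K \<le> K'"
  then have "cell e K r \<delta> \<subseteq> cell e K' r \<delta>" by (auto simp: cell_def)
  then show ?thesis using g unfolding good_cell_def by blast
qed

lemma cell_affine_gamma_dom:
  assumes e: "(e = \<i> \<or> e = - \<i>) \<and> B \<noteq> 0 \<or> e = 1 \<and> B > 0" and K: "K \<ge> 0"
  obtains M R where "M \<ge> 0"
    "\<And>r z. r \<ge> R \<Longrightarrow> z \<in> cell e K r \<delta> \<Longrightarrow> c + of_real B * z \<in> gamma_dom M \<and> norm (c + of_real B * z) \<ge> N"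
proof -
  define M where "M = norm c + \<bar>B\<bar> * K"
  have B0: "\<bar>B\<bar> > 0" and e1: "norm e = 1" using e by auto
  have M: "M \<ge> 0" using K by (auto simp: M_def)
  show thesis
  proof (rule that[OF M, of "max 1 ((2 + 2 * norm c + \<bar>N\<bar>) / \<bar>B\<bar>)"])
    fix r x assume *: "r \<ge> max 1 ((2 + 2 * norm c + \<bar>N\<bar>) / \<bar>B\<bar>)" and x: "x \<in> cell e K r \<delta>"
    have r1: "r \<ge> 1" and rB: "2 + 2 * norm c + \<bar>N\<bar> \<le> \<bar>B\<bar> * r" using * B0 by (auto simp: field_simps)
    have re: "e \<noteq> 1 \<Longrightarrow> \<bar>Re x\<bar> \<le> K" "e = 1 \<Longrightarrow> Re x \<ge> r" "e \<noteq> 1 \<Longrightarrow> \<bar>Im x\<bar> \<ge> r"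
      using x e K r1 by (auto simp: cell_def)
    have "c + of_real B * x \<in> gamma_dom M"
    proof (cases "e = 1")
      case True
      then have "B > 0" using e by (auto simp: complex_eq_iff)
      then have "B * r \<le> B * Re x" using re True by simp
      moreover have "Re (c + of_real B * x) = Re c + B * Re x" "- Re c \<le> norm c" "0 \<le> norm c"
        using abs_Re_le_cmod[of c] by auto
      moreover have "2 + 2 * norm c + \<bar>N\<bar> \<le> B * r" using rB \<open>B > 0\<close> by simp
      ultimately have "Re (c + of_real B * x) \<ge> 2" by linarith
      then show ?thesis using M by (simp add: gamma_dom_def)
    next
      case False
      have "\<bar>B * Re x\<bar> \<le> \<bar>B\<bar> * K" using re(1)[OF False] by (auto simp: abs_mult intro!: mult_left_mono)
      then have 1: "Re (c + of_real B * x) \<ge> - M" using abs_Re_le_cmod[of c] by (simp add: M_def)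
      have "\<bar>B * Im x\<bar> \<ge> \<bar>B\<bar> * r" using re(3)[OF False] by (auto simp: abs_mult intro!: mult_left_mono)
      then have "\<bar>Im (c + of_real B * x)\<bar> \<ge> 2" using abs_Im_le_cmod[of c] rB by simp
      with 1 show ?thesis by (simp add: gamma_dom_def)
    qed
    moreover have "N \<le> norm (c + of_real B * x)"
    proof -
      have "\<bar>B\<bar> * r \<le> \<bar>B\<bar> * norm x" using cell_norm(1)[OF x e1] by (intro mult_left_mono) auto
      moreover have "norm (of_real B * x) - norm c \<le> norm (c + of_real B * x)"
        using norm_triangle_ineq2[of "of_real B * x" "- c"] by (simp add: add.commute)
      ultimately show ?thesis using rB norm_ge_zero[of c] abs_ge_self[of N] unfolding norm_mult norm_of_real by linarith
    qed
    ultimately show "c + of_real B * x \<in> gamma_dom M \<and> norm (c + of_real B * x) \<ge> N" by simp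
  qed
qed

text \<open>Far out \<open>hyp_F\<close> is \<open>Gamma \<mu> * rGamma c\<close> times a factor of
  norm between 1/2 and 2, hence comparable with the exponent of \<open>rGamma\<close>.\<close>

lemma comparable_ex_hyp_F:
  assumes e: "(e = \<i> \<or> e = - \<i>) \<and> B \<noteq> 0 \<or> e = 1 \<and> B > 0" and K: "K \<ge> 0" "\<delta> \<ge> 0"
    and \<mu>: "Re \<mu> > 0" and v: "norm v < 1"
  shows "comparable_ex G e K \<delta> (\<lambda>z. hyp_F \<gamma> \<mu> v (c + of_real B * z))"
proof -
  obtain M R0 where M: "M \<ge> 0" and dom0: "\<And>r z. r \<ge> R0 \<Longrightarrow> z \<in> cell e K r \<delta> \<Longrightarrow> c + of_real B * z \<in> gamma_dom M \<and> norm (c + of_real B * z) \<ge> 0"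
    by (rule cell_affine_gamma_dom[OF e K(1), where \<delta> = \<delta> and c = c and N = 0]) (rule that)
  obtain S where S: "\<And>c. c \<in> gamma_dom M \<Longrightarrow> norm (hyp_F \<gamma> \<mu> v c / (Gamma \<mu> * rGamma c) - 1) \<le> S / norm c"
    by (rule hyp_F_asymp[OF \<mu> v M, where \<gamma> = \<gamma>]) (rule that)
  \<comment> \<open>\<open>S\<close> depends on \<open>M\<close>, so only now can the threshold be
    chosen beyond which the relative error \<open>S / norm c\<close> is at most 1/2.\<close>
  obtain M' R1 where "M' \<ge> 0" and dom1: "\<And>r z. r \<ge> R1 \<Longrightarrow> z \<in> cell e K r \<delta> \<Longrightarrow> c + of_real B * z \<in> gamma_dom M' \<and> norm (c + of_real B * z) \<ge> max 1 (2 * \<bar>S\<bar>)"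
    by (rule cell_affine_gamma_dom[OF e K(1), where \<delta> = \<delta> and c = c and N = "max 1 (2 * \<bar>S\<bar>)"]) (rule that)
  let ?c = "\<lambda>z. c + of_real B * z"
  let ?q = "\<lambda>z. hyp_F \<gamma> \<mu> v (?c z) / (Gamma \<mu> * rGamma (?c z))"
  have "comparable G e K \<delta> 0 ?q"
  proof (rule comparable_near_const[of "1 / 2" _ "max R0 R1" _ _ _ _ 2])
    fix r z assume r: "r \<ge> max R0 R1" and z: "z \<in> cell e K r \<delta>"
    have d: "?c z \<in> gamma_dom M" "norm (?c z) \<ge> 1" "2 * \<bar>S\<bar> \<le> norm (?c z)"
      using dom0[OF _ z] dom1[OF _ z] r by auto
    have "norm (?q z - 1) \<le> S / norm (?c z)" by (rule S[OF d(1)])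
    also have "\<dots> \<le> 1 / 2"
    proof -
      have "norm (?c z) > 0" using d by linarith
      then show ?thesis using d by (subst pos_divide_le_eq) auto
    qed
    finally have "norm (?q z - 1) \<le> 1 / 2" .
    then show "1 / 2 \<le> norm (?q z) \<and> norm (?q z) \<le> 2"
      using norm_triangle_ineq2[of 1 "1 - ?q z"] norm_triangle_ineq[of 1 "?q z - 1"] by (simp add: norm_minus_commute)
  qed simp
  moreover have "comparable G e K \<delta> (0 + - B) (\<lambda>z. Gamma \<mu> * rGamma (?c z))"
    by (intro comparable_mult comparable_const comparable_rGamma e K)
  ultimately have "comparable G e K \<delta> (0 + (0 + - B)) (\<lambda>z. ?q z * (Gamma \<mu> * rGamma (?c z)))"
    by (rule comparable_mult)
  then have "comparable G e K \<delta> (0 + (0 + - B)) (\<lambda>z. hyp_F \<gamma> \<mu> v (?c z))"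
  proof (rule comparable_cong[where ?R0.0 = R0])
    fix r z assume "r \<ge> R0" "z \<in> cell e K r \<delta>"
    then have "?c z \<in> gamma_dom M" using dom0 by blast
    then have "?c z \<notin> \<int>\<^sub>\<le>\<^sub>0" using gamma_dom_slit nonpos_Ints_subset_nonpos_Reals by blast
    then have "Gamma \<mu> * rGamma (?c z) \<noteq> 0"
      using Re_pos_not_nonpos_Int[OF \<mu>] by (simp add: rGamma_eq_zero_iff Gamma_eq_zero_iff)
    then show "hyp_F \<gamma> \<mu> v (?c z) = ?q z * (Gamma \<mu> * rGamma (?c z))" by simp
  qed
  then show ?thesis unfolding comparable_ex_def by blast
qed

text \<open>Seen from \<open>p\<close> the contour stays in the closed right half plane and misses
  \<open>p\<close>, so the principal argument is continuous along it and only its limits count: pi/2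
  and -pi/2 for a vertical contour, 0 and 0 for a right loop. A left loop leaves every such half
  plane.\<close>

lemma half_plane_has_arg_variation:
  fixes L :: "real \<Rightarrow> complex"
  assumes L: "L piecewise_C1_differentiable_on UNIV" and ends: "contour_ends k L" and k: "k \<noteq> Left_Loop"
    and p: "p \<notin> range L" and half: "\<And>s. Re p \<le> Re (L s)"
  shows "has_arg_variation L p (left_variation k)"
proof -
  have slit: "L s - p \<notin> \<real>\<^sub>\<le>\<^sub>0" for s
  proof
    assume "L s - p \<in> \<real>\<^sub>\<le>\<^sub>0"
    then have "L s = p" using half[of s] by (auto simp: complex_nonpos_Reals_iff complex_eq_iff)
    then show False using p by blast
  qed
  have eq: "Re (winding_number (L \<circ> linepath (-T) T) p) = (Arg (L T - p) - Arg (L (-T) - p)) / (2 * pi)" if "T > 0" for T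
    using winding_number_Arg[OF valid_path_arc[OF L], of "-T" T p 1] that slit by (auto simp: path_image_arc)
  have "\<exists>a b. ((\<lambda>s. Arg (L s - p)) \<longlongrightarrow> a) at_top \<and> ((\<lambda>s. Arg (L s - p)) \<longlongrightarrow> b) at_bot \<and> (a - b) / (2 * pi) = left_variation k"
  proof (cases k)
    case Vertical
    obtain K where K: "\<And>s. \<bar>Re (L s)\<bar> \<le> K" using ends Vertical by (auto simp: bounded_iff)
    have top: "filterlim (\<lambda>s. Im (L s)) at_top at_top" and bot: "filterlim (\<lambda>s. - Im (L s)) at_top at_bot"
      using ends Vertical by (auto simp: o_def filterlim_uminus_at_top)
    have rot: "Arg z = Arg (z / e) + Arg e" if "Re (z / e) > 0" "e = \<i> \<or> e = - \<i>" for z e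
    proof -
      have z0: "z / e \<noteq> 0" "e \<noteq> 0" using that by auto
      have "\<bar>Arg (z / e)\<bar> < pi / 2" unfolding Arg_Re_pos using that(1) by simp
      moreover have "Arg e = pi / 2 \<or> Arg e = - (pi / 2)" using that(2) by auto
      ultimately have "Arg (z / e) + Arg e \<in> {-pi<..pi}" by (auto simp: abs_less_iff)
      then show ?thesis using Arg_times'[OF z0] z0 by simp
    qed
    have "((\<lambda>s. Arg ((L s - p) / \<i>)) \<longlongrightarrow> 0) at_top"
    proof (rule Arg_tendsto_0[where K = "K + \<bar>Re p\<bar>"])
      show "filterlim (\<lambda>s. Re ((L s - p) / \<i>)) at_top at_top"
        using filterlim_tendsto_add_at_top[OF tendsto_const[of "- Im p"] top] by simp
      show "\<bar>Im ((L s - p) / \<i>)\<bar> \<le> K + \<bar>Re p\<bar>" for s using K[of s] by simp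
    qed
    then have "((\<lambda>s. Arg ((L s - p) / \<i>) + Arg \<i>) \<longlongrightarrow> 0 + pi / 2) at_top" by (intro tendsto_intros) auto
    moreover have "eventually (\<lambda>s. Arg ((L s - p) / \<i>) + Arg \<i> = Arg (L s - p)) at_top"
      using filterlim_at_top_dense[THEN iffD1, OF top, rule_format, of "Im p"]
      by eventually_elim (rule rot[symmetric], auto)
    ultimately have 1: "((\<lambda>s. Arg (L s - p)) \<longlongrightarrow> pi / 2) at_top"
      by (auto intro: Lim_transform_eventually)
    have "((\<lambda>s. Arg ((L s - p) / -\<i>)) \<longlongrightarrow> 0) at_bot"
    proof (rule Arg_tendsto_0[where K = "K + \<bar>Re p\<bar>"])
      show "filterlim (\<lambda>s. Re ((L s - p) / -\<i>)) at_top at_bot"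
        using filterlim_tendsto_add_at_top[OF tendsto_const[of "Im p"] bot] by simp
      show "\<bar>Im ((L s - p) / -\<i>)\<bar> \<le> K + \<bar>Re p\<bar>" for s using K[of s] by simp
    qed
    then have "((\<lambda>s. Arg ((L s - p) / -\<i>) + Arg (-\<i>)) \<longlongrightarrow> 0 + - (pi / 2)) at_bot" by (intro tendsto_intros) auto
    moreover have "eventually (\<lambda>s. Arg ((L s - p) / -\<i>) + Arg (-\<i>) = Arg (L s - p)) at_bot"
      using filterlim_at_top_dense[THEN iffD1, OF bot, rule_format, of "- Im p"]
      by eventually_elim (rule rot[symmetric], auto)
    ultimately have 2: "((\<lambda>s. Arg (L s - p)) \<longlongrightarrow> - (pi / 2)) at_bot"
      by (auto intro: Lim_transform_eventually)
    show ?thesis using 1 2 Vertical by (intro exI[of _ "pi / 2"] exI[of _ "- (pi / 2)"]) auto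
  next
    case Right_Loop
    obtain K where K: "\<And>s. \<bar>Im (L s)\<bar> \<le> K" using ends Right_Loop by (auto simp: bounded_iff)
    have 1: "\<bar>Im (L s - p)\<bar> \<le> K + \<bar>Im p\<bar>" for s using K[of s] by simp
    have 2: "filterlim (\<lambda>s. Re (L s - p)) at_top F" if "filterlim (\<lambda>s. Re (L s)) at_top F" for F
      using filterlim_tendsto_add_at_top[OF tendsto_const[of "- Re p"] that] by simp
    have "((\<lambda>s. Arg (L s - p)) \<longlongrightarrow> 0) at_top" "((\<lambda>s. Arg (L s - p)) \<longlongrightarrow> 0) at_bot"
      using Arg_tendsto_0[OF 2 1] ends Right_Loop by (simp_all add: o_def)
    then show ?thesis using Right_Loop by (intro exI[of _ 0]) auto
  qed (use k in simp)
  then obtain a b where ab: "((\<lambda>s. Arg (L s - p)) \<longlongrightarrow> a) at_top" "((\<lambda>s. Arg (L s - p)) \<longlongrightarrow> b) at_bot"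
    "(a - b) / (2 * pi) = left_variation k" by blast
  have "((\<lambda>T. (Arg (L T - p) - Arg (L (-T) - p)) / (2 * pi)) \<longlongrightarrow> (a - b) / (2 * pi)) at_top"
    using ab(2) by (intro tendsto_intros ab(1)) (auto simp: filterlim_at_bot_mirror)
  moreover have "eventually (\<lambda>T. (Arg (L T - p) - Arg (L (-T) - p)) / (2 * pi) = Re (winding_number (L \<circ> linepath (-T) T) p)) at_top"
    using eventually_gt_at_top[of 0] by eventually_elim (simp add: eq)
  ultimately have "((\<lambda>T. Re (winding_number (L \<circ> linepath (-T) T) p)) \<longlongrightarrow> left_variation k) at_top"
    unfolding ab(3) by (rule Lim_transform_eventually)
  then show ?thesis using p by (simp add: has_arg_variation_def)
qed

section \<open>Level sets of contours, and the additional Gamma factor\<close>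

lemma countable_isolated_reals:
  fixes Z :: "real set"
  assumes "\<And>s. s \<in> Z \<Longrightarrow> \<exists>\<epsilon>>0. \<forall>t\<in>Z. \<bar>t - s\<bar> < \<epsilon> \<longrightarrow> t = s"
  shows "countable Z"
proof -
  have "Z \<subseteq> (\<Union>(a, b)\<in>\<rat> \<times> \<rat>. {s\<in>Z. Z \<inter> {a<..<b} = {s}})"
  proof
    fix s assume s: "s \<in> Z"
    obtain \<epsilon> where \<epsilon>: "\<epsilon> > 0" "\<forall>t\<in>Z. \<bar>t - s\<bar> < \<epsilon> \<longrightarrow> t = s" using assms[OF s] by blast
    obtain a where a: "a \<in> \<rat>" "s - \<epsilon> < a" "a < s" using Rats_dense_in_real[of "s - \<epsilon>" s] \<epsilon> by auto
    obtain b where b: "b \<in> \<rat>" "s < b" "b < s + \<epsilon>" using Rats_dense_in_real[of s "s + \<epsilon>"] \<epsilon> by auto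
    have "Z \<inter> {a<..<b} = {s}"
    proof
      show "Z \<inter> {a<..<b} \<subseteq> {s}"
      proof
        fix t assume t: "t \<in> Z \<inter> {a<..<b}"
        then have "\<bar>t - s\<bar> < \<epsilon>" using a b by (auto simp: abs_less_iff)
        then show "t \<in> {s}" using \<epsilon> t by blast
      qed
    qed (use s a b in auto)
    then show "s \<in> (\<Union>(a, b)\<in>\<rat> \<times> \<rat>. {s\<in>Z. Z \<inter> {a<..<b} = {s}})" using a b s by blast
  qed
  moreover have "countable (\<Union>(a, b)\<in>\<rat> \<times> \<rat>. {s\<in>Z. Z \<inter> {a<..<b} = {s}})"
  proof (intro countable_UN countable_SIGMA countable_rat)
    fix x :: "real \<times> real"
    obtain a b where x: "x = (a, b)" by force
    have "{s\<in>Z. Z \<inter> {a<..<b} = {s}} \<subseteq> {THE s. Z \<inter> {a<..<b} = {s}}" by auto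
    then show "countable (case x of (a, b) \<Rightarrow> {s\<in>Z. Z \<inter> {a<..<b} = {s}})"
      unfolding x prod.case using countable_subset by (metis countable_empty countable_insert)
  qed
  ultimately show ?thesis by (rule countable_subset)
qed

text \<open>A parameter of the level set with nonzero derivative is isolated in it, and isolated
  points are countable. A contour may rest at \<open>p\<close> for a set of parameters of positive
  measure, but these contribute nothing to a contour integral.\<close>

lemma AE_level_set_derivative_zero:
  fixes L :: "real \<Rightarrow> complex"
  assumes L: "L piecewise_C1_differentiable_on UNIV"
  shows "AE s in lborel. L s = p \<longrightarrow> vector_derivative L (at s) = 0"
proof -
  obtain E where E: "finite E" "\<And>s. s \<notin> E \<Longrightarrow> (L has_vector_derivative vector_derivative L (at s)) (at s)"
    using L by (rule piecewise_C1_UNIV_E) blast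
  define Z where "Z = {s. s \<notin> E \<and> L s = p \<and> vector_derivative L (at s) \<noteq> 0}"
  have "countable Z"
  proof (rule countable_isolated_reals)
    fix s assume s: "s \<in> Z"
    let ?D = "vector_derivative L (at s)"
    have D: "norm ?D > 0" and "(L has_derivative (\<lambda>x. x *\<^sub>R ?D)) (at s)"
      using E(2)[of s] s by (auto simp: Z_def has_vector_derivative_def)
    then obtain \<epsilon> where \<epsilon>: "\<epsilon> > 0"
      "\<And>t. norm (t - s) < \<epsilon> \<Longrightarrow> norm (L t - L s - (t - s) *\<^sub>R ?D) \<le> norm ?D / 2 * norm (t - s)"
      unfolding has_derivative_at_alt by (meson half_gt_zero)
    have "t = s" if t: "t \<in> Z" "\<bar>t - s\<bar> < \<epsilon>" for t
    proof (rule ccontr)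
      assume "t \<noteq> s"
      have "\<bar>t - s\<bar> * norm ?D \<le> norm ?D / 2 * \<bar>t - s\<bar>"
        using \<epsilon>(2)[of t] t s by (simp add: Z_def)
      then show False using D \<open>t \<noteq> s\<close> by (simp add: mult.commute)
    qed
    then show "\<exists>\<epsilon>>0. \<forall>t\<in>Z. \<bar>t - s\<bar> < \<epsilon> \<longrightarrow> t = s" using \<epsilon>(1) by blast
  qed
  then have "countable (Z \<union> E)" using E(1) by (simp add: countable_finite)
  then have "AE s in lborel. s \<notin> Z \<union> E" by (intro AE_not_in countable_imp_null_set_lborel)
  then show ?thesis by eventually_elim (auto simp: Z_def)
qed

lemma fox_kernel_extend:
  "fox_kernel m (n + 1) ((1 - \<beta>, \<alpha>) # ap) bq \<xi> = Gamma (\<beta> + of_real \<alpha> * \<xi>) * fox_kernel m n ap bq \<xi>"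
  by (simp add: fox_kernel_def mult_ac)

lemma fox_left_poles_extend:
  "fox_left_poles (n + 1) ((1 - \<beta>, \<alpha>) # ap) = {\<xi>. \<beta> + of_real \<alpha> * \<xi> \<in> \<int>\<^sub>\<le>\<^sub>0} \<union> fox_left_poles n ap"
  by (auto simp: fox_left_poles_def)

text \<open>By the functional equation \<Gamma>(\<beta> + \<alpha> \<xi>) is \<Gamma>(\<beta> + 1 +
  \<alpha> \<xi>) divided by \<alpha> (\<xi> - p0), and because \<kappa> vanishes at
  \<open>p0\<close> the quotient \<open>\<kappa> \<xi> / (\<xi> - p0)\<close> extends
  analytically.\<close>

lemma removable_kernel_factor:
  assumes \<alpha>: "\<alpha> > 0" and \<kappa>: "\<kappa> holomorphic_on U" and U: "open U" "p0 \<in> U" and p0: "\<beta> + of_real \<alpha> * p0 = 0" and z: "\<kappa> p0 = 0"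
    and poles: "\<And>\<xi>. \<xi> \<in> U \<Longrightarrow> \<beta> + 1 + of_real \<alpha> * \<xi> \<notin> \<int>\<^sub>\<le>\<^sub>0"
  obtains q where "q holomorphic_on U" "\<And>\<xi>. \<xi> \<in> U \<Longrightarrow> \<xi> \<noteq> p0 \<Longrightarrow> q \<xi> = Gamma (\<beta> + of_real \<alpha> * \<xi>) * \<kappa> \<xi>"
proof -
  define r where "r = (\<lambda>z. if z = p0 then deriv \<kappa> p0 else (\<kappa> z - \<kappa> p0) / (z - p0))"
  have r: "r holomorphic_on U" unfolding r_def using U by (intro pole_lemma \<kappa>) (simp add: interior_open)
  show thesis
  proof (rule that[of "\<lambda>\<xi>. inverse (of_real \<alpha>) * (Gamma (\<beta> + 1 + of_real \<alpha> * \<xi>) * r \<xi>)"])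
    show "(\<lambda>\<xi>. inverse (of_real \<alpha>) * (Gamma (\<beta> + 1 + of_real \<alpha> * \<xi>) * r \<xi>)) holomorphic_on U"
      using poles by (intro holomorphic_intros r) auto
    fix \<xi> assume \<xi>: "\<xi> \<in> U" "\<xi> \<noteq> p0"
    have eq: "\<beta> + of_real \<alpha> * \<xi> = of_real \<alpha> * (\<xi> - p0)" using p0 by (simp add: algebra_simps add_eq_0_iff)
    have n0: "\<beta> + of_real \<alpha> * \<xi> \<noteq> 0" unfolding eq using \<alpha> \<xi> by simp
    have "\<beta> + of_real \<alpha> * \<xi> \<notin> \<int>\<^sub>\<le>\<^sub>0"
    proof
      assume "\<beta> + of_real \<alpha> * \<xi> \<in> \<int>\<^sub>\<le>\<^sub>0"
      then obtain j where j: "\<beta> + of_real \<alpha> * \<xi> = - of_nat j" by (auto elim!: nonpos_Ints_cases')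
      then obtain i where "j = Suc i" using n0 by (cases j) auto
      then have "\<beta> + 1 + of_real \<alpha> * \<xi> = - of_nat i" using j by (simp add: algebra_simps eq_neg_iff_add_eq_0)
      then show False using poles[OF \<xi>(1)] by simp
    qed
    then have "Gamma (\<beta> + of_real \<alpha> * \<xi> + 1) = (\<beta> + of_real \<alpha> * \<xi>) * Gamma (\<beta> + of_real \<alpha> * \<xi>)" by (rule Gamma_plus1)
    then have G: "Gamma (\<beta> + 1 + of_real \<alpha> * \<xi>) = of_real \<alpha> * (\<xi> - p0) * Gamma (\<beta> + of_real \<alpha> * \<xi>)"
      unfolding eq[symmetric] by (simp add: add_ac)
    show "inverse (of_real \<alpha>) * (Gamma (\<beta> + 1 + of_real \<alpha> * \<xi>) * r \<xi>) = Gamma (\<beta> + of_real \<alpha> * \<xi>) * \<kappa> \<xi>"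
      unfolding G r_def using \<alpha> \<xi> z by (simp add: field_simps)
  qed
qed

lemma measurable_vector_derivative:
  fixes L :: "real \<Rightarrow> complex"
  assumes L: "L piecewise_C1_differentiable_on UNIV"
  shows "(\<lambda>s. vector_derivative L (at s)) \<in> borel_measurable borel"
proof -
  obtain E where E: "finite E" "continuous_on (- E) (\<lambda>s. vector_derivative L (at s))"
    using L by (rule piecewise_C1_UNIV_E) blast
  show ?thesis
    by (rule borel_measurable_continuous_countable_exceptions[OF countable_finite[OF E(1)] E(2)])
qed

text \<open>By \<open>half\<close> the poles of the additional factor \<Gamma>(\<beta> + \<alpha>
  \<xi>) lie to the left of \<open>L\<close>, as they do for \<open>L1\<close>. Only
  \<open>p0\<close>, where \<beta> + \<alpha> \<xi> = 0, may lie on \<open>L\<close> itself; by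
  \<open>touch\<close> it is then a removable singularity and need not be separated.\<close>

theorem kernel_contour_shift:
  fixes L L1 :: "real \<Rightarrow> complex"
  assumes \<alpha>: "\<alpha> > 0" and ap: "\<forall>(c, A)\<in>set ap. A > 0" and bq: "\<forall>(b, B)\<in>set bq. B > 0"
    and \<mu>: "Re \<mu> > 0" and v: "norm v < 1" and X: "X \<noteq> 0"
    and L: "fox_contour k m n ap bq L" and L1: "fox_contour k m (n + 1) ((1 - \<beta>, \<alpha>) # ap) bq L1"
    and half: "\<And>s. Re (\<beta> + of_real \<alpha> * L s) \<ge> 0"
    and touch: "\<And>s. \<beta> + of_real \<alpha> * L s = 0 \<Longrightarrow> fox_kernel m n ap bq (L s) = 0"
    and int: "integrable lborel (\<lambda>s. fox_kernel m (n + 1) ((1 - \<beta>, \<alpha>) # ap) bq (L s) *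
          (X powr L s * hyp_F \<gamma> \<mu> v (\<mu> + \<beta> + of_real \<alpha> * L s)) * vector_derivative L (at s))"
    and int1: "integrable lborel (\<lambda>s. fox_kernel m (n + 1) ((1 - \<beta>, \<alpha>) # ap) bq (L1 s) *
          (X powr L1 s * hyp_F \<gamma> \<mu> v (\<mu> + \<beta> + of_real \<alpha> * L1 s)) * vector_derivative L1 (at s))"
  shows "(LINT s|lborel. fox_kernel m (n + 1) ((1 - \<beta>, \<alpha>) # ap) bq (L s) *
          (X powr L s * hyp_F \<gamma> \<mu> v (\<mu> + \<beta> + of_real \<alpha> * L s)) * vector_derivative L (at s)) =
    (LINT s|lborel. fox_kernel m (n + 1) ((1 - \<beta>, \<alpha>) # ap) bq (L1 s) *
          (X powr L1 s * hyp_F \<gamma> \<mu> v (\<mu> + \<beta> + of_real \<alpha> * L1 s)) * vector_derivative L1 (at s))"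
proof -
  define \<kappa> where "\<kappa> = fox_kernel m n ap bq"
  define \<kappa>' where "\<kappa>' = fox_kernel m (n + 1) ((1 - \<beta>, \<alpha>) # ap) bq"
  define H where "H \<xi> = X powr \<xi> * hyp_F \<gamma> \<mu> v (\<mu> + \<beta> + of_real \<alpha> * \<xi>)" for \<xi>
  define p0 where "p0 = - \<beta> / of_real \<alpha>"
  define Q where "Q = fox_right_poles m bq \<union> fox_left_poles n ap"
  have p0: "\<beta> + of_real \<alpha> * z = 0 \<longleftrightarrow> z = p0" for z
    using \<alpha> by (auto simp: p0_def field_simps eq_neg_iff_add_eq_0)
  have \<kappa>': "\<kappa>' \<xi> = Gamma (\<beta> + of_real \<alpha> * \<xi>) * \<kappa> \<xi>" for \<xi>
    unfolding \<kappa>_def \<kappa>'_def by (rule fox_kernel_extend)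
  have Lpc: "L piecewise_C1_differentiable_on UNIV" and ends: "contour_ends k L"
    and Lr: "\<And>z. z \<in> fox_right_poles m bq \<Longrightarrow> has_arg_variation L z (left_variation k - 1)"
    and Ll: "\<And>z. z \<in> fox_left_poles n ap \<Longrightarrow> has_arg_variation L z (left_variation k)"
    using L by (auto simp: fox_contour_def right_of_def left_of_def)
  have L1pc: "L1 piecewise_C1_differentiable_on UNIV" and ends1: "contour_ends k L1"
    and L1r: "\<And>z. z \<in> fox_right_poles m bq \<Longrightarrow> has_arg_variation L1 z (left_variation k - 1)"
    and L1l: "\<And>z. z \<in> fox_left_poles n ap \<Longrightarrow> has_arg_variation L1 z (left_variation k)"
    and L1p: "\<And>z. \<beta> + of_real \<alpha> * z \<in> \<int>\<^sub>\<le>\<^sub>0 \<Longrightarrow> has_arg_variation L1 z (left_variation k)"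
    using L1 unfolding fox_contour_def right_of_def left_of_def fox_left_poles_extend by auto
  \<comment> \<open>\<open>half\<close> bounds \<open>Re (L s)\<close> from below, which a left loop
    violates.\<close>
  have k: "k \<noteq> Left_Loop"
  proof
    assume "k = Left_Loop"
    then have "filterlim (\<lambda>s. Re (L s)) at_bot at_top" using ends by (simp add: o_def)
    then have "eventually (\<lambda>s. Re (L s) < - Re \<beta> / \<alpha>) at_top"
      unfolding filterlim_at_bot_dense by blast
    then obtain s where "Re (L s) < - Re \<beta> / \<alpha>" by (auto dest: eventually_happens)
    then show False using half[of s] \<alpha> by (simp add: field_simps)
  qed
  have var: "\<exists>v. has_arg_variation L p v \<and> has_arg_variation L1 p v"
    if "p \<in> Q \<or> \<beta> + of_real \<alpha> * p \<in> \<int>\<^sub>\<le>\<^sub>0 \<and> p \<notin> range L" for p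
  proof (cases "p \<in> Q")
    case True
    then show ?thesis using Lr Ll L1r L1l unfolding Q_def by blast
  next
    case False
    then have p: "\<beta> + of_real \<alpha> * p \<in> \<int>\<^sub>\<le>\<^sub>0" "p \<notin> range L" using that by auto
    have "Re (\<beta> + of_real \<alpha> * p) \<le> 0" using p(1) Re_pos_not_nonpos_Int by (metis not_le)
    then have "\<alpha> * Re p \<le> \<alpha> * Re (L s)" for s using half[of s] by simp
    then have "Re p \<le> Re (L s)" for s using \<alpha> by simp
    then have "has_arg_variation L p (left_variation k)" by (rule half_plane_has_arg_variation[OF Lpc ends k p(2)])
    then show ?thesis using L1p[OF p(1)] by blast
  qed
  have clQ: "closed Q" unfolding Q_def using closed_fox_left_poles closed_fox_right_poles by blast
  have \<kappa>h: "\<kappa> holomorphic_on - Q" unfolding \<kappa>_def Q_def by (rule fox_kernel_holomorphic) auto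
  have Hh: "H holomorphic_on A" for A
    unfolding H_def[abs_def] using X
    by (intro holomorphic_intros holomorphic_on_compose_gen[OF _ hyp_F_holomorphic[OF \<mu> v], unfolded o_def]) auto
  \<comment> \<open>If \<open>p0\<close> lies on \<open>L\<close>, then \<open>g\<close> is the
    analytic continuation of \<open>\<kappa>' * H\<close> across \<open>p0\<close> and
    \<open>P\<close> omits this point. Otherwise \<open>P\<close> contains all the singularities and
    \<open>g\<close> is the product itself.\<close>
  have "\<exists>P g. closed P \<and> g holomorphic_on - P \<and> P \<subseteq> Q \<union> {\<xi>. \<beta> + of_real \<alpha> * \<xi> \<in> \<int>\<^sub>\<le>\<^sub>0} \<and> P \<inter> range L = {} \<and>
      (\<forall>\<xi>\<in>-P. \<xi> \<noteq> p0 \<longrightarrow> g \<xi> = \<kappa>' \<xi> * H \<xi>) \<and> (p0 \<notin> P \<longrightarrow> p0 \<in> range L \<and> \<kappa> p0 = 0)"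
  proof (cases "p0 \<in> range L")
    case False
    let ?P = "Q \<union> {\<xi>. \<beta> + of_real \<alpha> * \<xi> \<in> \<int>\<^sub>\<le>\<^sub>0}"
    have "range L \<inter> ?P = {}"
    proof (rule ccontr)
      assume "range L \<inter> ?P \<noteq> {}"
      then obtain s where s: "L s \<in> ?P" by blast
      have "L s \<notin> Q" using Lr Ll unfolding Q_def has_arg_variation_def by blast
      then obtain j where j: "\<beta> + of_real \<alpha> * L s = - of_nat j" using s by (auto elim!: nonpos_Ints_cases')
      then have "j = 0" using half[of s] by simp
      then show False using j p0[of "L s"] False by auto
    qed
    moreover have "(\<lambda>\<xi>. \<kappa>' \<xi> * H \<xi>) holomorphic_on - ?P"
      unfolding \<kappa>' by (intro holomorphic_intros Hh holomorphic_on_subset[OF \<kappa>h]) auto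
    moreover have "closed ?P" using clQ closed_affine_nonpos_Ints[of \<beta> \<alpha>] by blast
    moreover have "p0 \<in> ?P" using p0[of p0] by simp
    ultimately show ?thesis by (intro exI[of _ ?P] exI[of _ "\<lambda>\<xi>. \<kappa>' \<xi> * H \<xi>"]) auto
  next
    case True
    let ?P = "Q \<union> {\<xi>. (\<beta> + 1) + of_real \<alpha> * \<xi> \<in> \<int>\<^sub>\<le>\<^sub>0}"
    have z: "\<kappa> p0 = 0" using True touch p0 unfolding \<kappa>_def by blast
    have disj: "range L \<inter> ?P = {}"
    proof (rule ccontr)
      assume "range L \<inter> ?P \<noteq> {}"
      then obtain s where s: "L s \<in> ?P" by blast
      have "L s \<notin> Q" using Lr Ll unfolding Q_def has_arg_variation_def by blast
      then have "\<beta> + 1 + of_real \<alpha> * L s \<in> \<int>\<^sub>\<le>\<^sub>0" using s by blast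
      moreover have "Re (\<beta> + 1 + of_real \<alpha> * L s) > 0" using half[of s] by simp
      ultimately show False using Re_pos_not_nonpos_Int by blast
    qed
    have cl: "closed ?P" using clQ closed_affine_nonpos_Ints[of "\<beta> + 1" \<alpha>] by blast
    have p0P: "p0 \<in> - ?P" using disj True by blast
    have "\<kappa> holomorphic_on - ?P" by (rule holomorphic_on_subset[OF \<kappa>h]) auto
    then obtain q where q: "q holomorphic_on - ?P" "\<And>\<xi>. \<xi> \<in> - ?P \<Longrightarrow> \<xi> \<noteq> p0 \<Longrightarrow> q \<xi> = Gamma (\<beta> + of_real \<alpha> * \<xi>) * \<kappa> \<xi>"
      by (rule removable_kernel_factor[OF \<alpha> _ open_Compl[OF cl] p0P, of \<kappa> \<beta>]) (use p0 z in auto)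
    have sub: "\<beta> + of_real \<alpha> * \<xi> \<in> \<int>\<^sub>\<le>\<^sub>0" if "\<beta> + 1 + of_real \<alpha> * \<xi> \<in> \<int>\<^sub>\<le>\<^sub>0" for \<xi>
    proof -
      obtain j where "\<beta> + 1 + of_real \<alpha> * \<xi> = - of_nat j" using \<open>\<beta> + 1 + of_real \<alpha> * \<xi> \<in> \<int>\<^sub>\<le>\<^sub>0\<close> by (rule nonpos_Ints_cases')
      then have "\<beta> + of_real \<alpha> * \<xi> = - of_nat (Suc j)" by (simp add: algebra_simps eq_neg_iff_add_eq_0)
      then show ?thesis by (metis minus_of_nat_in_nonpos_Ints)
    qed
    show ?thesis
      using cl disj sub z True
      by (intro exI[of _ ?P] exI[of _ "\<lambda>\<xi>. q \<xi> * H \<xi>"] conjI holomorphic_intros q(1) Hh) (auto simp: q(2) \<kappa>')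
  qed
  then obtain P g where P: "closed P" "P \<subseteq> Q \<union> {\<xi>. \<beta> + of_real \<alpha> * \<xi> \<in> \<int>\<^sub>\<le>\<^sub>0}" "P \<inter> range L = {}" and g: "g holomorphic_on - P"
    and geq: "\<And>\<xi>. \<xi> \<notin> P \<Longrightarrow> \<xi> \<noteq> p0 \<Longrightarrow> g \<xi> = \<kappa>' \<xi> * H \<xi>" by blast
  have L1avoid: "L1 s \<notin> Q \<union> {\<xi>. \<beta> + of_real \<alpha> * \<xi> \<in> \<int>\<^sub>\<le>\<^sub>0}" for s
    using L1r L1l L1p unfolding Q_def has_arg_variation_def by blast
  have L1P: "L1 s \<notin> P" "L1 s \<noteq> p0" for s
    using L1avoid[of s] P(2) p0[of "L1 s"] by auto
  have i1: "(\<lambda>s. \<kappa>' (L1 s) * H (L1 s) * vector_derivative L1 (at s)) = (\<lambda>s. g (L1 s) * vector_derivative L1 (at s))"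
    using geq L1P by simp
  \<comment> \<open>At \<open>p0\<close> the value of \<open>\<kappa>'\<close> is 0, by the
    convention \<open>Gamma 0 = 0\<close>, and may differ from what the continuation
    \<open>g\<close> prescribes. On this level set the derivative of \<open>L\<close> vanishes
    almost everywhere.\<close>
  have ae: "AE s in lborel. \<kappa>' (L s) * H (L s) * vector_derivative L (at s) = g (L s) * vector_derivative L (at s)"
    using AE_level_set_derivative_zero[OF Lpc, of p0]
  proof eventually_elim
    case (elim s)
    have "L s \<notin> P" using P(3) by blast
    then show ?case using elim geq[of "L s"] by (cases "L s = p0") auto
  qed
  have contL: "continuous_on UNIV L" using Lpc by (auto simp: piecewise_C1_differentiable_on_def)
  have "continuous_on UNIV (\<lambda>s. g (L s))"
    using continuous_on_compose2[OF holomorphic_on_imp_continuous_on[OF g] contL] P(3) by blast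
  then have gm: "(\<lambda>s. g (L s) * vector_derivative L (at s)) \<in> borel_measurable lborel"
    using measurable_vector_derivative[OF Lpc] by (intro borel_measurable_times) (auto intro: borel_measurable_continuous_onI)
  have km: "(\<lambda>s. \<kappa>' (L s) * H (L s) * vector_derivative L (at s)) \<in> borel_measurable lborel"
    using borel_measurable_integrable[OF int] by (simp add: \<kappa>'_def H_def)
  have gint: "integrable lborel (\<lambda>s. g (L s) * vector_derivative L (at s))"
    using integrable_cong_AE[OF km gm ae] int by (simp add: \<kappa>'_def H_def)
  have gint1: "integrable lborel (\<lambda>s. g (L1 s) * vector_derivative L1 (at s))"
    using int1 unfolding i1[symmetric] by (simp add: \<kappa>'_def H_def)
  have pvar: "\<exists>v. has_arg_variation L p v \<and> has_arg_variation L1 p v" if "p \<in> P" for p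
    using var[of p] that P by blast
  have pos': "\<forall>(c, A)\<in>set ((1 - \<beta>, \<alpha>) # ap). A > 0" using ap \<alpha> by auto
  have Psub: "P \<subseteq> fox_right_poles m bq \<union> fox_left_poles (n + 1) ((1 - \<beta>, \<alpha>) # ap)"
    using P(2) unfolding Q_def fox_left_poles_extend by blast
  have p0cell: "\<exists>R. \<forall>r\<ge>R. p0 \<notin> cell e K r \<delta>" if "norm e = 1" for e K \<delta>
    using cell_norm(1)[of p0 e K _ \<delta>] that by (intro exI[of _ "norm p0 + 1"]) fastforce
  have cmpH: "comparable_ex G e K \<delta> H" if "e = \<i> \<or> e = - \<i> \<or> e = 1" "K \<ge> 0" "\<delta> \<ge> 0" for G e K \<delta>
  proof -
    have "norm e = 1" using that by auto
    then have "comparable_ex G e K \<delta> (\<lambda>z. X powr z)" using comparable_powr[of e X] X unfolding comparable_ex_def by blast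
    moreover have "comparable_ex G e K \<delta> (\<lambda>z. hyp_F \<gamma> \<mu> v (\<mu> + \<beta> + of_real \<alpha> * z))"
      using that \<alpha> by (intro comparable_ex_hyp_F \<mu> v) auto
    ultimately show ?thesis unfolding H_def[abs_def] by (rule comparable_ex_mult)
  qed
  have "(LINT s|lborel. g (L s) * vector_derivative L (at s)) = (LINT s|lborel. g (L1 s) * vector_derivative L1 (at s))"
  proof (cases k)
    case Vertical
    obtain Y where Y: "\<And>\<xi>. \<xi> \<in> P \<Longrightarrow> \<bar>Im \<xi>\<bar> \<le> Y"
      using fox_poles_Im_bounded[OF pos' bq, of m "n + 1"] Psub by blast
    show ?thesis
    proof (rule contour_integral_deform_vertical[OF Lpc L1pc _ _ P(1) g pvar gint gint1])
      show "contour_ends Vertical L" "contour_ends Vertical L1" using ends ends1 Vertical by auto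
      show "\<exists>Y. \<forall>p\<in>P. \<bar>Re p\<bar> \<le> K \<longrightarrow> \<bar>Im p\<bar> \<le> Y" for K using Y by blast
      show "\<exists>C\<ge>0. \<exists>Y. \<forall>r\<ge>Y. good_cell g P \<i> K C 1 r \<and> good_cell g P (-\<i>) K C 1 r" for K
      proof -
        define K' where "K' = max K 0"
        have one: "\<exists>C\<ge>0. \<exists>Y. \<forall>r\<ge>Y. good_cell g P e K' C 1 r" if e: "e = \<i> \<or> e = - \<i>" for e
        proof -
          have "comparable_ex UNIV e K' 1 (\<lambda>\<xi>. \<kappa>' \<xi> * H \<xi>)"
            unfolding \<kappa>'_def using e by (intro comparable_ex_mult comparable_ex_fox_kernel_vertical pos' bq cmpH) (auto simp: K'_def)
          then obtain C R where C: "C \<ge> 0" and R: "\<And>r z z0 z1. r \<in> UNIV \<Longrightarrow> r \<ge> R \<Longrightarrow> z0 \<in> cell e K' r 1 \<Longrightarrow> z1 \<in> cell e K' r 1 \<Longrightarrow>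
             z \<in> closed_segment z0 z1 \<Longrightarrow> norm (\<kappa>' z * H z) \<le> C * max (norm (\<kappa>' z0 * H z0)) (norm (\<kappa>' z1 * H z1))"
            by (rule comparable_ex_good_cell) (rule that)
          have "norm e = 1" using e by auto
          from p0cell[OF this, of K' 1] obtain R0 where R0: "\<And>r. r \<ge> R0 \<Longrightarrow> p0 \<notin> cell e K' r 1" by blast
          have "good_cell g P e K' C 1 r" if r: "r \<ge> Max {R, R0, Y + 1, 1}" for r
          proof -
            have r': "r \<ge> R" "r \<ge> R0" "r > Y" "r \<ge> 1" using r by auto
            have np: "z \<notin> P" if "z \<in> cell e K' r 1" for z
            proof -
              have "\<bar>Im z\<bar> \<ge> r" using that e r' by (auto simp: cell_def)
              then show ?thesis using Y[of z] r' by force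
            qed
            have eq: "g z = \<kappa>' z * H z" if "z \<in> cell e K' r 1" for z
              using geq[of z] np[OF that] R0[OF r'(2)] that by blast
            show ?thesis
              unfolding good_cell_def
            proof (intro conjI ballI)
              show "cell e K' r 1 \<inter> P = {}" using np by blast
              fix z0 z1 z assume z: "z0 \<in> cell e K' r 1" "z1 \<in> cell e K' r 1" "z \<in> closed_segment z0 z1"
              have "z \<in> cell e K' r 1" using closed_segment_subset[OF z(1,2) convex_cell] z(3) by blast
              then show "norm (g z) \<le> C * max (norm (g z0)) (norm (g z1))"
                using R[OF UNIV_I r'(1) z] eq z by simp
            qed
          qed
          then show ?thesis using C by blast
        qed
        obtain C1 Y1 C2 Y2 where CY: "C1 \<ge> 0" "\<And>r. r \<ge> Y1 \<Longrightarrow> good_cell g P \<i> K' C1 1 r" "C2 \<ge> 0" "\<And>r. r \<ge> Y2 \<Longrightarrow> good_cell g P (-\<i>) K' C2 1 r"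
          using one[of \<i>] one[of "-\<i>"] by blast
        have up: "good_cell g P e K C 1 r" if "good_cell g P e K' C' 1 r" "C' \<le> C" for e C C' r
        proof -
          have "good_cell g P e K' C 1 r"
            using that mult_right_mono[OF that(2)] unfolding good_cell_def
            by (metis (no_types, lifting) le_max_iff_disj norm_ge_zero order_trans)
          then show ?thesis by (rule good_cell_mono) (simp add: K'_def)
        qed
        show ?thesis
          by (rule exI[of _ "max C1 C2"], rule conjI[rotated], rule exI[of _ "max Y1 Y2"])
            (use CY up[OF CY(2), of _ "max C1 C2"] up[OF CY(4), of _ "max C1 C2"] in auto)
      qed
    qed
  next
    case Right_Loop
    show ?thesis
    proof (rule contour_integral_deform_right[OF Lpc L1pc _ _ P(1) g pvar gint gint1])
      show "contour_ends Right_Loop L" "contour_ends Right_Loop L1" using ends ends1 Right_Loop by auto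
      show "\<exists>C\<ge>0. \<exists>\<delta>>0. \<forall>R. \<exists>r\<ge>R. good_cell g P 1 K C \<delta> r" for K
      proof -
        define K' where "K' = max K 0"
        have K': "K' \<ge> 0" "K \<le> K'" by (auto simp: K'_def)
        obtain G \<delta> where \<delta>: "\<delta> > 0" and G: "\<And>R. \<exists>r\<ge>R. r \<in> G" and cmp: "comparable_ex G 1 K' \<delta> \<kappa>'"
          and cell: "\<And>r. r \<in> G \<Longrightarrow> cell 1 K' r \<delta> \<inter> fox_right_poles m bq = {}"
          by (rule comparable_ex_fox_kernel_right[OF pos' bq K'(1), where m = m and n = "n + 1", folded \<kappa>'_def]) (rule that)
        have "comparable_ex G 1 K' \<delta> (\<lambda>\<xi>. \<kappa>' \<xi> * H \<xi>)"
          by (intro comparable_ex_mult cmp cmpH) (use K' \<delta> in auto)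
        then obtain C R where C: "C \<ge> 0" and R: "\<And>r z z0 z1. r \<in> G \<Longrightarrow> r \<ge> R \<Longrightarrow> z0 \<in> cell 1 K' r \<delta> \<Longrightarrow> z1 \<in> cell 1 K' r \<delta> \<Longrightarrow>
           z \<in> closed_segment z0 z1 \<Longrightarrow> norm (\<kappa>' z * H z) \<le> C * max (norm (\<kappa>' z0 * H z0)) (norm (\<kappa>' z1 * H z1))"
          by (rule comparable_ex_good_cell) (rule that)
        obtain R0 where R0: "\<And>r. r \<ge> R0 \<Longrightarrow> p0 \<notin> cell 1 K' r \<delta>" using p0cell[OF norm_one, of K' \<delta>] by blast
        obtain R1 where R1: "\<And>\<xi>. \<xi> \<in> fox_left_poles (n + 1) ((1 - \<beta>, \<alpha>) # ap) \<Longrightarrow> Re \<xi> \<le> R1"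
          using fox_left_poles_Re_bounded[OF pos', of "n + 1"] by blast
        have "good_cell g P 1 K' C \<delta> r" if r: "r \<ge> Max {R, R0, R1 + 1}" "r \<in> G" for r
        proof -
          have r': "r \<ge> R" "r \<ge> R0" "r > R1" using r by auto
          have np: "z \<notin> P" if z: "z \<in> cell 1 K' r \<delta>" for z
          proof
            assume "z \<in> P"
            then have "z \<in> fox_right_poles m bq \<or> Re z \<le> R1" using Psub R1 by blast
            then show False using z cell[OF r(2)] r' by (auto simp: cell_one)
          qed
          have eq: "g z = \<kappa>' z * H z" if "z \<in> cell 1 K' r \<delta>" for z
            using geq[of z] np[OF that] R0[OF r'(2)] that by blast
          show ?thesis
            unfolding good_cell_def
          proof (intro conjI ballI)
            show "cell 1 K' r \<delta> \<inter> P = {}" using np by blast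
            fix z0 z1 z assume z: "z0 \<in> cell 1 K' r \<delta>" "z1 \<in> cell 1 K' r \<delta>" "z \<in> closed_segment z0 z1"
            have "z \<in> cell 1 K' r \<delta>" using closed_segment_subset[OF z(1,2) convex_cell] z(3) by blast
            then show "norm (g z) \<le> C * max (norm (g z0)) (norm (g z1))"
              using R[OF r(2) r'(1) z] eq z by simp
          qed
        qed
        then have gc: "good_cell g P 1 K C \<delta> r" if "r \<ge> Max {R, R0, R1 + 1}" "r \<in> G" for r
          using good_cell_mono[OF _ K'(2)] that by blast
        have "\<exists>r\<ge>R'. good_cell g P 1 K C \<delta> r" for R'
        proof -
          obtain r where "r \<ge> max R' (Max {R, R0, R1 + 1})" "r \<in> G" using G by blast
          then show ?thesis using gc[of r] by (intro exI[of _ r]) simp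
        qed
        then show ?thesis using C \<delta> by blast
      qed
    qed
  qed (use k in simp)
  moreover have "(LINT s|lborel. g (L s) * vector_derivative L (at s)) = (LINT s|lborel. \<kappa>' (L s) * H (L s) * vector_derivative L (at s))"
    using integral_cong_AE[OF km gm ae] by simp
  ultimately show ?thesis unfolding i1[symmetric] by (simp add: \<kappa>'_def H_def)
qed

section \<open>Integrability determines the position of the contour\<close>

text \<open>\<open>(L b - p) / (L a - p)\<close> is the exponential of the integral of
  \<open>L' / (L - p)\<close> over the interval, and this integrand is bounded by \<open>M\<close>
  almost everywhere.\<close>

lemma path_ratio_le:
  fixes L :: "real \<Rightarrow> complex"
  assumes L: "L piecewise_C1_differentiable_on UNIV" and ab: "a \<le> b" and p: "p \<notin> L ` {a..b}"
    and M: "integrable lborel M" "\<And>s. M s \<ge> 0"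
    and le: "AE s in lborel. s \<in> {a..b} \<longrightarrow> norm (vector_derivative L (at s)) \<le> M s * norm (L s - p)"
  shows "norm (L a - p) \<le> exp (integral\<^sup>L lborel M) * norm (L b - p)"
    "norm (L b - p) \<le> exp (integral\<^sup>L lborel M) * norm (L a - p)"
proof -
  let ?f = "\<lambda>s. vector_derivative L (at s) / (L s - p)"
  have fi: "?f integrable_on {a..b}"
    and ex: "exp (- (integral {a..b} ?f)) * (L b - p) = L a - p"
    using winding_number_exp_integral[OF piecewise_C1_differentiable_on_subset[OF L] ab p] by auto
  have si: "set_integrable lborel {a..b} M"
    using set_integrable_subset[of lborel UNIV M "{a..b}"] M(1) by (simp add: set_integrable_def)
  have mi: "(M has_integral (LINT s:{a..b}|lborel. M s)) {a..b}"
    using set_borel_integral_eq_integral[OF si] by (simp add: has_integral_integral)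
  obtain N where N: "N \<in> null_sets lborel" "{s. \<not> (s \<in> {a..b} \<longrightarrow> norm (vector_derivative L (at s)) \<le> M s * norm (L s - p))} \<subseteq> N"
    using le by (auto simp: eventually_ae_filter)
  have neg: "negligible N" using N(1) by (simp add: negligible_iff_null_sets null_sets_completionI)
  have "norm (integral {a..b} ?f) \<le> (LINT s:{a..b}|lborel. M s)"
  proof -
    define f' where "f' s = (if s \<in> N then 0 else ?f s)" for s
    have f': "(f' has_integral integral {a..b} ?f) {a..b}"
      by (rule has_integral_spike[OF neg _ integrable_integral[OF fi]]) (auto simp: f'_def)
    have "norm (integral {a..b} f') \<le> integral {a..b} M"
    proof (rule integral_norm_bound_integral)
      show "f' integrable_on {a..b}" "M integrable_on {a..b}" using f' mi by (auto simp: integrable_on_def)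
      fix s assume s: "s \<in> {a..b}"
      then have "L s \<noteq> p" using p by auto
      then show "norm (f' s) \<le> M s"
        using N(2) s M(2)[of s] by (auto simp: f'_def norm_divide field_simps)
    qed
    then show ?thesis using f' mi by (simp add: integral_unique)
  qed
  also have "\<dots> \<le> integral\<^sup>L lborel M"
    unfolding set_lebesgue_integral_def
    by (rule integral_mono) (use si M in \<open>auto simp: set_integrable_def indicator_def\<close>)
  finally have n: "norm (integral {a..b} ?f) \<le> integral\<^sup>L lborel M" .
  have "norm (L a - p) = exp (- Re (integral {a..b} ?f)) * norm (L b - p)"
    unfolding ex[symmetric] by (simp add: norm_mult)
  moreover have "\<bar>Re (integral {a..b} ?f)\<bar> \<le> integral\<^sup>L lborel M" using n abs_Re_le_cmod order_trans by blast
  ultimately show "norm (L a - p) \<le> exp (integral\<^sup>L lborel M) * norm (L b - p)"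
    by (auto intro!: mult_right_mono)
  have "norm (L b - p) = exp (Re (integral {a..b} ?f)) * norm (L a - p)"
    using \<open>norm (L a - p) = _\<close> by (simp add: mult.assoc[symmetric] flip: exp_add)
  then show "norm (L b - p) \<le> exp (integral\<^sup>L lborel M) * norm (L a - p)"
    using \<open>\<bar>_\<bar> \<le> _\<close> by (auto intro!: mult_right_mono)
qed

text \<open>Gronwall's inequality for \<open>norm (L s - p)\<close>, with a merely integrable coefficient.\<close>

lemma path_locally_constant:
  fixes L :: "real \<Rightarrow> complex"
  assumes L: "L piecewise_C1_differentiable_on UNIV" and p: "L s0 = p"
    and M: "integrable lborel M" "\<And>s. M s \<ge> 0"
    and le: "AE s in lborel. \<bar>s - s0\<bar> < \<epsilon> \<longrightarrow> norm (vector_derivative L (at s)) \<le> M s * norm (L s - p)"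
    and s: "\<bar>s - s0\<bar> < \<epsilon>"
  shows "L s = p"
proof (rule ccontr)
  assume ne: "L s \<noteq> p"
  have cont: "continuous_on A L" for A
    using L continuous_on_subset by (auto simp: piecewise_C1_differentiable_on_def)
  \<comment> \<open>\<open>t0\<close> will be the point of this level set nearest to
    \<open>s\<close>. Between \<open>t0\<close> and \<open>s\<close> the value \<open>p\<close> is
    not attained, so the ratio bound keeps the distance from \<open>p\<close> bounded below right up
    to \<open>t0\<close>, against continuity.\<close>
  define B where "B = {t \<in> closed_segment s0 s. L t = p}"
  have "closed B" unfolding B_def by (rule continuous_closed_preimage_constant[OF cont]) auto
  moreover have "B \<subseteq> closed_segment s0 s" by (auto simp: B_def)
  ultimately have cB: "compact B" using compact_Int_closed[of "closed_segment s0 s" B] by (simp add: inf.absorb2)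
  have "s0 \<in> B" using p by (simp add: B_def)
  then obtain t0 where t0: "t0 \<in> B" "\<And>t. t \<in> B \<Longrightarrow> dist s t0 \<le> dist s t"
    using continuous_attains_inf[OF cB _ continuous_on_dist[OF continuous_on_const continuous_on_id], of s] by auto
  have st0: "t0 \<noteq> s" "L t0 = p" using t0 ne by (auto simp: B_def)
  define E where "E = exp (integral\<^sup>L lborel M)"
  have key: "norm (L s - p) \<le> E * norm (L t - p)" if t: "t \<in> open_segment t0 s" for t
  proof -
    have sub: "closed_segment t s \<subseteq> closed_segment s0 s" "\<forall>y\<in>closed_segment t s. dist s y < dist s t0"
      using t t0(1) st0 by (auto simp: B_def closed_segment_eq_real_ivl open_segment_eq_real_ivl dist_real_def split: if_splits)
    have np: "p \<notin> L ` closed_segment t s"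
    proof
      assume "p \<in> L ` closed_segment t s"
      then obtain y where y: "y \<in> closed_segment t s" "L y = p" by auto
      then have "y \<in> B" using sub by (auto simp: B_def)
      from t0(2)[OF this] sub y show False by fastforce
    qed
    have near: "\<bar>y - s0\<bar> < \<epsilon>" if "y \<in> closed_segment t s" for y
      using sub(1) that s by (auto simp: closed_segment_eq_real_ivl split: if_splits)
    have le': "AE y in lborel. y \<in> closed_segment t s \<longrightarrow> norm (vector_derivative L (at y)) \<le> M y * norm (L y - p)"
      using le by eventually_elim (use near in blast)
    show ?thesis
    proof (cases "t \<le> s")
      case True
      then show ?thesis using path_ratio_le(2)[OF L True _ M] np le' by (simp add: closed_segment_eq_real_ivl E_def)
    next
      case False
      then show ?thesis using path_ratio_le(1)[OF L _ _ M, of s t p] np le' by (simp add: closed_segment_eq_real_ivl E_def)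
    qed
  qed
  have E: "E > 0" by (simp add: E_def)
  have "isCont L t0" using cont[of UNIV] by (simp add: continuous_on_eq_continuous_at)
  then obtain d where d: "d > 0" "\<And>t. dist t t0 < d \<Longrightarrow> dist (L t) (L t0) < norm (L s - p) / E"
    using ne E unfolding continuous_at_eps_delta by (metis divide_pos_pos zero_less_norm_iff right_minus_eq)
  define u where "u = min (1 / 2) (d / (2 * \<bar>s - t0\<bar>))"
  have u: "0 < u" "u < 1" "u * \<bar>s - t0\<bar> < d"
  proof -
    have pos: "\<bar>s - t0\<bar> > 0" using st0 by simp
    show "0 < u" "u < 1" using d pos by (auto simp: u_def)
    have "u * \<bar>s - t0\<bar> \<le> d / (2 * \<bar>s - t0\<bar>) * \<bar>s - t0\<bar>" by (intro mult_right_mono) (auto simp: u_def)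
    also have "\<dots> < d" using pos d by (simp add: field_simps)
    finally show "u * \<bar>s - t0\<bar> < d" .
  qed
  define t where "t = (1 - u) *\<^sub>R t0 + u *\<^sub>R s"
  have "t \<in> open_segment t0 s" using u st0 by (auto simp: in_segment t_def)
  moreover have "dist t t0 < d"
  proof -
    have "t - t0 = u * (s - t0)" by (simp add: t_def algebra_simps)
    then show ?thesis using u by (simp add: dist_real_def abs_mult)
  qed
  ultimately have "norm (L s - p) \<le> E * norm (L t - p)" "norm (L t - p) < norm (L s - p) / E"
    using key d(2)[of t] st0 by (auto simp: dist_norm)
  then show False using E by (simp add: field_simps)
qed

lemma contour_ends_not_constant: "contour_ends k L \<Longrightarrow> \<not> (\<forall>s. L s = p)"
proof
  assume k: "contour_ends k L" and c: "\<forall>s. L s = p"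
  have 1: "\<not> filterlim (\<lambda>s. y) at_top (at_top :: real filter)" "\<not> filterlim (\<lambda>s. y) at_bot (at_top :: real filter)" for y :: real
    by (auto simp: filterlim_at_top_dense filterlim_at_bot_dense intro: exI[of _ y])
  show False using k c 1 by (cases k) (auto simp: o_def)
qed

text \<open>The line is connected, so a nonempty level set that is open as well as closed is
  everything, whereas a contour escapes to infinity.\<close>

lemma path_level_set_clopen:
  fixes L :: "real \<Rightarrow> complex"
  assumes L: "L piecewise_C1_differentiable_on UNIV" "contour_ends k L" and s0: "L s0 = p"
    and loc: "\<And>s. L s = p \<Longrightarrow> \<exists>\<epsilon>>0. \<forall>t. \<bar>t - s\<bar> < \<epsilon> \<longrightarrow> L t = p"
  shows False
proof -
  have cont: "continuous_on UNIV L" using L by (auto simp: piecewise_C1_differentiable_on_def)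
  let ?S = "{s. L s = p}"
  have "closed ?S" using continuous_closed_preimage_constant[OF cont] by simp
  moreover have "open ?S" unfolding open_dist using loc by (auto simp: dist_real_def)
  ultimately have "?S = {} \<or> ?S = UNIV" using clopen[of ?S] by blast
  then show False using s0 contour_ends_not_constant[OF L(2), of p] by auto
qed

text \<open>
  As the contour approaches the line \<open>Re b = 0\<close>, the Euler integral blows up at least like
  \<open>1 / Re b\<close>; together with the preceding bound this keeps the contour off the pole.
\<close>

lemma power_singularity_lower_bound:
  assumes ux: "u < x" and u0: "u \<noteq> 0" and same: "\<And>t. u < t \<Longrightarrow> t < x \<Longrightarrow> t \<noteq> 0"
  obtains c where "c > 0"
    "\<And>b \<epsilon>. integrable lborel (\<lambda>t. indicator {u<..<x} t * (of_real t powr \<gamma> * of_real (x - t) powr (\<mu> - 1) * of_real (t - u) powr (b - 1))) \<Longrightarrow>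
       0 < \<epsilon> \<Longrightarrow> \<epsilon> \<le> 1 \<Longrightarrow> Re b \<le> \<epsilon> \<Longrightarrow>
       c / \<epsilon> \<le> (LINT t|lborel. norm (indicator {u<..<x} t * (of_real t powr \<gamma> * of_real (x - t) powr (\<mu> - 1) * of_real (t - u) powr (b - 1))))"
proof -
  \<comment> \<open>\<open>h \<le> 1\<close> makes the powers of \<open>t - u\<close> decrease in
    the exponent, and \<open>u + h < x\<close> stays away from the singularity at \<open>x\<close>.
    With \<open>u \<noteq> 0\<close> the remaining factor is continuous in norm and nonzero on the
    compact interval.\<close>
  define h where "h = min 1 ((x - u) / 2)"
  have h: "0 < h" "h \<le> 1" "u + h < x" using ux by (auto simp: h_def min_def field_simps)
  define \<rho> where "\<rho> t = norm (complex_of_real t powr \<gamma> * of_real (x - t) powr (\<mu> - 1))" for t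
  have nz: "t \<noteq> 0" "x - t > 0" if "t \<in> {u..u+h}" for t
    using that h u0 same[of t] by (cases "t = u", auto)
  have "continuous_on {u..u+h} \<rho>"
  proof -
    have c1: "continuous_on {u..u+h} (\<lambda>t. complex_of_real (x - t) powr (\<mu> - 1))"
      using h by (intro continuous_intros continuous_on_powr_complex) (auto simp: complex_nonpos_Reals_iff)
    have c2: "continuous_on {u..u+h} (\<lambda>t. norm (complex_of_real t powr \<gamma>))"
    proof (cases "u > 0")
      case True
      then show ?thesis by (intro continuous_intros continuous_on_powr_complex) (auto simp: complex_nonpos_Reals_iff)
    next
      case False
      then have neg: "t < 0" if "t \<in> {u..u+h}" for t
      proof -
        have "u < 0" using False u0 by simp
        have "\<not> t \<ge> 0"
        proof
          assume "t \<ge> 0"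
          then have "0 \<in> {u..u+h}" using that \<open>u < 0\<close> by auto
          then show False using nz(1)[of 0] by simp
        qed
        then show ?thesis by simp
      qed
      have "continuous_on {u..u+h} (\<lambda>t. norm (exp (\<gamma> * (complex_of_real (ln (- t)) + \<i> * of_real pi))))"
        using neg by (intro continuous_intros) fastforce+
      then show ?thesis
        by (rule continuous_on_eq) (use neg in \<open>force simp: powr_of_real_cases\<close>)
    qed
    show ?thesis unfolding \<rho>_def norm_mult by (intro continuous_intros c1 c2)
  qed
  then obtain t1 where t1: "t1 \<in> {u..u+h}" "\<And>t. t \<in> {u..u+h} \<Longrightarrow> \<rho> t1 \<le> \<rho> t"
    using continuous_attains_inf[of "{u..u+h}" \<rho>] h by auto
  have \<rho>1: "\<rho> t1 > 0" using nz[OF t1(1)] by (auto simp: \<rho>_def norm_mult)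
  show thesis
  proof (rule that[of "\<rho> t1 * h"])
    show "\<rho> t1 * h > 0" using \<rho>1 h by simp
    fix b \<epsilon> let ?f = "\<lambda>t. indicator {u<..<x} t * (of_real t powr \<gamma> * of_real (x - t) powr (\<mu> - 1) * of_real (t - u) powr (b - 1))"
    assume int: "integrable lborel ?f" and \<epsilon>: "0 < \<epsilon>" "\<epsilon> \<le> 1" "Re b \<le> \<epsilon>"
    \<comment> \<open>Since \<open>\<epsilon> \<le> 1\<close> and \<open>h \<le> 1\<close>, the
      value \<open>h powr \<epsilon> / \<epsilon>\<close> is at least \<open>h / \<epsilon>\<close>;
      this is the origin of the constant \<open>\<rho> t1 * h\<close>.\<close>
    have hi: "((\<lambda>y. y powr (\<epsilon> - 1)) has_integral h powr \<epsilon> / \<epsilon>) {0..h}"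
      using has_integral_powr_from_0[of "\<epsilon> - 1" h] \<epsilon> h by simp
    have nn: "(\<integral>\<^sup>+ y. ennreal (indicator {0..h} y * y powr (\<epsilon> - 1)) \<partial>lborel) = ennreal (h powr \<epsilon> / \<epsilon>)"
      using nn_integral_has_integral_lebesgue[OF _ hi] by simp
    have "ennreal (\<rho> t1 * h / \<epsilon>) \<le> ennreal (\<rho> t1) * ennreal (h powr \<epsilon> / \<epsilon>)"
    proof -
      have "h powr 1 \<le> h powr \<epsilon>" using \<epsilon> h by (intro powr_mono') auto
      then have "\<rho> t1 * h / \<epsilon> \<le> \<rho> t1 * (h powr \<epsilon> / \<epsilon>)"
        using \<epsilon> h \<rho>1 by (simp add: divide_right_mono)
      then show ?thesis using \<rho>1 by (simp add: ennreal_mult'[symmetric] ennreal_leI)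
    qed
    also have "\<dots> = (\<integral>\<^sup>+ y. ennreal (\<rho> t1) * ennreal (indicator {0..h} y * y powr (\<epsilon> - 1)) \<partial>lborel)"
      unfolding nn[symmetric] by (rule nn_integral_cmult[symmetric]) measurable
    also have "\<dots> = (\<integral>\<^sup>+ t. ennreal (\<rho> t1) * ennreal (indicator {0..h} (t - u) * (t - u) powr (\<epsilon> - 1)) \<partial>lborel)"
      using nn_integral_real_affine[of "\<lambda>y. ennreal (\<rho> t1) * ennreal (indicator {0..h} y * y powr (\<epsilon> - 1))" 1 "-u"] by simp
    also have "\<dots> \<le> (\<integral>\<^sup>+ t. ennreal (norm (?f t)) \<partial>lborel)"
    proof (rule nn_integral_mono)
      fix t
      show "ennreal (\<rho> t1) * ennreal (indicator {0..h} (t - u) * (t - u) powr (\<epsilon> - 1)) \<le> ennreal (norm (?f t))"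
      proof (cases "t \<in> {u<..u+h}")
        case True
        then have "t - u > 0" "t - u \<le> 1" using h by auto
        then have "(t - u) powr (\<epsilon> - 1) \<le> (t - u) powr (Re b - 1)" using \<epsilon> by (intro powr_mono') auto
        then have "\<rho> t1 * (t - u) powr (\<epsilon> - 1) \<le> \<rho> t * (t - u) powr (Re b - 1)"
          using t1(2)[of t] True \<rho>1 by (intro mult_mono) auto
        also have "\<dots> = norm (?f t)"
        proof -
          have "norm (complex_of_real (t - u) powr (b - 1)) = (t - u) powr (Re b - 1)"
            using norm_of_real_powr[of "t - u" "b - 1"] \<open>t - u > 0\<close> by simp
          then show ?thesis using True h by (simp add: \<rho>_def norm_mult)
        qed
        finally show ?thesis using True h \<rho>1 by (simp add: ennreal_mult'[symmetric] ennreal_leI)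
      next
        case False
        then show ?thesis by (cases "t = u") auto
      qed
    qed
    also have "\<dots> = ennreal (LINT t|lborel. norm (?f t))"
      using int by (intro nn_integral_eq_integral integrable_norm) auto
    finally show "\<rho> t1 * h / \<epsilon> \<le> (LINT t|lborel. norm (?f t))"
      by (subst (asm) ennreal_le_iff) (auto intro: integral_nonneg_AE)
  qed
qed

lemma countable_scaled_nonpos_Ints:
  assumes "B \<noteq> 0"
  shows "countable {z. c + of_real B * z \<in> (\<int>\<^sub>\<le>\<^sub>0 :: complex set)}"
proof -
  have "{z. c + of_real B * z \<in> (\<int>\<^sub>\<le>\<^sub>0 :: complex set)} \<subseteq> (\<lambda>w. w / of_real B) ` {z. c + z \<in> \<int>\<^sub>\<le>\<^sub>0}"
  proof
    fix z assume "z \<in> {z. c + of_real B * z \<in> (\<int>\<^sub>\<le>\<^sub>0 :: complex set)}"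
    then show "z \<in> (\<lambda>w. w / of_real B) ` {z. c + z \<in> \<int>\<^sub>\<le>\<^sub>0}"
      using assms by (intro image_eqI[of _ _ "of_real B * z"]) auto
  qed
  then show ?thesis by (rule countable_subset[OF _ countable_image[OF countable_affine_nonpos_Ints]])
qed

text \<open>The \<open>rGamma\<close> factors vanish at affine preimages of the nonpositive
  integers, and so do the \<open>Gamma\<close> factors, whose value at a pole is 0 by
  convention.\<close>

lemma fox_kernel_zeros_countable:
  assumes ap: "\<forall>(c, A)\<in>set ap. A > 0" and bq: "\<forall>(b, B)\<in>set bq. B > 0"
  shows "countable {\<xi>. fox_kernel m n ap bq \<xi> = 0}"
proof -
  let ?Z = "\<lambda>c B. {z. c + of_real B * z \<in> (\<int>\<^sub>\<le>\<^sub>0 :: complex set)}"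
  have pos: "snd x \<noteq> 0" if "x \<in> set bq \<or> x \<in> set ap" for x using that ap bq by fastforce
  have "{\<xi>. fox_kernel m n ap bq \<xi> = 0} \<subseteq> (\<Union>x\<in>set bq \<union> set ap. ?Z (fst x) (- snd x) \<union> ?Z (1 - fst x) (snd x))"
  proof
    fix \<xi> assume "\<xi> \<in> {\<xi>. fox_kernel m n ap bq \<xi> = 0}"
    then have "fox_kernel m n ap bq \<xi> = 0" by simp
    then have "0 \<in> (\<lambda>x. Gamma (fst x - of_real (snd x) * \<xi>)) ` set (take m bq) \<or>
        0 \<in> (\<lambda>x. Gamma (1 - fst x + of_real (snd x) * \<xi>)) ` set (take n ap) \<or>
        0 \<in> (\<lambda>x. rGamma (1 - fst x + of_real (snd x) * \<xi>)) ` set (drop m bq) \<or>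
        0 \<in> (\<lambda>x. rGamma (fst x - of_real (snd x) * \<xi>)) ` set (drop n ap)"
      unfolding fox_kernel_def split_def mult_eq_0_iff prod_list_zero_iff set_map by argo
    then obtain x where "x \<in> set bq \<union> set ap"
      "fst x - of_real (snd x) * \<xi> \<in> \<int>\<^sub>\<le>\<^sub>0 \<or> 1 - fst x + of_real (snd x) * \<xi> \<in> \<int>\<^sub>\<le>\<^sub>0"
      by (elim disjE imageE) (metis Gamma_eq_zero_iff rGamma_eq_zero_iff in_set_takeD in_set_dropD UnI1 UnI2)+
    then have "x \<in> set bq \<union> set ap" "\<xi> \<in> ?Z (fst x) (- snd x) \<union> ?Z (1 - fst x) (snd x)" by auto
    then show "\<xi> \<in> (\<Union>x\<in>set bq \<union> set ap. ?Z (fst x) (- snd x) \<union> ?Z (1 - fst x) (snd x))" by blast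
  qed
  moreover have "countable (\<Union>x\<in>set bq \<union> set ap. ?Z (fst x) (- snd x) \<union> ?Z (1 - fst x) (snd x))"
    using pos by (intro countable_UN countable_Un countable_scaled_nonpos_Ints countable_finite) auto
  ultimately show ?thesis by (rule countable_subset)
qed

section \<open>Interchanging the integrals\<close>

lemma norm_integral_le_nn_integral:
  "ennreal (norm (integral\<^sup>L M f)) \<le> (\<integral>\<^sup>+x. norm (f x) \<partial>M)"
  by (cases "integrable M f") (auto simp: integral_norm_bound_ennreal not_integrable_integral_eq)

text \<open>First \<open>t\<close> and \<open>u\<close> are exchanged for the inner integral over
  \<open>s\<close>, then \<open>s\<close> and \<open>t\<close> for almost every fixed
  \<open>u\<close>. Finiteness of the iterated integral of the norms, with \<open>H\<close> as its
  innermost part, justifies both. The first claim is recorded because the position of the contour is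
  read off from it at such a \<open>u\<close>.\<close>

lemma Fubini_triple:
  fixes Z :: "real \<Rightarrow> real \<Rightarrow> real \<Rightarrow> complex"
  assumes Z: "(\<lambda>(t, u, s). Z t u s) \<in> borel_measurable (lborel \<Otimes>\<^sub>M lborel \<Otimes>\<^sub>M lborel)"
    and fin: "(\<integral>\<^sup>+t. \<integral>\<^sup>+u. \<integral>\<^sup>+s. ennreal (norm (Z t u s)) \<partial>lborel \<partial>lborel \<partial>lborel) < \<infinity>"
  shows "AE u in lborel. integrable (lborel \<Otimes>\<^sub>M lborel) (\<lambda>(s, t). Z t u s)"
    "(LINT t|lborel. LINT u|lborel. LINT s|lborel. Z t u s) = (LINT u|lborel. LINT s|lborel. LINT t|lborel. Z t u s)"
proof -
  have 1 [measurable]: "(\<lambda>((t, u), s). Z t u s) \<in> borel_measurable ((lborel \<Otimes>\<^sub>M lborel) \<Otimes>\<^sub>M lborel)"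
    using measurable_compose[OF _ Z, of "\<lambda>((t, u), s). (t, u, s)" "(lborel \<Otimes>\<^sub>M lborel) \<Otimes>\<^sub>M lborel"] by (simp add: split_beta')
  have 2 [measurable]: "(\<lambda>((u, s), t). Z t u s) \<in> borel_measurable ((lborel \<Otimes>\<^sub>M lborel) \<Otimes>\<^sub>M lborel)"
    using measurable_compose[OF _ Z, of "\<lambda>((u, s), t). (t, u, s)" "(lborel \<Otimes>\<^sub>M lborel) \<Otimes>\<^sub>M lborel"] by (simp add: split_beta')
  have 3 [measurable]: "(\<lambda>(s, t). Z t u s) \<in> borel_measurable (lborel \<Otimes>\<^sub>M lborel)" for u
    using measurable_compose[OF _ Z, of "\<lambda>(s, t). (t, u, s)" "lborel \<Otimes>\<^sub>M lborel"] by (simp add: split_beta')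
  have 4: "(\<lambda>(u, s). LINT t|lborel. Z t u s) \<in> borel_measurable (lborel \<Otimes>\<^sub>M lborel)"
    using lborel.borel_measurable_lebesgue_integral[of "\<lambda>p t. Z t (fst p) (snd p)" "lborel \<Otimes>\<^sub>M lborel"] 2 by (simp add: split_beta')
  have 5: "(\<lambda>u. LINT s|lborel. LINT t|lborel. Z t u s) \<in> borel_measurable lborel"
    using lborel.borel_measurable_lebesgue_integral[of "\<lambda>u s. LINT t|lborel. Z t u s" lborel] 4 by (simp add: split_beta')
  define h where "h t u = (LINT s|lborel. Z t u s)" for t u
  define H where "H t u = (\<integral>\<^sup>+s. ennreal (norm (Z t u s)) \<partial>lborel)" for t u
  have hm: "case_prod h \<in> borel_measurable (lborel \<Otimes>\<^sub>M lborel)"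
    using lborel.borel_measurable_lebesgue_integral[of "\<lambda>p s. Z (fst p) (snd p) s" "lborel \<Otimes>\<^sub>M lborel"] 1 by (simp add: h_def split_beta')
  have Hm: "case_prod H \<in> borel_measurable (lborel \<Otimes>\<^sub>M lborel)"
    using lborel.borel_measurable_nn_integral[of "\<lambda>p s. ennreal (norm (Z (fst p) (snd p) s))" "lborel \<Otimes>\<^sub>M lborel"] 1 by (simp add: H_def split_beta')
  have 6: "(\<lambda>u. LINT t|lborel. h t u) \<in> borel_measurable lborel"
    using lborel.borel_measurable_lebesgue_integral[of "\<lambda>u t. h t u" lborel] measurable_pair_swap[OF hm] by (simp add: split_beta')
  have finH: "(\<integral>\<^sup>+u. \<integral>\<^sup>+t. H t u \<partial>lborel \<partial>lborel) < \<infinity>"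
    unfolding lborel_pair.Fubini'[OF Hm] unfolding H_def using fin by simp
  have "integrable (lborel \<Otimes>\<^sub>M lborel) (case_prod h)"
  proof (rule integrableI_bounded[OF hm])
    have "(\<integral>\<^sup>+p. ennreal (norm (case_prod h p)) \<partial>(lborel \<Otimes>\<^sub>M lborel)) \<le> (\<integral>\<^sup>+p. case_prod H p \<partial>(lborel \<Otimes>\<^sub>M lborel))"
      by (intro nn_integral_mono) (auto simp: h_def H_def norm_integral_le_nn_integral)
    also have "\<dots> = (\<integral>\<^sup>+t. \<integral>\<^sup>+u. H t u \<partial>lborel \<partial>lborel)"
      using lborel.nn_integral_fst[OF Hm] by simp
    also have "\<dots> < \<infinity>" unfolding H_def using fin by simp
    finally show "(\<integral>\<^sup>+p. ennreal (norm (case_prod h p)) \<partial>(lborel \<Otimes>\<^sub>M lborel)) < \<infinity>" .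
  qed
  then have sw: "(LINT u|lborel. LINT t|lborel. h t u) = (LINT t|lborel. LINT u|lborel. h t u)"
    by (rule lborel_pair.Fubini_integral)
  have "(\<lambda>u. \<integral>\<^sup>+t. H t u \<partial>lborel) \<in> borel_measurable lborel"
    using lborel.borel_measurable_nn_integral[of "\<lambda>u t. H t u" lborel] measurable_pair_swap[OF Hm] by (simp add: split_beta')
  from nn_integral_PInf_AE[OF this] finH have aeH: "AE u in lborel. (\<integral>\<^sup>+t. H t u \<partial>lborel) \<noteq> \<infinity>" by simp
  then show ae: "AE u in lborel. integrable (lborel \<Otimes>\<^sub>M lborel) (\<lambda>(s, t). Z t u s)"
  proof eventually_elim
    case (elim u)
    show ?case
    proof (rule integrableI_bounded[OF 3])
      have nm: "(\<lambda>(s, t). ennreal (norm (Z t u s))) \<in> borel_measurable (lborel \<Otimes>\<^sub>M lborel)"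
        using 3[of u] by (simp add: split_beta')
      have "(\<integral>\<^sup>+p. ennreal (norm (case p of (s, t) \<Rightarrow> Z t u s)) \<partial>(lborel \<Otimes>\<^sub>M lborel)) = (\<integral>\<^sup>+s. \<integral>\<^sup>+t. ennreal (norm (Z t u s)) \<partial>lborel \<partial>lborel)"
        using lborel.nn_integral_fst[OF nm] by (simp add: split_beta')
      also have "\<dots> = (\<integral>\<^sup>+t. H t u \<partial>lborel)"
        unfolding H_def using lborel_pair.Fubini'[OF nm] by simp
      also have "\<dots> < \<infinity>" using elim by (simp add: less_top)
      finally show "(\<integral>\<^sup>+p. ennreal (norm (case p of (s, t) \<Rightarrow> Z t u s)) \<partial>(lborel \<Otimes>\<^sub>M lborel)) < \<infinity>" .
    qed
  qed
  have "AE u in lborel. (LINT t|lborel. h t u) = (LINT s|lborel. LINT t|lborel. Z t u s)"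
    using ae
  proof eventually_elim
    case (elim u)
    then show ?case unfolding h_def using lborel_pair.Fubini_integral[of "\<lambda>s t. Z t u s"] by simp
  qed
  then have "(LINT u|lborel. LINT t|lborel. h t u) = (LINT u|lborel. LINT s|lborel. LINT t|lborel. Z t u s)"
    by (rule integral_cong_AE[OF 6 5])
  then show "(LINT t|lborel. LINT u|lborel. LINT s|lborel. Z t u s) = (LINT u|lborel. LINT s|lborel. LINT t|lborel. Z t u s)"
    using sw by (simp add: h_def)
qed

lemma lebesgue_integral_eq_lborel:
  fixes F G :: "real \<Rightarrow> complex"
  assumes G: "G \<in> borel_measurable lborel" and ae: "AE u in lborel. F u = G u"
  shows "integral\<^sup>L lebesgue F = integral\<^sup>L lborel G"
proof -
  have Gl: "G \<in> borel_measurable lebesgue" using G by (rule measurable_completion)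
  have ae': "AE u in lebesgue. F u = G u" using AE_completion[OF ae] .
  have "F \<in> borel_measurable lebesgue"
    by (rule borel_measurable_AE[OF Gl]) (use ae' in \<open>auto elim: eventually_mono\<close>)
  then have "integral\<^sup>L lebesgue F = integral\<^sup>L lebesgue G" by (rule integral_cong_AE[OF _ Gl ae'])
  also have "\<dots> = integral\<^sup>L lborel G" by (rule integral_completion[OF G])
  finally show ?thesis .
qed

text \<open>The function \<phi> is only Lebesgue measurable, while Fubini's theorem is applied to
  products of \<open>lborel\<close>; a Borel representative bridges the two.\<close>

lemma lebesgue_ex_borel_measurable:
  fixes f :: "real \<Rightarrow> complex"
  assumes f: "f \<in> borel_measurable lebesgue"
  obtains g where "g \<in> borel_measurable borel" "AE u in lborel. f u = g u"
proof -
  have "(\<lambda>u. Re (f u)) \<in> borel_measurable (completion lborel)" "(\<lambda>u. Im (f u)) \<in> borel_measurable (completion lborel)"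
    using f by simp_all
  from this[THEN completion_ex_borel_measurable_real] obtain g1 g2 where g: "g1 \<in> borel_measurable lborel" "AE u in lborel. Re (f u) = g1 u"
    "g2 \<in> borel_measurable lborel" "AE u in lborel. Im (f u) = g2 u"
    by blast
  show thesis
  proof (rule that[of "\<lambda>u. of_real (g1 u) + \<i> * of_real (g2 u)"])
    show "(\<lambda>u. of_real (g1 u) + \<i> * of_real (g2 u)) \<in> borel_measurable borel" using g by simp
    show "AE u in lborel. f u = of_real (g1 u) + \<i> * of_real (g2 u)"
      using g(2,4) by eventually_elim (simp add: complex_eq_iff)
  qed
qed

section \<open>Measurability of the factors\<close>

lemma fox_contour_measurable:
  assumes L: "fox_contour k m n ap bq L"
  shows "L \<in> borel_measurable borel" "(\<lambda>s. vector_derivative L (at s)) \<in> borel_measurable borel"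
    "continuous_on UNIV (\<lambda>s. fox_kernel m n ap bq (L s))"
proof -
  have Lpc: "L piecewise_C1_differentiable_on UNIV" using L by (simp add: fox_contour_def)
  then have c: "continuous_on UNIV L" by (simp add: piecewise_C1_differentiable_on_def)
  then show "L \<in> borel_measurable borel" by (rule borel_measurable_continuous_onI)
  show "(\<lambda>s. vector_derivative L (at s)) \<in> borel_measurable borel" by (rule measurable_vector_derivative[OF Lpc])
  have "range L \<inter> (fox_right_poles m bq \<union> fox_left_poles n ap) = {}"
    using L unfolding fox_contour_def right_of_def left_of_def has_arg_variation_def by blast
  from holomorphic_on_imp_continuous_on[OF fox_kernel_holomorphic[OF this]] c
  show "continuous_on UNIV (\<lambda>s. fox_kernel m n ap bq (L s))" by (rule continuous_on_compose2) auto
qed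

lemma rGamma_measurable [measurable]: "(rGamma :: complex \<Rightarrow> complex) \<in> borel_measurable borel"
  by (intro borel_measurable_continuous_onI holomorphic_on_imp_continuous_on holomorphic_intros)

lemma powr_const_measurable [measurable]:
  "z \<noteq> 0 \<Longrightarrow> (\<lambda>\<xi>. (z :: complex) powr \<xi>) \<in> borel_measurable borel"
  by (intro borel_measurable_continuous_onI holomorphic_on_imp_continuous_on holomorphic_intros)

lemma hyp_F_measurable:
  "Re \<mu> > 0 \<Longrightarrow> norm v < 1 \<Longrightarrow> hyp_F \<gamma> \<mu> v \<in> borel_measurable borel"
  by (intro borel_measurable_continuous_onI holomorphic_on_imp_continuous_on hyp_F_holomorphic)

definition euler_integrand :: "complex \<Rightarrow> complex \<Rightarrow> real \<Rightarrow> real \<Rightarrow> complex \<Rightarrow> real \<Rightarrow> complex" where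
  "euler_integrand \<gamma> \<mu> u x b t =
     indicator {u<..<x} t * (of_real t powr \<gamma> * of_real (x - t) powr (\<mu> - 1) * of_real (t - u) powr (b - 1))"

text \<open>An integrable Euler integrand has \<open>Re b > 0\<close>. So where the contour enters
  the region of negative real part, \<open>A\<close> vanishes, \<open>L\<close> has derivative 0
  almost everywhere and is locally constant. Near a point \<open>p0\<close> with \<beta> + \<alpha>
  p0 = 0 the inner integral is at least a constant over \<open>norm (L s - p0)\<close>; if the
  kernel does not vanish there, integrability makes \<open>L' / (L - p0)\<close> integrable and the
  contour cannot arrive at \<open>p0\<close> unless it rests there. Either way the level set is
  open, which a contour does not allow.\<close>

lemma integrability_forces_contour:
  fixes L :: "real \<Rightarrow> complex"
  assumes \<alpha>: "\<alpha> > 0" and ap: "\<forall>(c, A)\<in>set ap. A > 0" and bq: "\<forall>(b, B)\<in>set bq. B > 0" and w: "w \<noteq> 0"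
    and L: "fox_contour k m n ap bq L"
    and ux: "u < x" "u \<noteq> 0" and same: "\<forall>t. u < t \<and> t < x \<longrightarrow> t \<noteq> 0"
    and A: "\<And>s. A s = fox_kernel m n ap bq (L s) * w powr L s * vector_derivative L (at s)"
    and ae: "AE s in lborel. A s \<noteq> 0 \<longrightarrow> integrable lborel (euler_integrand \<gamma> \<mu> u x (\<beta> + of_real \<alpha> * L s))"
    and int: "integrable lborel (\<lambda>s. norm (A s) * (LINT t|lborel. norm (euler_integrand \<gamma> \<mu> u x (\<beta> + of_real \<alpha> * L s) t)))"
  shows "AE s in lborel. A s \<noteq> 0 \<longrightarrow> Re (\<beta> + of_real \<alpha> * L s) > 0"
    "\<And>s. Re (\<beta> + of_real \<alpha> * L s) \<ge> 0"
    "\<And>s. \<beta> + of_real \<alpha> * L s = 0 \<Longrightarrow> fox_kernel m n ap bq (L s) = 0"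
proof -
  let ?\<kappa> = "fox_kernel m n ap bq" and ?D = "\<lambda>s. vector_derivative L (at s)"
  let ?N = "\<lambda>s. LINT t|lborel. norm (euler_integrand \<gamma> \<mu> u x (\<beta> + of_real \<alpha> * L s) t)"
  have Lpc: "L piecewise_C1_differentiable_on UNIV" and ends: "contour_ends k L" using L by (auto simp: fox_contour_def)
  have cL: "continuous_on UNIV L" using Lpc by (auto simp: piecewise_C1_differentiable_on_def)
  have same': "\<And>t. u < t \<Longrightarrow> t < x \<Longrightarrow> t \<noteq> 0" using same by blast
  obtain c where c: "c > 0" and lower: "\<And>b \<epsilon>. integrable lborel (euler_integrand \<gamma> \<mu> u x b) \<Longrightarrow> 0 < \<epsilon> \<Longrightarrow> \<epsilon> \<le> 1 \<Longrightarrow> Re b \<le> \<epsilon> \<Longrightarrow>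
       c / \<epsilon> \<le> (LINT t|lborel. norm (euler_integrand \<gamma> \<mu> u x b t))"
    unfolding euler_integrand_def[abs_def] by (rule power_singularity_lower_bound[OF ux same', of \<gamma> \<mu>]) blast+
  \<comment> \<open>For \<open>Re b \<le> 0\<close> the lower bound \<open>c / \<epsilon>\<close>
    would hold for every \<epsilon> in (0, 1], more than a finite integral permits.\<close>
  have pos: "Re b > 0" if b: "integrable lborel (euler_integrand \<gamma> \<mu> u x b)" for b
  proof (rule ccontr)
    assume "\<not> Re b > 0"
    define I where "I = (LINT t|lborel. norm (euler_integrand \<gamma> \<mu> u x b t))"
    define \<epsilon> where "\<epsilon> = min 1 (c / (\<bar>I\<bar> + 1))"
    have \<epsilon>: "0 < \<epsilon>" "\<epsilon> \<le> 1" "\<epsilon> \<le> c / (\<bar>I\<bar> + 1)" using c by (auto simp: \<epsilon>_def)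
    have "c / \<epsilon> \<le> I" unfolding I_def by (rule lower[OF b \<epsilon>(1,2)]) (use \<open>\<not> Re b > 0\<close> \<epsilon> in auto)
    moreover have "\<bar>I\<bar> + 1 \<le> c / \<epsilon>" using \<epsilon> by (simp add: field_simps)
    ultimately show False by linarith
  qed
  show ae1: "AE s in lborel. A s \<noteq> 0 \<longrightarrow> Re (\<beta> + of_real \<alpha> * L s) > 0"
    using ae by eventually_elim (use pos in blast)
  \<comment> \<open>On the level sets of the countably many zeros of the kernel the derivative
    vanishes almost everywhere, so \<open>A s = 0\<close> gives derivative 0.\<close>
  have "AE s in lborel. \<forall>z\<in>{\<xi>. ?\<kappa> \<xi> = 0}. L s = z \<longrightarrow> ?D s = 0"
    using AE_level_set_derivative_zero[OF Lpc] fox_kernel_zeros_countable[OF ap bq]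
    by (subst AE_ball_countable) auto
  then have ae2: "AE s in lborel. A s = 0 \<longrightarrow> ?D s = 0"
    by eventually_elim (use w in \<open>auto simp: A\<close>)
  show half: "Re (\<beta> + of_real \<alpha> * L s0) \<ge> 0" for s0
  proof (rule ccontr)
    assume neg: "\<not> Re (\<beta> + of_real \<alpha> * L s0) \<ge> 0"
    show False
    proof (rule path_level_set_clopen[OF Lpc ends refl[of "L s0"]])
      fix s assume s: "L s = L s0"
      have "continuous_on UNIV (\<lambda>s. Re (\<beta> + of_real \<alpha> * L s))"
        by (intro continuous_intros cL)
      then have "isCont (\<lambda>s. Re (\<beta> + of_real \<alpha> * L s)) s" by (simp add: continuous_on_eq_continuous_at)
      then obtain \<epsilon> where \<epsilon>: "\<epsilon> > 0" "\<And>t. dist t s < \<epsilon> \<Longrightarrow> dist (Re (\<beta> + of_real \<alpha> * L t)) (Re (\<beta> + of_real \<alpha> * L s)) < - Re (\<beta> + of_real \<alpha> * L s)"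
        using neg s unfolding continuous_at_eps_delta by (metis neg_0_less_iff_less not_le)
      have neg': "Re (\<beta> + of_real \<alpha> * L t) < 0" if "\<bar>t - s\<bar> < \<epsilon>" for t
        using \<epsilon>(2)[of t] that unfolding dist_real_def by linarith
      have "AE t in lborel. \<bar>t - s\<bar> < \<epsilon> \<longrightarrow> norm (?D t) \<le> 0 * norm (L t - L s0)"
        using ae1 ae2
      proof eventually_elim
        case (elim t)
        show ?case
        proof
          assume "\<bar>t - s\<bar> < \<epsilon>"
          then have "?D t = 0" using neg'[of t] elim by fastforce
          then show "norm (?D t) \<le> 0 * norm (L t - L s0)" by simp
        qed
      qed
      from path_locally_constant[OF Lpc s _ _ this] have "\<forall>t. \<bar>t - s\<bar> < \<epsilon> \<longrightarrow> L t = L s0"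
        by (metis integrable_zero order_refl)
      then show "\<exists>\<epsilon>>0. \<forall>t. \<bar>t - s\<bar> < \<epsilon> \<longrightarrow> L t = L s0" using \<epsilon>(1) by blast
    qed
  qed
  show "?\<kappa> (L s0) = 0" if p0: "\<beta> + of_real \<alpha> * L s0 = 0" for s0
  proof (rule ccontr)
    assume nz: "?\<kappa> (L s0) \<noteq> 0"
    show False
    proof (rule path_level_set_clopen[OF Lpc ends refl[of "L s0"]])
      fix s assume s: "L s = L s0"
      define \<phi> where "\<phi> t = ?\<kappa> (L t) * w powr L t" for t
      have "continuous_on UNIV (\<lambda>\<xi>. w powr \<xi>)"
        by (intro holomorphic_on_imp_continuous_on holomorphic_intros w)
      then have "continuous_on UNIV (\<lambda>t. w powr L t)" by (rule continuous_on_compose2[OF _ cL]) auto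
      then have c\<phi>: "continuous_on UNIV \<phi>" unfolding \<phi>_def
        by (intro continuous_on_mult fox_contour_measurable(3)[OF L])
      define q where "q = norm (\<phi> s) / 2"
      have q: "q > 0" using nz w s by (simp add: q_def \<phi>_def)
      have "continuous_on UNIV (\<lambda>s. Re (\<beta> + of_real \<alpha> * L s))"
        by (intro continuous_intros cL)
      then have "isCont \<phi> s" "isCont (\<lambda>s. Re (\<beta> + of_real \<alpha> * L s)) s"
        using c\<phi> by (simp_all add: continuous_on_eq_continuous_at)
      then obtain \<epsilon>1 \<epsilon>2 where \<epsilon>12: "\<epsilon>1 > 0" "\<epsilon>2 > 0" "\<And>t. dist t s < \<epsilon>1 \<Longrightarrow> dist (\<phi> t) (\<phi> s) < q"
        "\<And>t. dist t s < \<epsilon>2 \<Longrightarrow> dist (Re (\<beta> + of_real \<alpha> * L t)) (Re (\<beta> + of_real \<alpha> * L s)) < 1"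
        using q unfolding continuous_at_eps_delta by (metis zero_less_one)
      define \<epsilon> where "\<epsilon> = min \<epsilon>1 \<epsilon>2"
      have near: "norm (\<phi> t) \<ge> q" "Re (\<beta> + of_real \<alpha> * L t) < 1" if "\<bar>t - s\<bar> < \<epsilon>" for t
      proof -
        have "norm (\<phi> s) - norm (\<phi> t) < q"
          using \<epsilon>12(3)[of t] that norm_triangle_ineq2[of "\<phi> s" "\<phi> t"] by (auto simp: \<epsilon>_def dist_norm norm_minus_commute)
        then show "norm (\<phi> t) \<ge> q" unfolding q_def by simp
        have "Re (\<beta> + of_real \<alpha> * L s) = 0" using p0 s by simp
        then show "Re (\<beta> + of_real \<alpha> * L t) < 1"
          using \<epsilon>12(4)[of t] that unfolding dist_real_def by (auto simp: \<epsilon>_def)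
      qed
      \<comment> \<open>The coefficient for Gronwall's inequality. Near \<open>s\<close> one has
        \<open>q * norm (?D t) \<le> norm (A t)\<close> and, where \<open>A t\<close> is nonzero,
        \<open>c \<le> ?N t * (\<alpha> * norm (L t - L s0))\<close>; the product of the two gives
        the bound.\<close>
      define M where "M t = \<alpha> / (q * c) * (norm (A t) * ?N t)" for t
      have M: "integrable lborel M" "\<And>t. M t \<ge> 0"
        using int \<alpha> q c unfolding M_def by (auto intro!: integrable_mult_right mult_nonneg_nonneg integral_nonneg_AE simp del: times_divide_eq_left)
      have "AE t in lborel. \<bar>t - s\<bar> < \<epsilon> \<longrightarrow> norm (?D t) \<le> M t * norm (L t - L s0)"
        using ae ae1 ae2
      proof eventually_elim
        case (elim t)
        show ?case
        proof
          assume t: "\<bar>t - s\<bar> < \<epsilon>"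
          show "norm (?D t) \<le> M t * norm (L t - L s0)"
          proof (cases "A t = 0")
            case True then show ?thesis using elim M(2)[of t] by simp
          next
            case False
            define \<sigma> where "\<sigma> = Re (\<beta> + of_real \<alpha> * L t)"
            have \<sigma>: "0 < \<sigma>" "\<sigma> \<le> 1" using elim False near(2)[OF t] by (auto simp: \<sigma>_def)
            have "c / \<sigma> \<le> ?N t" using elim False \<sigma> by (intro lower) (auto simp: \<sigma>_def)
            then have 1: "c \<le> ?N t * \<sigma>" using \<sigma> by (simp add: field_simps)
            have "\<beta> + of_real \<alpha> * L t = of_real \<alpha> * (L t - L s0)" using p0 by (simp add: algebra_simps add_eq_0_iff)
            then have 2: "\<sigma> \<le> \<alpha> * norm (L t - L s0)"
              unfolding \<sigma>_def using complex_Re_le_cmod[of "of_real \<alpha> * (L t - L s0)"] \<alpha> by (simp only: norm_mult norm_of_real abs_of_pos)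
            have N0: "?N t \<ge> 0" by (intro integral_nonneg_AE) auto
            have 3: "c \<le> ?N t * (\<alpha> * norm (L t - L s0))" using 1 mult_left_mono[OF 2 N0] by linarith
            have "q * norm (?D t) \<le> norm (A t)"
              using mult_right_mono[OF near(1)[OF t], of "norm (?D t)"] by (simp add: A \<phi>_def norm_mult)
            then have "c * (q * norm (?D t)) \<le> (?N t * (\<alpha> * norm (L t - L s0))) * norm (A t)"
              using 3 q c by (intro mult_mono) auto
            then show ?thesis using q c unfolding M_def by (simp add: field_simps)
          qed
        qed
      qed
      from path_locally_constant[OF Lpc s M this] have "\<forall>t. \<bar>t - s\<bar> < \<epsilon> \<longrightarrow> L t = L s0" by blast
      then show "\<exists>\<epsilon>>0. \<forall>t. \<bar>t - s\<bar> < \<epsilon> \<longrightarrow> L t = L s0" using \<epsilon>12(1,2) by (intro exI[of _ \<epsilon>]) (simp add: \<epsilon>_def)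
    qed
  qed
qed

text \<open>A pole of Gamma at \<open>- \<gamma>\<close> would make 0 a left pole of the loop
  kernel. It is also a right pole, so the variation around it would have to be 0 and -1 at
  once.\<close>

lemma loop_contour_nonpole:
  assumes "fox_contour Right_Loop 1 2 [(1 + \<gamma>, 1), (1 - \<mu>, 1)] [(0, 1)] L"
  shows "- \<gamma> \<notin> \<int>\<^sub>\<le>\<^sub>0"
proof
  assume "- \<gamma> \<in> \<int>\<^sub>\<le>\<^sub>0"
  then have "0 \<in> fox_left_poles 2 [(1 + \<gamma>, 1), (1 - \<mu>, 1)]" unfolding loop_left_poles by simp
  moreover have "(0::complex) \<in> fox_right_poles 1 [(0, 1)]" unfolding loop_right_poles by (metis of_nat_0 rangeI)
  ultimately have "has_arg_variation L 0 0" "has_arg_variation L 0 (-1)"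
    using assms unfolding fox_contour_def right_of_def left_of_def by auto
  then have "(-1::real) = 0"
    unfolding has_arg_variation_def using tendsto_unique[OF trivial_limit_at_top_linorder] by blast
  then show False by simp
qed

section \<open>The two sides for a fixed \<open>u\<close>\<close>

lemma scaled_powr:
  fixes w \<xi> :: complex and p \<alpha> :: real
  assumes "p > 0" "w \<noteq> 0"
  shows "(w * of_real (p powr \<alpha>)) powr \<xi> = w powr \<xi> * of_real p powr (of_real \<alpha> * \<xi>)"
proof -
  have "complex_of_real (p powr \<alpha>) powr \<xi> = of_real p powr (of_real \<alpha> * \<xi>)"
    using assms by (simp add: powr_of_real_cases ln_powr mult_ac)
  then show ?thesis using powr_times_of_real[of "p powr \<alpha>" w \<xi>] assms by simp
qed

lemma integrable_AE_transfer:
  fixes f g :: "'a \<Rightarrow> complex"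
  assumes f: "integrable M f" and g: "g \<in> borel_measurable M" and ae: "AE s in M. f s = c * g s"
  shows "integral\<^sup>L M f = c * integral\<^sup>L M g" "c \<noteq> 0 \<Longrightarrow> integrable M g"
proof -
  have cg: "(\<lambda>s. c * g s) \<in> borel_measurable M" using g by measurable
  have "integral\<^sup>L M f = (LINT s|M. c * g s)"
    by (rule integral_cong_AE[OF borel_measurable_integrable[OF f] cg ae])
  then show "integral\<^sup>L M f = c * integral\<^sup>L M g" by simp
  assume c: "c \<noteq> 0"
  have "integrable M (\<lambda>s. c * g s)"
    using integrable_cong_AE[OF borel_measurable_integrable[OF f] cg ae] f by simp
  then have "integrable M (\<lambda>s. inverse c * (c * g s))" by (rule integrable_mult_right)
  then show "integrable M g" using c by (simp add: field_simps)
qed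

lemma Gamma_measurable [measurable]: "(Gamma :: complex \<Rightarrow> complex) \<in> borel_measurable borel"
proof -
  have "(Gamma :: complex \<Rightarrow> complex) = (\<lambda>z. inverse (rGamma z))" by (simp add: rGamma_inverse_Gamma)
  moreover have "(\<lambda>z :: complex. inverse (rGamma z)) \<in> borel_measurable borel" by measurable
  ultimately show ?thesis by simp
qed

lemma integrable_cancel:
  fixes f :: "'a \<Rightarrow> complex"
  assumes "integrable M (\<lambda>t. c * f t)" "c \<noteq> 0" shows "integrable M f"
  using integrable_mult_right[OF assms(1), of "inverse c"] assms(2) by (simp add: field_simps)

text \<open>For almost every \<open>s\<close> with \<open>A s \<noteq> 0\<close> the position of the
  contour gives a positive real part, and Euler's integral evaluates the inner integral; where
  \<open>A s = 0\<close> also \<open>G s = 0\<close>. The \<open>s\<close>-dependent power of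
  \<open>x - u\<close> is absorbed into the power of
  \<open>w * of_real ((x - u) powr \<alpha>)\<close>.\<close>

lemma euler_side:
  fixes L :: "real \<Rightarrow> complex"
  assumes \<alpha>: "\<alpha> > 0" and ap: "\<forall>(c, A)\<in>set ap. A > 0" and bq: "\<forall>(b, B)\<in>set bq. B > 0"
    and \<mu>: "Re \<mu> > 0" and w: "w \<noteq> 0" and L: "fox_contour k m n ap bq L"
    and ux: "u < x" "u \<noteq> 0" "x \<noteq> 0" and v: "\<bar>(x - u) / x\<bar> < 1"
    and same: "\<forall>t. u < t \<and> t < x \<longrightarrow> t \<noteq> 0"
    and A: "\<And>s. A s = fox_kernel m n ap bq (L s) * w powr L s * vector_derivative L (at s)"
    and int: "integrable (lborel \<Otimes>\<^sub>M lborel) (\<lambda>(s, t). A s * euler_integrand \<gamma> \<mu> u x (\<beta> + of_real \<alpha> * L s) t)"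
    and G: "\<And>s. G s = fox_kernel m (n + 1) ((1 - \<beta>, \<alpha>) # ap) bq (L s) * ((w * of_real ((x - u) powr \<alpha>)) powr L s *
        hyp_F \<gamma> \<mu> (of_real ((x - u) / x)) (\<mu> + \<beta> + of_real \<alpha> * L s)) * vector_derivative L (at s)"
  shows "\<And>s. Re (\<beta> + of_real \<alpha> * L s) \<ge> 0"
    "\<And>s. \<beta> + of_real \<alpha> * L s = 0 \<Longrightarrow> fox_kernel m n ap bq (L s) = 0"
    "integrable lborel G"
    "(LINT s|lborel. LINT t|lborel. A s * euler_integrand \<gamma> \<mu> u x (\<beta> + of_real \<alpha> * L s) t) =
      of_real x powr \<gamma> * of_real (x - u) powr (\<mu> + \<beta> - 1) * integral\<^sup>L lborel G"
proof -
  let ?b = "\<lambda>s. \<beta> + of_real \<alpha> * L s"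
  let ?e = "\<lambda>s t. euler_integrand \<gamma> \<mu> u x (?b s) t"
  let ?c = "of_real x powr \<gamma> * of_real (x - u) powr (\<mu> + \<beta> - 1)"
  define F where "F = hyp_F \<gamma> \<mu> (of_real ((x - u) / x))"
  have p: "x - u > 0" using ux by simp
  have "AE s in lborel. integrable lborel (\<lambda>t. A s * ?e s t)"
    using lborel_pair.AE_integrable_fst'[OF int] by simp
  then have ae: "AE s in lborel. A s \<noteq> 0 \<longrightarrow> integrable lborel (?e s)"
    by eventually_elim (use integrable_cancel in blast)
  have "integrable lborel (\<lambda>s. LINT t|lborel. norm (A s * ?e s t))"
    using lborel_pair.integrable_fst'[OF integrable_norm[OF int]] by simp
  then have intN: "integrable lborel (\<lambda>s. norm (A s) * (LINT t|lborel. norm (?e s t)))"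
    by (simp add: norm_mult)
  note forced = integrability_forces_contour[OF \<alpha> ap bq w L ux(1,2) same A ae intN]
  from forced(2) show "\<And>s. Re (?b s) \<ge> 0" .
  from forced(3) show "\<And>s. ?b s = 0 \<Longrightarrow> fox_kernel m n ap bq (L s) = 0" .
  have I: "integrable lborel (\<lambda>s. LINT t|lborel. A s * ?e s t)"
    using lborel_pair.integrable_fst'[OF int] by simp
  have X0: "w * of_real ((x - u) powr \<alpha>) \<noteq> 0" using w p by simp
  have [measurable]: "F \<in> borel_measurable borel"
    unfolding F_def using ux v by (intro hyp_F_measurable \<mu>) (simp only: norm_of_real)
  note [measurable] = fox_contour_measurable(1,2)[OF L] borel_measurable_continuous_onI[OF fox_contour_measurable(3)[OF L]]
    powr_const_measurable[OF X0]
  have Gm: "G \<in> borel_measurable lborel"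
    unfolding G[abs_def] fox_kernel_extend F_def[symmetric] by measurable
  have "AE s in lborel. (LINT t|lborel. A s * ?e s t) = ?c * G s"
    using forced(1)
  proof eventually_elim
    case (elim s)
    show ?case
    proof (cases "A s = 0")
      case True
      then have "fox_kernel m n ap bq (L s) = 0 \<or> vector_derivative L (at s) = 0" using w by (simp add: A)
      then have "G s = 0" unfolding G fox_kernel_extend by auto
      then show ?thesis using True by simp
    next
      case False
      then have b: "Re (?b s) > 0" using elim by simp
      have "(LINT t|lborel. ?e s t) = of_real x powr \<gamma> * of_real (x - u) powr (\<mu> + ?b s - 1) * (Gamma (?b s) * F (\<mu> + ?b s))"
        unfolding euler_integrand_def F_def by (rule euler_integral_interval[OF \<mu> b ux(1,3) v])
      moreover have "of_real (x - u) powr (\<mu> + ?b s - 1) = of_real (x - u) powr (\<mu> + \<beta> - 1) * of_real (x - u) powr (of_real \<alpha> * L s)"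
        by (simp add: powr_add[symmetric] algebra_simps)
      ultimately show ?thesis
        unfolding G fox_kernel_extend F_def[symmetric] scaled_powr[OF p w] by (simp add: A mult_ac add.assoc)
    qed
  qed
  note tr = integrable_AE_transfer[OF I Gm this]
  show "(LINT s|lborel. LINT t|lborel. A s * ?e s t) = ?c * integral\<^sup>L lborel G" by (rule tr(1))
  show "integrable lborel G" using tr(2) p ux by simp
qed

text \<open>Fubini makes \<open>W s\<close> integrable for almost every \<open>s\<close>. Where the
  prefactor \<open>pre s\<close> vanishes this says nothing about \<open>q s\<close>, but then both
  sides are 0; elsewhere the loop integral is a sum of residues.\<close>

lemma loop_side:
  fixes L1 L2 :: "real \<Rightarrow> complex"
  assumes \<mu>: "Re \<mu> > 0" and X: "X \<noteq> 0" and v: "norm (v :: complex) < 1" "v \<noteq> 0"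
    and L1: "fox_contour k m' n' cs ds L1" and L2: "fox_contour Right_Loop 1 2 [(1 + \<gamma>, 1), (1 - \<mu>, 1)] [(0, 1)] L2"
    and W: "\<And>s r. W s r = fox_H2_integrand 0 [] [(1 - \<mu> - \<beta>, \<alpha>, 1)] m' n' cs ds
        1 2 [(1 + \<gamma>, 1), (1 - \<mu>, 1)] [(0, 1)] L1 L2 X (- v) s r"
    and fin: "(\<integral>\<^sup>+s. \<integral>\<^sup>+r. ennreal (norm (W s r)) \<partial>lborel \<partial>lborel) < \<infinity>"
    and G: "\<And>s. G s = fox_kernel m' n' cs ds (L1 s) * (X powr L1 s * hyp_F \<gamma> \<mu> v (\<mu> + \<beta> + of_real \<alpha> * L1 s)) * vector_derivative L1 (at s)"
  shows "integrable lborel G"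
    "(LINT s|lborel. LINT r|lborel. W s r) = 2 * of_real pi * \<i> * Gamma (- \<gamma>) * integral\<^sup>L lborel G"
proof -
  define pre where "pre s = fox_kernel m' n' cs ds (L1 s) * X powr L1 s * vector_derivative L1 (at s)" for s
  define lk where "lk = loop_kernel \<gamma> \<mu>"
  define D where "D r = vector_derivative L2 (at r)" for r
  define q where "q s r = lk (L2 r) * rGamma (\<mu> + \<beta> + of_real \<alpha> * L1 s + L2 r) * (- v) powr L2 r * D r" for s r
  have Wq: "W s r = pre s * q s r" for s r
    unfolding W fox_H2_integrand_def fox2_Phi_def pre_def q_def lk_def D_def by (simp add: algebra_simps)
  have mv: "- v \<noteq> 0" using v by simp
  note [measurable] = fox_contour_measurable(1,2)[OF L1] borel_measurable_continuous_onI[OF fox_contour_measurable(3)[OF L1]]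
    fox_contour_measurable(1)[OF L2] fox_contour_measurable(2)[OF L2, folded D_def]
    borel_measurable_continuous_onI[OF fox_contour_measurable(3)[OF L2], folded lk_def]
    powr_const_measurable[OF X] powr_const_measurable[OF mv] hyp_F_measurable[OF \<mu> v(1), of \<gamma>]
  have [measurable]: "pre \<in> borel_measurable borel" unfolding pre_def[abs_def] by measurable
  have Wm: "(\<lambda>(s, r). W s r) \<in> borel_measurable (lborel \<Otimes>\<^sub>M lborel)"
    unfolding Wq q_def by measurable
  have Gm: "G \<in> borel_measurable lborel" unfolding G[abs_def] by measurable
  have "(\<lambda>(s, r). ennreal (norm (W s r))) \<in> borel_measurable (lborel \<Otimes>\<^sub>M lborel)"
    using Wm by (simp add: split_beta')
  from lborel.nn_integral_fst[OF this] have "(\<integral>\<^sup>+p. ennreal (norm (case p of (s, r) \<Rightarrow> W s r)) \<partial>(lborel \<Otimes>\<^sub>M lborel)) < \<infinity>"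
    using fin by (simp add: split_beta')
  with Wm have int: "integrable (lborel \<Otimes>\<^sub>M lborel) (\<lambda>(s, r). W s r)" by (rule integrableI_bounded)
  have I: "integrable lborel (\<lambda>s. LINT r|lborel. W s r)" using lborel_pair.integrable_fst'[OF int] by simp
  have "AE s in lborel. integrable lborel (\<lambda>r. W s r)" using lborel_pair.AE_integrable_fst'[OF int] by simp
  then have "AE s in lborel. (LINT r|lborel. W s r) = (2 * of_real pi * \<i> * Gamma (- \<gamma>)) * G s"
  proof eventually_elim
    case (elim s)
    have Gs: "G s = pre s * hyp_F \<gamma> \<mu> v (\<mu> + \<beta> + of_real \<alpha> * L1 s)" by (simp add: G pre_def)
    show ?case
    proof (cases "pre s = 0")
      case True then show ?thesis by (simp add: Wq Gs)
    next
      case False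
      have "integrable lborel (q s)" using elim False unfolding Wq by (rule integrable_cancel)
      then have "integral\<^sup>L lborel (q s) = 2 * of_real pi * \<i> * (Gamma (- \<gamma>) * hyp_F \<gamma> \<mu> v (\<mu> + \<beta> + of_real \<alpha> * L1 s))"
        unfolding q_def lk_def D_def by (rule right_loop_integral[OF L2 \<mu> v])
      then show ?thesis by (simp add: Wq Gs)
    qed
  qed
  note tr = integrable_AE_transfer[OF I Gm this]
  show "(LINT s|lborel. LINT r|lborel. W s r) = 2 * of_real pi * \<i> * Gamma (- \<gamma>) * integral\<^sup>L lborel G" by (rule tr(1))
  show "integrable lborel G" using tr(2) loop_contour_nonpole[OF L2] by (simp add: Gamma_eq_zero_iff)
qed

text \<open>Of the square of \<open>2 * of_real pi * \<i>\<close> in \<open>fox_H2\<close> one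
  factor cancels against the residues, which also contribute \<open>Gamma (- \<gamma>)\<close>; the
  division by \<open>of_real x powr \<gamma>\<close> compensates the factor from Euler's
  integral.\<close>

lemma fox_H2_eq_euler_integral:
  fixes L L1 L2 :: "real \<Rightarrow> complex"
  assumes \<alpha>: "\<alpha> > 0" and ap: "\<forall>(c, A)\<in>set ap. A > 0" and bq: "\<forall>(b, B)\<in>set bq. B > 0"
    and \<mu>: "Re \<mu> > 0" and w: "w \<noteq> 0" and L: "fox_contour k m n ap bq L"
    and L1: "fox_contour k m (n + 1) ((1 - \<beta>, \<alpha>) # ap) bq L1"
    and L2: "fox_contour Right_Loop 1 2 [(1 + \<gamma>, 1), (1 - \<mu>, 1)] [(0, 1)] L2"
    and ux: "u < x" "u \<noteq> 0" "x \<noteq> 0" and v: "\<bar>(x - u) / x\<bar> < 1"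
    and same: "\<forall>t. u < t \<and> t < x \<longrightarrow> t \<noteq> 0"
    and A: "\<And>s. A s = fox_kernel m n ap bq (L s) * w powr L s * vector_derivative L (at s)"
    and int: "integrable (lborel \<Otimes>\<^sub>M lborel) (\<lambda>(s, t). A s * euler_integrand \<gamma> \<mu> u x (\<beta> + of_real \<alpha> * L s) t)"
    and fin: "(\<integral>\<^sup>+s. \<integral>\<^sup>+r. ennreal (norm (fox_H2_integrand 0 [] [(1 - \<mu> - \<beta>, \<alpha>, 1)]
         m (n + 1) ((1 - \<beta>, \<alpha>) # ap) bq 1 2 [(1 + \<gamma>, 1), (1 - \<mu>, 1)] [(0, 1)] L1 L2
         (w * of_real ((x - u) powr \<alpha>)) (of_real (- ((x - u) / x))) s r)) \<partial>lborel \<partial>lborel) < \<infinity>"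
  shows "of_real (x - u) powr (\<mu> + \<beta> - 1) * fox_H2 0 [] [(1 - \<mu> - \<beta>, \<alpha>, 1)]
         m (n + 1) ((1 - \<beta>, \<alpha>) # ap) bq 1 2 [(1 + \<gamma>, 1), (1 - \<mu>, 1)] [(0, 1)] L1 L2
         (w * of_real ((x - u) powr \<alpha>)) (of_real (- ((x - u) / x))) =
    Gamma (- \<gamma>) / (of_real x powr \<gamma> * (2 * of_real pi * \<i>)) *
      (LINT s|lborel. LINT t|lborel. A s * euler_integrand \<gamma> \<mu> u x (\<beta> + of_real \<alpha> * L s) t)"
proof -
  define X where "X = w * of_real ((x - u) powr \<alpha>)"
  define v' where "v' = complex_of_real ((x - u) / x)"
  define \<kappa>' where "\<kappa>' = fox_kernel m (n + 1) ((1 - \<beta>, \<alpha>) # ap) bq"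
  have X: "X \<noteq> 0" using w ux by (simp add: X_def)
  have v': "norm v' < 1" "v' \<noteq> 0" unfolding v'_def norm_of_real using v ux by simp_all
  have m_v': "complex_of_real (- ((x - u) / x)) = - v'" by (simp only: v'_def of_real_minus)
  define G where "G P s = \<kappa>' (P s) * (X powr P s * hyp_F \<gamma> \<mu> v' (\<mu> + \<beta> + of_real \<alpha> * P s)) * vector_derivative P (at s)"
    for P :: "real \<Rightarrow> complex" and s
  note es = euler_side[where G = "G L", OF \<alpha> ap bq \<mu> w L ux v same A int G_def[unfolded \<kappa>'_def X_def v'_def]]
  note ls = loop_side[where G = "G L1", OF \<mu> X v' L1 L2 refl fin[folded X_def, unfolded m_v'] G_def[unfolded \<kappa>'_def]]
  have eq: "integral\<^sup>L lborel (G L) = integral\<^sup>L lborel (G L1)"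
    unfolding G_def[abs_def] \<kappa>'_def
    by (rule kernel_contour_shift[OF \<alpha> ap bq \<mu> v'(1) X L L1 es(1,2) es(3)[unfolded G_def[abs_def] \<kappa>'_def] ls(1)[unfolded G_def[abs_def] \<kappa>'_def]])
  have x0: "of_real x powr \<gamma> \<noteq> (0::complex)" using ux by simp
  have E: "(LINT s|lborel. LINT t|lborel. A s * euler_integrand \<gamma> \<mu> u x (\<beta> + of_real \<alpha> * L s) t) =
      of_real x powr \<gamma> * of_real (x - u) powr (\<mu> + \<beta> - 1) * integral\<^sup>L lborel (G L)"
    by (rule es(4))
  define P where "P = complex_of_real (x - u) powr (\<mu> + \<beta> - 1)"
  show ?thesis
    unfolding E fox_H2_def X_def[symmetric] m_v' ls(2) P_def[symmetric] eq using x0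
    by (simp add: field_simps power2_eq_square)
qed

lemma nn_integral_pair_scale:
  fixes f :: "real \<Rightarrow> real \<Rightarrow> complex"
  assumes f: "(\<lambda>(s, r). f s r) \<in> borel_measurable (lborel \<Otimes>\<^sub>M lborel)"
    and fin: "(\<integral>\<^sup>+s. \<integral>\<^sup>+r. ennreal (norm (f s r)) \<partial>lborel \<partial>lborel) < \<infinity>"
  shows "(\<integral>\<^sup>+s. \<integral>\<^sup>+r. ennreal (norm (c * f s r)) \<partial>lborel \<partial>lborel) < \<infinity>"
proof -
  have f': "(\<lambda>(s, r). d * f s r) \<in> borel_measurable (lborel \<Otimes>\<^sub>M lborel)" for d
    using borel_measurable_times[OF borel_measurable_const[of d] f] by (simp add: split_beta')
  have nn: "(\<integral>\<^sup>+p. ennreal (norm (d * f (fst p) (snd p))) \<partial>(lborel \<Otimes>\<^sub>M lborel)) =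
      (\<integral>\<^sup>+s. \<integral>\<^sup>+r. ennreal (norm (d * f s r)) \<partial>lborel \<partial>lborel)" for d
    using lborel.nn_integral_fst[of "\<lambda>p. ennreal (norm (d * f (fst p) (snd p)))" lborel] f'[of d] by (simp add: split_beta')
  have "integrable (lborel \<Otimes>\<^sub>M lborel) (\<lambda>p. f (fst p) (snd p))"
    by (rule integrableI_bounded) (use f fin nn[of 1] in \<open>simp_all add: split_beta'\<close>)
  then have "integrable (lborel \<Otimes>\<^sub>M lborel) (\<lambda>p. c * f (fst p) (snd p))" by (rule integrable_mult_right)
  then show ?thesis unfolding integrable_iff_bounded nn by blast
qed

theorem theorem2:
  fixes a x \<alpha> :: real and \<beta> \<gamma> \<mu> w :: complex and m n :: nat
    and ap bq :: "(complex \<times> real) list"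
    and \<phi> :: "real \<Rightarrow> complex"
    and k :: contour_kind and L L1 L2 :: "real \<Rightarrow> complex"
  assumes "\<alpha> > 0" and "\<forall>(c, A)\<in>set ap. A > 0" and "\<forall>(b, B)\<in>set bq. B > 0"
    and "Re \<gamma> > -1" and "Re \<mu> > 0" and "Re \<beta> > 0" and "w \<noteq> 0"
    and "1 \<le> m" and "m \<le> length bq" and "n \<le> length ap"
    and "Re \<beta> + Min ((\<lambda>(b, B). Re (of_real \<alpha> * b / of_real B)) ` set (take m bq)) > 0"
    and "a < x" and "x \<noteq> 0" and "\<forall>u. a < u \<and> u < x \<longrightarrow> \<bar>(x - u) / x\<bar> < 1"
    and "fox_contour k m n ap bq L"
    and "fox2_contours k Right_Loop 0 []
           m (n + 1) ((1 - \<beta>, \<alpha>) # ap) bq 1 2 [(1 + \<gamma>, 1), (1 - \<mu>, 1)] [(0, 1)] L1 L2"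
    and "\<phi> absolutely_integrable_on {a<..<x}"
    and "(\<integral>\<^sup>+ t\<in>{a<..<x}. (\<integral>\<^sup>+ u\<in>{a<..<t}. (\<integral>\<^sup>+ s.
            ennreal (norm (of_real t powr \<gamma> / of_real (x - t) powr (1 - \<mu>) *
              of_real (t - u) powr (\<beta> - 1) *
              fox_H_integrand m n ap bq L (w * of_real ((t - u) powr \<alpha>)) s * \<phi> u))
          \<partial>lborel) \<partial>lebesgue) \<partial>lebesgue) < \<infinity>"
    and "(\<integral>\<^sup>+ u\<in>{a<..<x}. (\<integral>\<^sup>+ s. (\<integral>\<^sup>+ r.
            ennreal (norm (of_real (x - u) powr (\<mu> + \<beta> - 1) *
              fox_H2_integrand 0 [] [(1 - \<mu> - \<beta>, \<alpha>, 1)]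
                m (n + 1) ((1 - \<beta>, \<alpha>) # ap) bq 1 2 [(1 + \<gamma>, 1), (1 - \<mu>, 1)] [(0, 1)] L1 L2
                (w * of_real ((x - u) powr \<alpha>)) (of_real (- ((x - u) / x))) s r * \<phi> u))
          \<partial>lborel) \<partial>lborel) \<partial>lebesgue) < \<infinity>"
  shows "EK_integral a \<gamma> \<mu> (fox_H_operator a w m n \<alpha> ap bq \<beta> L \<phi>) x =
    of_real x powr \<gamma> * of_real (x - a) powr (- \<mu> - \<gamma>) / (Gamma \<mu> * Gamma (- \<gamma>)) *
    (LINT u:{a<..<x}|lebesgue.
       of_real (x - u) powr (\<mu> + \<beta> - 1) *
       fox_H2 0 [] [(1 - \<mu> - \<beta>, \<alpha>, 1)]
         m (n + 1) ((1 - \<beta>, \<alpha>) # ap) bq 1 2 [(1 + \<gamma>, 1), (1 - \<mu>, 1)] [(0, 1)] L1 L2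
         (w * of_real ((x - u) powr \<alpha>)) (of_real (- ((x - u) / x))) * \<phi> u)"
proof -
  note \<alpha> = assms(1) and ap = assms(2) and bq = assms(3) and \<mu> = assms(5) and w = assms(7) and L = assms(15)
    and H1 = assms(18) and H2 = assms(19)
  have L1: "fox_contour k m (n + 1) ((1 - \<beta>, \<alpha>) # ap) bq L1"
    and L2: "fox_contour Right_Loop 1 2 [(1 + \<gamma>, 1), (1 - \<mu>, 1)] [(0, 1)] L2"
    using assms(16) unfolding fox2_contours_def by blast+
  have v: "\<bar>(x - u) / x\<bar> < 1" if "a < u" "u < x" for u using assms(14) that by blast
  \<comment> \<open>At \<open>u = 0\<close> the quotient would be 1. So the interval avoids 0 and
    all \<open>t\<close> in it have the sign of \<open>x\<close>.\<close>
  have nz: "u \<noteq> 0" if "a < u" "u < x" for u using v[OF that] assms(13) by auto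
  have "(\<lambda>u. indicator {a<..<x} u *\<^sub>R \<phi> u) \<in> borel_measurable lebesgue"
    using assms(17) unfolding set_integrable_def by (rule borel_measurable_integrable)
  then obtain \<psi> where \<psi> [measurable]: "\<psi> \<in> borel_measurable borel"
    and "AE u in lborel. indicator {a<..<x} u *\<^sub>R \<phi> u = \<psi> u"
    by (rule lebesgue_ex_borel_measurable)
  then have ae\<psi>: "AE u in lborel. a < u \<and> u < x \<longrightarrow> \<phi> u = \<psi> u"
    by (auto elim!: eventually_mono simp: indicator_def)

  \<comment> \<open>The left-hand side as a triple integral\<close>
  define A where "A s = fox_kernel m n ap bq (L s) * w powr L s * vector_derivative L (at s)" for s
  note [measurable] = fox_contour_measurable(1,2)[OF L] borel_measurable_continuous_onI[OF fox_contour_measurable(3)[OF L]]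
    powr_const_measurable[OF w]
  have [measurable]: "A \<in> borel_measurable borel" unfolding A_def[abs_def] by measurable
  \<comment> \<open>The region a < u < t < x is built into \<open>Z\<close>, so all integrals run
    over the whole line, and \<psi> replaces \<phi> to make \<open>Z\<close> Borel. The power of
    \<open>t - u\<close> already includes the one from the argument of the H-function.\<close>
  define Z where "Z t u s = (if a < u \<and> u < t \<and> t < x then of_real t powr \<gamma> * of_real (x - t) powr (\<mu> - 1) *
      of_real (t - u) powr (\<beta> + of_real \<alpha> * L s - 1) * (A s * \<psi> u) else 0)" for t u s
  have Zm: "(\<lambda>(t, u, s). Z t u s) \<in> borel_measurable (lborel \<Otimes>\<^sub>M lborel \<Otimes>\<^sub>M lborel)"
    unfolding Z_def by measurable
  have Zeuler: "Z t u s = \<psi> u * (A s * euler_integrand \<gamma> \<mu> u x (\<beta> + of_real \<alpha> * L s) t)" if "a < u" for t u s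
    using that by (cases "u < t \<and> t < x") (auto simp: Z_def euler_integrand_def)
  have Zfox: "Z t u s = of_real t powr \<gamma> / of_real (x - t) powr (1 - \<mu>) * of_real (t - u) powr (\<beta> - 1) * \<psi> u *
      fox_H_integrand m n ap bq L (w * of_real ((t - u) powr \<alpha>)) s" if "a < u" "u < t" "t < x" for t u s
  proof -
    have 1: "1 / complex_of_real (x - t) powr (1 - \<mu>) = of_real (x - t) powr (\<mu> - 1)"
      using powr_minus_divide[of "complex_of_real (x - t)" "1 - \<mu>"] by simp
    have "complex_of_real (t - u) powr (\<beta> + of_real \<alpha> * L s - 1) = of_real (t - u) powr (\<beta> - 1) * of_real (t - u) powr (of_real \<alpha> * L s)"
      by (simp add: powr_add[symmetric] algebra_simps)
    moreover have "t - u > 0" using that by simp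
    ultimately show ?thesis
      unfolding Z_def fox_H_integrand_def A_def scaled_powr[OF \<open>t - u > 0\<close> w] divide_inverse
      using that 1 by (simp add: divide_inverse mult_ac)
  qed
  have Z0: "Z t u s = 0" if "\<not> (a < u \<and> u < t \<and> t < x)" for t u s unfolding Z_def using that by (rule if_not_P)

  let ?h1 = "\<lambda>t u s. of_real t powr \<gamma> / of_real (x - t) powr (1 - \<mu>) * of_real (t - u) powr (\<beta> - 1) *
              fox_H_integrand m n ap bq L (w * of_real ((t - u) powr \<alpha>)) s * \<phi> u"
  have in1: "(\<integral>\<^sup>+u\<in>{a<..<t}. (\<integral>\<^sup>+s. ennreal (norm (?h1 t u s)) \<partial>lborel) \<partial>lebesgue) =
      (\<integral>\<^sup>+u. \<integral>\<^sup>+s. ennreal (norm (Z t u s)) \<partial>lborel \<partial>lborel)" if t: "t < x" for t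
  proof -
    have "AE u in lborel. (\<integral>\<^sup>+s. ennreal (norm (?h1 t u s)) \<partial>lborel) * indicator {a<..<t} u = (\<integral>\<^sup>+s. ennreal (norm (Z t u s)) \<partial>lborel)"
      using ae\<psi>
    proof eventually_elim
      case (elim u)
      show ?case
      proof (cases "u \<in> {a<..<t}")
        case True
        then have "?h1 t u s = Z t u s" for s using elim t Zfox[of u t s] by (simp add: mult_ac)
        then show ?thesis using True by simp
      next
        case False
        then have "Z t u s = 0" for s by (intro Z0) auto
        then show ?thesis using False by simp
      qed
    qed
    from nn_integral_cong_AE[OF AE_completion[OF this]] show ?thesis by (simp only: nn_integral_completion)
  qed
  have finZ: "(\<integral>\<^sup>+t. \<integral>\<^sup>+u. \<integral>\<^sup>+s. ennreal (norm (Z t u s)) \<partial>lborel \<partial>lborel \<partial>lborel) < \<infinity>"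
  proof -
    have "(\<integral>\<^sup>+u\<in>{a<..<t}. (\<integral>\<^sup>+s. ennreal (norm (?h1 t u s)) \<partial>lborel) \<partial>lebesgue) * indicator {a<..<x} t =
      (\<integral>\<^sup>+u. \<integral>\<^sup>+s. ennreal (norm (Z t u s)) \<partial>lborel \<partial>lborel)" for t
    proof (cases "t \<in> {a<..<x}")
      case True then show ?thesis using in1[of t] by simp
    next
      case False
      then have "Z t u s = 0" for u s by (intro Z0) auto
      then show ?thesis using False by simp
    qed
    then show ?thesis using H1 by (simp only: nn_integral_completion)
  qed
  note Fub = Fubini_triple[OF Zm finZ]

  have inner: "of_real t powr \<gamma> * fox_H_operator a w m n \<alpha> ap bq \<beta> L \<phi> t / of_real (x - t) powr (1 - \<mu>) =
      1 / (2 * of_real pi * \<i>) * (LINT u|lborel. LINT s|lborel. Z t u s)" if t: "a < t" "t < x" for t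
  proof -
    let ?c = "of_real t powr \<gamma> / of_real (x - t) powr (1 - \<mu>)"
    let ?g = "\<lambda>u. of_real (t - u) powr (\<beta> - 1) * fox_H m n ap bq L (w * of_real ((t - u) powr \<alpha>)) * \<phi> u"
    have "AE u in lborel. 2 * of_real pi * \<i> * ?c * (indicator {a<..<t} u *\<^sub>R ?g u) = (LINT s|lborel. Z t u s)"
      using ae\<psi>
    proof eventually_elim
      case (elim u)
      show ?case
      proof (cases "u \<in> {a<..<t}")
        case True
        then have "(LINT s|lborel. Z t u s) = ?c * of_real (t - u) powr (\<beta> - 1) * \<psi> u *
            (LINT s|lborel. fox_H_integrand m n ap bq L (w * of_real ((t - u) powr \<alpha>)) s)"
          using t by (simp add: Zfox del: of_real_diff)
        then show ?thesis using True elim t unfolding fox_H_def by (simp add: field_simps)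
      next
        case False
        then have "Z t u s = 0" for s by (intro Z0) auto
        then show ?thesis using False by simp
      qed
    qed
    moreover have "(\<lambda>u. LINT s|lborel. Z t u s) \<in> borel_measurable lborel" unfolding Z_def by measurable
    ultimately have "(LINT u|lebesgue. 2 * of_real pi * \<i> * ?c * (indicator {a<..<t} u *\<^sub>R ?g u)) = (LINT u|lborel. LINT s|lborel. Z t u s)"
      by (intro lebesgue_integral_eq_lborel)
    then have "2 * of_real pi * \<i> * ?c * fox_H_operator a w m n \<alpha> ap bq \<beta> L \<phi> t = (LINT u|lborel. LINT s|lborel. Z t u s)"
      unfolding fox_H_operator_def set_lebesgue_integral_def integral_mult_right_zero .
    then show ?thesis by (simp add: field_simps)
  qed
  define T where "T = (LINT u|lborel. LINT s|lborel. LINT t|lborel. Z t u s)"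
  have "(LINT t:{a<..<x}|lebesgue. of_real t powr \<gamma> * fox_H_operator a w m n \<alpha> ap bq \<beta> L \<phi> t / of_real (x - t) powr (1 - \<mu>)) =
      (LINT t|lborel. 1 / (2 * of_real pi * \<i>) * (LINT u|lborel. LINT s|lborel. Z t u s))"
    unfolding set_lebesgue_integral_def
  proof (rule lebesgue_integral_eq_lborel)
    show "(\<lambda>t. 1 / (2 * of_real pi * \<i>) * (LINT u|lborel. LINT s|lborel. Z t u s)) \<in> borel_measurable lborel"
      unfolding Z_def by measurable
    show "AE t in lborel. indicator {a<..<x} t *\<^sub>R (of_real t powr \<gamma> * fox_H_operator a w m n \<alpha> ap bq \<beta> L \<phi> t / of_real (x - t) powr (1 - \<mu>)) =
        1 / (2 * of_real pi * \<i>) * (LINT u|lborel. LINT s|lborel. Z t u s)"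
    proof (rule AE_I2)
      fix t
      show "indicator {a<..<x} t *\<^sub>R (of_real t powr \<gamma> * fox_H_operator a w m n \<alpha> ap bq \<beta> L \<phi> t / of_real (x - t) powr (1 - \<mu>)) =
        1 / (2 * of_real pi * \<i>) * (LINT u|lborel. LINT s|lborel. Z t u s)"
      proof (cases "t \<in> {a<..<x}")
        case True then show ?thesis using inner[of t] by simp
      next
        case False
        then have "Z t u s = 0" for u s by (intro Z0) auto
        then show ?thesis using False by simp
      qed
    qed
  qed
  then have lhs: "EK_integral a \<gamma> \<mu> (fox_H_operator a w m n \<alpha> ap bq \<beta> L \<phi>) x =
      of_real (x - a) powr (- \<mu> - \<gamma>) / Gamma \<mu> * (1 / (2 * of_real pi * \<i>) * T)"
    unfolding EK_integral_def integral_mult_right_zero Fub(2) T_def[symmetric] by (rule arg_cong)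

  \<comment> \<open>The right-hand side at almost every \<open>u\<close>\<close>
  define W where "W u = fox_H2_integrand 0 [] [(1 - \<mu> - \<beta>, \<alpha>, 1)]
         m (n + 1) ((1 - \<beta>, \<alpha>) # ap) bq 1 2 [(1 + \<gamma>, 1), (1 - \<mu>, 1)] [(0, 1)] L1 L2
         (w * of_real ((x - u) powr \<alpha>)) (of_real (- ((x - u) / x)))" for u
  define Q where "Q u = fox_H2 0 [] [(1 - \<mu> - \<beta>, \<alpha>, 1)]
         m (n + 1) ((1 - \<beta>, \<alpha>) # ap) bq 1 2 [(1 + \<gamma>, 1), (1 - \<mu>, 1)] [(0, 1)] L1 L2
         (w * of_real ((x - u) powr \<alpha>)) (of_real (- ((x - u) / x)))" for u
  define \<kappa>' where "\<kappa>' = fox_kernel m (n + 1) ((1 - \<beta>, \<alpha>) # ap) bq"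
  define lk where "lk = loop_kernel \<gamma> \<mu>"
  define P where "P u = complex_of_real (x - u) powr (\<mu> + \<beta> - 1)" for u
  \<comment> \<open>The power of \<open>w * of_real ((x - u) powr \<alpha>)\<close> is split into
    one with a constant base and one with a real base, for which joint measurability in
    \<open>u\<close> and \<open>s\<close> is available.\<close>
  define V where "V u s r = (if a < u \<and> u < x then P u * \<psi> u *
      (rGamma (\<mu> + \<beta> + of_real \<alpha> * L1 s + L2 r) * \<kappa>' (L1 s) * lk (L2 r) *
       (w powr L1 s * of_real (x - u) powr (of_real \<alpha> * L1 s)) * of_real (- ((x - u) / x)) powr L2 r *
       vector_derivative L1 (at s) * vector_derivative L2 (at r)) else 0)" for u s r
  note [measurable] = fox_contour_measurable(1,2)[OF L1] fox_contour_measurable(1,2)[OF L2]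
    borel_measurable_continuous_onI[OF fox_contour_measurable(3)[OF L1], folded \<kappa>'_def]
    borel_measurable_continuous_onI[OF fox_contour_measurable(3)[OF L2], folded lk_def]
  have VW: "V u s r = P u * \<psi> u * W u s r" if "a < u" "u < x" for u s r
  proof -
    have "x - u > 0" using that by simp
    from scaled_powr[OF this w] show ?thesis
      unfolding V_def W_def fox_H2_integrand_def fox2_Phi_def \<kappa>'_def[symmetric] lk_def[symmetric] using that by (simp add: algebra_simps)
  qed
  have Vm: "(\<lambda>(s, r). V u s r) \<in> borel_measurable (lborel \<Otimes>\<^sub>M lborel)" for u
    unfolding V_def by measurable
  define N where "N u = (\<integral>\<^sup>+s. \<integral>\<^sup>+r. ennreal (norm (V u s r)) \<partial>lborel \<partial>lborel)" for u
  have Nm: "N \<in> borel_measurable lborel" unfolding N_def V_def P_def by measurable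
  have "AE u in lborel. (\<integral>\<^sup>+s. \<integral>\<^sup>+r. ennreal (norm (P u * W u s r * \<phi> u)) \<partial>lborel \<partial>lborel) * indicator {a<..<x} u = N u"
    using ae\<psi>
  proof eventually_elim
    case (elim u)
    show ?case
    proof (cases "u \<in> {a<..<x}")
      case True
      then have "P u * W u s r * \<phi> u = V u s r" for s r using elim VW[of u s r] by (simp add: mult_ac)
      then show ?thesis using True by (simp add: N_def)
    next
      case False
      then have "V u s r = 0" for s r by (auto simp: V_def)
      then show ?thesis using False by (simp add: N_def)
    qed
  qed
  from nn_integral_cong_AE[OF AE_completion[OF this]]
  have "(\<integral>\<^sup>+u. N u \<partial>lborel) = (\<integral>\<^sup>+u\<in>{a<..<x}. (\<integral>\<^sup>+s. \<integral>\<^sup>+r. ennreal (norm (P u * W u s r * \<phi> u)) \<partial>lborel \<partial>lborel) \<partial>lebesgue)"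
    by (simp only: nn_integral_completion)
  also have "\<dots> < \<infinity>" using H2 unfolding W_def P_def .
  finally have "(\<integral>\<^sup>+u. N u \<partial>lborel) \<noteq> \<infinity>" by simp
  from nn_integral_PInf_AE[OF Nm this] have aeN: "AE u in lborel. N u \<noteq> \<infinity>" .

  define C where "C = Gamma (- \<gamma>) / (of_real x powr \<gamma> * (2 * of_real pi * \<i>))"
  have rhs: "(LINT u:{a<..<x}|lebesgue. P u * Q u * \<phi> u) = (LINT u|lborel. C * (LINT s|lborel. LINT t|lborel. Z t u s))"
    unfolding set_lebesgue_integral_def
  proof (rule lebesgue_integral_eq_lborel)
    show "(\<lambda>u. C * (LINT s|lborel. LINT t|lborel. Z t u s)) \<in> borel_measurable lborel"
      unfolding Z_def by measurable
    show "AE u in lborel. indicator {a<..<x} u *\<^sub>R (P u * Q u * \<phi> u) = C * (LINT s|lborel. LINT t|lborel. Z t u s)"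
      using ae\<psi> aeN Fub(1)
    proof eventually_elim
      case (elim u)
      show ?case
      \<comment> \<open>Where \<psi> vanishes, finiteness carries no information about the contours,
        but both sides are 0. Elsewhere division by \<open>\<psi> u\<close> yields the integrability
        that places the contour.\<close>
      proof (cases "a < u \<and> u < x \<and> \<psi> u \<noteq> 0")
        case False
        then have "Z t u s = 0" for t s unfolding Z_def by auto
        then show ?thesis using False elim(1) by (auto simp: indicator_def)
      next
        case True
        then have u: "a < u" "u < x" and \<psi>0: "\<psi> u \<noteq> 0" by auto
        have P0: "P u \<noteq> 0" using u by (simp add: P_def)
        have Ze: "(\<lambda>(s, t). Z t u s) = (\<lambda>p. \<psi> u * (case p of (s, t) \<Rightarrow> A s * euler_integrand \<gamma> \<mu> u x (\<beta> + of_real \<alpha> * L s) t))"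
          unfolding Zeuler[OF u(1)] by (simp add: fun_eq_iff split_beta)
        from elim(3) have int: "integrable (lborel \<Otimes>\<^sub>M lborel) (\<lambda>(s, t). A s * euler_integrand \<gamma> \<mu> u x (\<beta> + of_real \<alpha> * L s) t)"
          unfolding Ze by (rule integrable_cancel[OF _ \<psi>0])
        have "N u < \<infinity>" using elim(2) by (simp add: less_top)
        have "inverse (P u * \<psi> u) * V u s r = W u s r" for s r using P0 \<psi>0 by (simp add: VW[OF u] field_simps)
        with nn_integral_pair_scale[OF Vm \<open>N u < \<infinity>\<close>[unfolded N_def], of "inverse (P u * \<psi> u)"]
        have fin: "(\<integral>\<^sup>+s. \<integral>\<^sup>+r. ennreal (norm (W u s r)) \<partial>lborel \<partial>lborel) < \<infinity>"
          by simp
        have same: "\<forall>t. u < t \<and> t < x \<longrightarrow> t \<noteq> 0" using nz u by auto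
        have "P u * Q u = C * (LINT s|lborel. LINT t|lborel. A s * euler_integrand \<gamma> \<mu> u x (\<beta> + of_real \<alpha> * L s) t)"
          unfolding P_def Q_def C_def
          by (rule fox_H2_eq_euler_integral[OF \<alpha> ap bq \<mu> w L L1 L2 u(2) nz[OF u] assms(13) v[OF u] same A_def int fin[unfolded W_def]])
        then show ?thesis unfolding Zeuler[OF u(1)] integral_mult_right_zero using u elim(1) by (simp add: mult_ac)
      qed
    qed
  qed
  \<comment> \<open>The value 0 would occur only at a pole, which the loop contour rules out; so
    this factor really cancels the one produced by the residues.\<close>
  have G0: "Gamma (- \<gamma>) \<noteq> 0" using loop_contour_nonpole[OF L2] by (simp add: Gamma_eq_zero_iff)
  have x0: "complex_of_real x powr \<gamma> \<noteq> 0" using assms(13) by simp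
  have pi0: "2 * complex_of_real pi * \<i> \<noteq> 0" by simp
  have alg: "e / g * (1 / q * y) = xg * e / (g * h) * (h / (xg * q) * y)" if "h \<noteq> 0" "xg \<noteq> 0" "q \<noteq> 0" for e g q y xg h :: complex
    using that by (simp add: field_simps)
  show ?thesis
    unfolding lhs P_def[symmetric] Q_def[symmetric] rhs integral_mult_right_zero T_def[symmetric]
    unfolding C_def by (rule alg[OF G0 x0 pi0])
qed

end
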